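(* Let $n,\ell,m\ge1$ be integers, $\kappa\in\mathbb C^\times$, $c=\kappa-m$, and $\nu\in\mathbb N^\ell$ a composition of $m$. Let $M$ be an almost smooth $\hat{\mathbf g}^F$-module of level $c$ and $M'$ an almost smooth $\hat{\mathbf g}^{F'}$-module of level $c$. Let $N={}^{\varkappa}M$ and $N''={}^{\varkappa'}M'$ be the $\hat{\mathbf g}$-modules obtained from $M$, $M'$ by transport through the Lie algebra isomorphisms $\varkappa:\hat{\mathbf g}^F\to\hat{\mathbf g}$, $\varkappa':\hat{\mathbf g}^{F'}\to\hat{\mathbf g}$. Then the $\mathbf R_{n,\ell}$-linear map $$T(M',M)_{\mathbf R_{n,\ell}}\to T(N'',N)_{\mathbf R_{n,1}}\otimes_{\mathbf R_{n,1}}\mathbf R_{n,\ell},\qquad u'\otimes v_1\otimes\cdots\otimes v_n\otimes u\mapsto u'\otimes\check\gamma(x_1)v_1\otimes\cdots\otimes\check\gamma(x_n)v_n\otimes u,$$ induces an isomorphism of $\mathbf B_{n,\ell}$-modules $$\mathfrak C(M',M)_{n,\ell}\to\mathfrak C(N'',N)_{n,1}\otimes_{\mathbf R_{n,1}}\mathbf R_{n,\ell}.$$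
   Context: **Group and rings.** $D_\ell\subset\mathbb C^\times$: group of $\ell$-th roots of unity with fixed generator $\varepsilon$; $W=\mathfrak S_n\ltimes (D_\ell)^n$; $\varepsilon_i$ has $\varepsilon$ at place $i$. $W$ acts on $\mathbb C[x_1,\dots,x_n]$ by $\varepsilon_i(x_i)=\varepsilon^{-1}x_i$, $\varepsilon_i(x_j)=x_j$ ($j\ne i$), $\mathfrak S_n$ permuting. $\mathbf R_{n,\ell}$ is the localization of $\mathbb C[x_1,\dots,x_n]$ at $x_1\cdots x_n\prod_{p\in\mathbb Z/\ell}\prod_{i\ne j}(x_i-\varepsilon^px_j)$, $\mathbf R_{n,1}$ the localization of $\mathbb C[y_1,\dots,y_n]$ at $y_1\cdots y_n\prod_{i\ne j}(y_i-y_j)$, embedded in $\mathbf R_{n,\ell}$ by $y_i\mapsto x_i^\ell$. $\mathbf B_{n,\ell}=\mathbb CW\ltimes\mathbf R_{n,\ell}$. **Lie algebras.** $\mathfrak g=\mathfrak{gl}_m(\mathbb C)$, $\langle\xi:\zeta\rangle=\mathrm{tr}(\xi\zeta)$; $\mathbf V=\mathbb C^m$ and its dual $\mathbf V^*$, on which $GL_m(\mathbb C)$ acts by the dual representation. $\{1,\dots,m\}=J_1\sqcup\dots\sqcup J_\ell$ is the partition into consecutive intervals with $|J_p|=\nu_p$. $\check\gamma$ is the diagonal matrix with $j$-th entry $-p$ for $j\in J_p$, also viewed as the cocharacter $\check\gamma(z)=\mathrm{diag}(z^{-p})_{j\in J_p}$ of the diagonal torus; $g=\check\gamma(\varepsilon)^{-1}$.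 $\mathfrak g(b)=\{\xi\in\mathfrak g:[\check\gamma,\xi]=b\xi\}$. $\hat{\mathbf g}=\mathfrak g\otimes\mathbb C[t,t^{-1}]\oplus\mathbb C\mathbf 1$, $\mathbf 1$ central, $[\xi\otimes f,\zeta\otimes h]=[\xi,\zeta]\otimes fh+\langle\xi:\zeta\rangle\mathrm{Res}_{t=0}(h\,df)\mathbf 1$, $\xi^{(a)}=\xi\otimes t^a$. $F(\xi^{(a)})=\varepsilon^a(g\xi g^{-1})^{(a)}$, $F'(\xi^{(a)})=\varepsilon^{-a}(g\xi g^{-1})^{(a)}$, $F(\mathbf 1)=F'(\mathbf 1)=\mathbf 1$; $\hat{\mathbf g}^F,\hat{\mathbf g}^{F'}$ are the fixed point Lie algebras. A module over one of them has level $c$ if $\mathbf 1$ acts by $c/\ell$, and is almost smooth if each element is killed by all elements of $\mathfrak g\otimes t^r\mathbb C[t]$ lying in the Lie algebra, for some large $r$. $\sharp\xi^{(a)}=(-1)^a\xi^{(-a)}$. The isomorphisms are: $\varkappa(\mathbf 1)=\mathbf 1/\ell$ and, for $\xi\in\mathfrak g(b)$, $a\equiv b\bmod\ell$, $\varkappa(\xi^{(a)})=(-1)^{a+(a-b)/\ell}\,\xi^{((a-b)/\ell)}-\delta_{a,0}\langle\check\gamma:\xi\rangle\mathbf 1/\ell$; $\varkappa'(\mathbf 1)=\mathbf 1/\ell$ and, for $\xi\in\mathfrak g(b)$, $a\equiv-b\bmod\ell$, $\varkappa'(\xi^{(a)})=\xi^{((a+b)/\ell)}+\delta_{a,0}\langle\check\gamma:\xi\rangle\mathbf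 1/\ell$. The modules ${}^\varkappa M$, ${}^{\varkappa'}M'$ have the same underlying spaces as $M$, $M'$, and $\varkappa(\eta)$ (resp. $\varkappa'(\eta)$) acts on them as $\eta$ acts on $M$ (resp. $M'$). **Coinvariants.** $T(M',M)=M'\otimes(\mathbf V^* )^{\otimes n}\otimes M$, factors numbered $0,1,\dots,n+1$; $(i)$ denotes action on the $i$-th factor. Let $\mathfrak g[\mathbb C^\times]=\mathfrak g\otimes\mathbb C[z,z^{-1}]$ and let $\mathfrak g[\mathbb C^\times]^F$ be the fixed points of $\xi\otimes f(z)\mapsto g\xi g^{-1}\otimes f(\varepsilon^{-1}z)$. It acts on $T(M',M)_{\mathbf R_{n,\ell}}=T(M',M)\otimes\mathbf R_{n,\ell}$ by $\xi\otimes z^a\mapsto(\xi^{(a)})_{(0)}+\sum_{i=1}^nx_i^a\xi_{(i)}+(\sharp\xi^{(a)})_{(n+1)}$, and $\mathfrak C(M',M)_{n,\ell}=H_0(\mathfrak g[\mathbb C^\times]^F,T(M',M)_{\mathbf R_{n,\ell}})$ (coinvariants). $\mathbf B_{n,\ell}$ acts on it: $\mathfrak S_n$ permutes the $\mathbf V^*$ factors and acts on $\mathbf R_{n,\ell}$, $\varepsilon_i$ acts by $g$ on the $i$-th $\mathbf V^*$ tensored with its action on $\mathbf R_{n,\ell}$. For $\hat{\mathbf g}$-modules $N'',N$ (on which $\mathbf 1$ acts by $c$), $\mathfrak C(N'',N)_{n,1}=H_0(\mathfrak g[\mathbb C^\times],T(N'',N)_{\mathbf R_{n,1}})$ is the same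 construction for $\ell=1$, $g=1$, with $y_i$ in place of $x_i$. On $\mathfrak C(N'',N)_{n,1}\otimes_{\mathbf R_{n,1}}\mathbf R_{n,\ell}$, $\mathfrak S_n$ acts diagonally and $\varepsilon_i$ acts only through $\mathbf R_{n,\ell}$. *)

theory Defs
  imports
    "HOL-Algebra.Module"
    "HOL-Algebra.AbelCoset"
    "HOL-Analysis.Determinants"
    "HOL-Computational_Algebra.Fraction_Field"
    "HOL-Library.Poly_Mapping"
begin

section \<open>Modules given by generators and relations\<close>

text \<open>Coefficient rings are subrings of a type of class \<^class>\<open>comm_ring_1\<close>, given by their carrier
  sets. The multiplicative fields of the module records below carry no meaning.\<close>

definition ring_on :: "'f::comm_ring_1 set \<Rightarrow> 'f ring" where
  "ring_on S = \<lparr>carrier = S, monoid.mult = (*), one = 1, zero = 0, add = (+)\<rparr>"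

definition lin_maps :: "'r ring \<Rightarrow> ('r, 'x) module \<Rightarrow> ('r, 'y) module \<Rightarrow> ('x \<Rightarrow> 'y) set" where
  "lin_maps R A B = {f \<in> carrier A \<rightarrow> carrier B.
     (\<forall>x\<in>carrier A. \<forall>y\<in>carrier A. f (x \<oplus>\<^bsub>A\<^esub> y) = f x \<oplus>\<^bsub>B\<^esub> f y) \<and>
     (\<forall>r\<in>carrier R. \<forall>x\<in>carrier A. f (r \<odot>\<^bsub>A\<^esub> x) = r \<odot>\<^bsub>B\<^esub> f x)}"

definition submodule_span :: "'r ring \<Rightarrow> ('r, 'x) module \<Rightarrow> 'x set \<Rightarrow> 'x set" where
  "submodule_span R A G = \<Inter>{B. submodule B R A \<and> G \<subseteq> B}"

definition quot_module :: "('r, 'x) module \<Rightarrow> 'x set \<Rightarrow> ('r, 'x set) module" where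
  "quot_module A B =
     \<lparr>carrier = a_rcosets\<^bsub>A\<^esub> B, monoid.mult = (\<lambda>_ _. B), one = B,
      zero = B, add = set_add A, smult = (\<lambda>r X. \<Union>x\<in>X. B +>\<^bsub>A\<^esub> (r \<odot>\<^bsub>A\<^esub> x))\<rparr>"

definition free_module :: "'f::comm_ring_1 set \<Rightarrow> 'x set \<Rightarrow> ('f, 'x \<Rightarrow>\<^sub>0 'f) module" where
  "free_module S X =
     \<lparr>carrier = {p. Poly_Mapping.keys p \<subseteq> X \<and> range (Poly_Mapping.lookup p) \<subseteq> S},
      monoid.mult = (\<lambda>_ _. 0), one = 0, zero = 0, add = (+),
      smult = (\<lambda>r. Poly_Mapping.map ((*) r))\<rparr>"

definition presented_module ::
  "'f::comm_ring_1 set \<Rightarrow> 'x set \<Rightarrow> ('x \<Rightarrow>\<^sub>0 'f) set \<Rightarrow> ('f, ('x \<Rightarrow>\<^sub>0 'f) set) module" where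
  "presented_module S X G =
     quot_module (free_module S X) (submodule_span (ring_on S) (free_module S X) G)"

definition presented_gen ::
  "'f::comm_ring_1 set \<Rightarrow> 'x set \<Rightarrow> ('x \<Rightarrow>\<^sub>0 'f) set \<Rightarrow> 'x \<Rightarrow> ('x \<Rightarrow>\<^sub>0 'f) set" where
  "presented_gen S X G x =
     submodule_span (ring_on S) (free_module S X) G +>\<^bsub>free_module S X\<^esub> Poly_Mapping.single x 1"

text \<open>The \<open>\<tau>\<close>-semilinear map out of a presented module that sends the generator \<open>x\<close> to \<open>\<phi> x\<close>.
  It is only used when \<open>\<tau>\<close> is a ring homomorphism and the relations are respected; then the value
  does not depend on the chosen representative.\<close>

definition presented_lift ::
  "('f::comm_ring_1 \<Rightarrow> 'r) \<Rightarrow> ('r, 'y) module \<Rightarrow> ('x \<Rightarrow> 'y) \<Rightarrow> ('x \<Rightarrow>\<^sub>0 'f) set \<Rightarrow> 'y" where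
  "presented_lift \<tau> B \<phi> Y =
     (let p = (SOME p. p \<in> Y)
      in \<Oplus>\<^bsub>B\<^esub>k\<in>Poly_Mapping.keys p. \<tau> (Poly_Mapping.lookup p k) \<odot>\<^bsub>B\<^esub> \<phi> k)"

text \<open>The map induced on a quotient by \<open>B\<close>, for \<open>f\<close> preserving \<open>B\<close>.\<close>

definition quot_map :: "('r, 'x) module \<Rightarrow> 'x set \<Rightarrow> ('x \<Rightarrow> 'x) \<Rightarrow> 'x set \<Rightarrow> 'x set" where
  "quot_map A B f Y = B +>\<^bsub>A\<^esub> f (SOME y. y \<in> Y)"

text \<open>Base change \<open>A \<otimes>\<^sub>R S\<close> of the \<open>R\<close>-module \<open>A\<close> along a ring homomorphism \<open>h : R \<rightarrow> S\<close>, as the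
  \<open>S\<close>-module generated by the symbols \<open>a \<otimes> s\<close>.\<close>

definition bc_relations ::
  "'r set \<Rightarrow> ('r \<Rightarrow> 's::comm_ring_1) \<Rightarrow> ('r, 'x) module \<Rightarrow> 's set \<Rightarrow> ('x \<times> 's \<Rightarrow>\<^sub>0 's) set" where
  "bc_relations R h A S =
     (let e = (\<lambda>a s. Poly_Mapping.single (a, s) 1) in
        {e (a \<oplus>\<^bsub>A\<^esub> a') s - e a s - e a' s |a a' s. a \<in> carrier A \<and> a' \<in> carrier A \<and> s \<in> S}
      \<union> {e a (s + s') - e a s - e a s' |a s s'. a \<in> carrier A \<and> s \<in> S \<and> s' \<in> S}
      \<union> {e (r \<odot>\<^bsub>A\<^esub> a) s - e a (h r * s) |r a s. r \<in> R \<and> a \<in> carrier A \<and> s \<in> S}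
      \<union> {e a (s' * s) - Poly_Mapping.single (a, s) s' |a s s'. a \<in> carrier A \<and> s \<in> S \<and> s' \<in> S})"

definition base_change ::
  "'r set \<Rightarrow> ('r \<Rightarrow> 's::comm_ring_1) \<Rightarrow> ('r, 'x) module \<Rightarrow> 's set \<Rightarrow> ('s, ('x \<times> 's \<Rightarrow>\<^sub>0 's) set) module"
where
  "base_change R h A S = presented_module S (carrier A \<times> S) (bc_relations R h A S)"

definition bc_tensor ::
  "'r set \<Rightarrow> ('r \<Rightarrow> 's::comm_ring_1) \<Rightarrow> ('r, 'x) module \<Rightarrow> 's set \<Rightarrow> 'x \<Rightarrow> 's \<Rightarrow> ('x \<times> 's \<Rightarrow>\<^sub>0 's) set"
where
  "bc_tensor R h A S a s = presented_gen S (carrier A \<times> S) (bc_relations R h A S) (a, s)"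


section \<open>The rings \<open>R\<^sub>n\<^sub>,\<^sub>l\<close> and the group \<open>W\<close>\<close>

text \<open>The variables are indexed by a finite type \<open>'n\<close> with \<open>CARD('n) = n\<close>. Its order is only used
  to see that the polynomial ring is a domain; the localizations are subrings of its field of
  fractions.\<close>

type_synonym 'n pol = "('n \<Rightarrow>\<^sub>0 nat) \<Rightarrow>\<^sub>0 complex"
type_synonym 'n ratf = "'n pol fract"

definition pconst :: "complex \<Rightarrow> 'n pol" where
  "pconst c = Poly_Mapping.single 0 c"

definition pvar :: "'n \<Rightarrow> 'n pol" where
  "pvar i = Poly_Mapping.single (Poly_Mapping.single i 1) 1"

definition rconst :: "complex \<Rightarrow> 'n::{finite,linorder} ratf" where
  "rconst c = Fraction_Field.Fract (pconst c) 1"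

definition xvar :: "'n \<Rightarrow> 'n::{finite,linorder} ratf" where
  "xvar i = Fraction_Field.Fract (pvar i) 1"

definition discr :: "complex \<Rightarrow> nat \<Rightarrow> 'n::{finite,linorder} pol" where
  "discr \<epsilon> l = (\<Prod>i\<in>UNIV. pvar i) *
     (\<Prod>p<l. \<Prod>i\<in>UNIV. \<Prod>j\<in>UNIV - {i}. pvar i - pconst (\<epsilon> ^ p) * pvar j)"

text \<open>The ring \<open>R\<^sub>n\<^sub>,\<^sub>1\<close>, whose variables are usually called \<open>y\<^sub>i\<close>, is \<open>Rloc 1 1\<close>; \<open>emb\<close> below is its
  embedding \<open>y\<^sub>i \<mapsto> x\<^sub>i^l\<close> into \<open>R\<^sub>n\<^sub>,\<^sub>l\<close>.\<close>

definition Rloc :: "complex \<Rightarrow> nat \<Rightarrow> 'n::{finite,linorder} ratf set" where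
  "Rloc \<epsilon> l = {Fraction_Field.Fract f (discr \<epsilon> l ^ k) |f k. True}"

definition pol_eval :: "('n \<Rightarrow> 'n ratf) \<Rightarrow> 'n pol \<Rightarrow> 'n::{finite,linorder} ratf" where
  "pol_eval a p = (\<Sum>m\<in>Poly_Mapping.keys p.
     rconst (Poly_Mapping.lookup p m) * (\<Prod>i\<in>UNIV. a i ^ Poly_Mapping.lookup m i))"

text \<open>The substitution \<open>x\<^sub>i \<mapsto> a i\<close> in a rational function, for algebraically independent \<open>a i\<close>.\<close>

definition frac_subst :: "('n \<Rightarrow> 'n ratf) \<Rightarrow> 'n ratf \<Rightarrow> 'n::{finite,linorder} ratf" where
  "frac_subst a f =
     (let (p, q) = (SOME (p, q). q \<noteq> 0 \<and> f = Fraction_Field.Fract p q)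
      in pol_eval a p / pol_eval a q)"

definition emb :: "nat \<Rightarrow> 'n ratf \<Rightarrow> 'n::{finite,linorder} ratf" where
  "emb l = frac_subst (\<lambda>i. xvar i ^ l)"

definition roots_group :: "nat \<Rightarrow> complex set" where
  "roots_group l = {z. z ^ l = 1}"

text \<open>The pair \<open>(\<sigma>, d)\<close> stands for the element \<open>\<sigma> \<cdot> \<Prod>\<^sub>i \<epsilon>\<^sub>i^(d i)\<close> of \<open>W\<close>.\<close>

type_synonym 'n wreath = "('n \<Rightarrow> 'n) \<times> ('n \<Rightarrow> nat)"

definition Wgrp :: "nat \<Rightarrow> 'n wreath set" where
  "Wgrp l = {(\<sigma>, d). bij \<sigma> \<and> (\<forall>i. d i < l)}"

definition W_ring :: "complex \<Rightarrow> 'n wreath \<Rightarrow> 'n ratf \<Rightarrow> 'n::{finite,linorder} ratf" where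
  "W_ring \<epsilon> w = frac_subst (\<lambda>i. rconst (inverse \<epsilon> ^ snd w i) * xvar (fst w i))"

text \<open>Elements \<open>\<Sum>\<^sub>w b\<^sub>w w\<close> of \<open>B\<^sub>n\<^sub>,\<^sub>l = CW \<ltimes> R\<^sub>n\<^sub>,\<^sub>l\<close>, as the families of their coefficients.\<close>

definition Balg :: "complex \<Rightarrow> nat \<Rightarrow> ('n wreath \<Rightarrow> 'n::{finite,linorder} ratf) set" where
  "Balg \<epsilon> l = {b. \<forall>w\<in>Wgrp l. b w \<in> Rloc \<epsilon> l}"


section \<open>The affine Lie algebra and its twisted forms\<close>

text \<open>\<open>\<Sum>\<^sub>a X\<^sub>a t^a\<close> in \<open>gl\<^sub>m[t, t^-1]\<close> is the finitely supported function \<open>a \<mapsto> X\<^sub>a\<close>, with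
  \<open>m = CARD('m)\<close>; the pair \<open>(X, s)\<close> is the element \<open>X + s 1\<close> of the affine Lie algebra.\<close>

type_synonym ('f, 'm) sqmat = "(('f, 'm) vec, 'm) vec"
type_synonym 'm loop = "int \<Rightarrow>\<^sub>0 (complex, 'm) sqmat"
type_synonym 'm affine = "'m loop \<times> complex"

definition mscale :: "'f::times \<Rightarrow> ('f, 'm::finite) sqmat \<Rightarrow> ('f, 'm) sqmat" where
  "mscale c A = (\<chi> i j. c * A $ i $ j)"

definition commutator :: "(complex, 'm) sqmat \<Rightarrow> (complex, 'm) sqmat \<Rightarrow> (complex, 'm::finite) vec ^ 'm" where
  "commutator A B = A ** B - B ** A"

definition aff_scale :: "complex \<Rightarrow> 'm affine \<Rightarrow> 'm::finite affine" where
  "aff_scale c \<eta> = (Poly_Mapping.map (mscale c) (fst \<eta>), c * snd \<eta>)"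

text \<open>The central term uses \<open>Res (t^b d(t^a)) = a\<close> if \<open>a + b = 0\<close>, and \<open>0\<close> otherwise.\<close>

definition aff_bracket :: "'m affine \<Rightarrow> 'm affine \<Rightarrow> 'm::finite affine" where
  "aff_bracket \<eta> \<theta> =
     (\<Sum>a\<in>Poly_Mapping.keys (fst \<eta>). \<Sum>b\<in>Poly_Mapping.keys (fst \<theta>).
        (Poly_Mapping.single (a + b)
           (commutator (Poly_Mapping.lookup (fst \<eta>) a) (Poly_Mapping.lookup (fst \<theta>) b)),
         if a + b = 0
         then trace (Poly_Mapping.lookup (fst \<eta>) a ** Poly_Mapping.lookup (fst \<theta>) b) * of_int a
         else 0))"

text \<open>\<open>block \<nu> j\<close> is the \<open>p\<close> with \<open>j \<in> J\<^sub>p\<close>; note that \<open>card {..j}\<close> is the position of \<open>j\<close>.\<close>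

definition block :: "(nat \<Rightarrow> nat) \<Rightarrow> 'm::{finite,linorder} \<Rightarrow> nat" where
  "block \<nu> j = (LEAST p. card {..j} \<le> (\<Sum>q=1..p. \<nu> q))"

definition gcheck :: "(nat \<Rightarrow> nat) \<Rightarrow> (complex, 'm::{finite,linorder}) sqmat" where
  "gcheck \<nu> = (\<chi> i j. if i = j then - of_nat (block \<nu> i) else 0)"

definition cochar :: "(nat \<Rightarrow> nat) \<Rightarrow> 'f::field \<Rightarrow> ('f, 'm::{finite,linorder}) sqmat" where
  "cochar \<nu> z = (\<chi> i j. if i = j then z powi (- int (block \<nu> i)) else 0)"

definition geps :: "(nat \<Rightarrow> nat) \<Rightarrow> complex \<Rightarrow> (complex, 'm::{finite,linorder}) sqmat" where
  "geps \<nu> \<epsilon> = matrix_inv (cochar \<nu> \<epsilon>)"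

definition geigen :: "(nat \<Rightarrow> nat) \<Rightarrow> int \<Rightarrow> ((complex, 'm::{finite,linorder}) sqmat) set" where
  "geigen \<nu> b = {\<xi>. commutator (gcheck \<nu>) \<xi> = mscale (of_int b) \<xi>}"

text \<open>\<open>\<xi> \<otimes> f(t) \<mapsto> g \<xi> g^-1 \<otimes> f(e t)\<close>. Thus \<open>F\<close> is given by \<open>e = \<epsilon>\<close>, and both \<open>F'\<close> and the
  automorphism of \<open>gl\<^sub>m[z, z^-1]\<close> by \<open>e = \<epsilon>^-1\<close>.\<close>

definition loop_twist ::
  "(complex, 'm) sqmat \<Rightarrow> complex \<Rightarrow> 'm loop \<Rightarrow> 'm::finite loop" where
  "loop_twist g e X =
     Poly_Mapping.mapp (\<lambda>a \<xi>. mscale (e powi a) (g ** \<xi> ** matrix_inv g)) X"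

definition loop_fixed :: "(complex, 'm) sqmat \<Rightarrow> complex \<Rightarrow> ('m::finite loop) set" where
  "loop_fixed g e = {X. loop_twist g e X = X}"

definition aff_fixed :: "(complex, 'm) sqmat \<Rightarrow> complex \<Rightarrow> ('m::finite affine) set" where
  "aff_fixed g e = {\<eta>. (loop_twist g e (fst \<eta>), snd \<eta>) = \<eta>}"

definition laff :: "(complex, 'm) sqmat \<Rightarrow> int \<Rightarrow> 'm::finite affine" where
  "laff \<xi> a = (Poly_Mapping.single a \<xi>, 0)"

definition sharp :: "(complex, 'm) sqmat \<Rightarrow> int \<Rightarrow> 'm::finite affine" where
  "sharp \<xi> a = laff (mscale ((-1) powi a) \<xi>) (- a)"

definition geigen_proj ::
  "(nat \<Rightarrow> nat) \<Rightarrow> int \<Rightarrow> (complex, 'm) sqmat \<Rightarrow> (complex, 'm::{finite,linorder}) sqmat" where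
  "geigen_proj \<nu> b \<xi> = (\<chi> i j. if int (block \<nu> j) - int (block \<nu> i) = b then \<xi> $ i $ j else 0)"

text \<open>\<open>kappa\<close> and \<open>kappa'\<close> are given by the formulas on homogeneous elements, extended linearly; see
  the lemmas \<open>kappa_homogeneous\<close> and \<open>kappa'_homogeneous\<close>. All eigenvalues \<open>b\<close> that occur satisfy
  \<open>\<bar>b\<bar> < l\<close>, and on fixed points only those with \<open>l\<close> dividing \<open>a - b\<close> (resp. \<open>a + b\<close>) contribute.\<close>

definition kappa :: "(nat \<Rightarrow> nat) \<Rightarrow> nat \<Rightarrow> 'm affine \<Rightarrow> 'm::{finite,linorder} affine" where
  "kappa \<nu> l \<eta> =
     (\<Sum>a\<in>Poly_Mapping.keys (fst \<eta>). \<Sum>b\<in>{- int l..int l}.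
        Poly_Mapping.single ((a - b) div int l)
          (mscale ((-1) powi (a + (a - b) div int l))
             (geigen_proj \<nu> b (Poly_Mapping.lookup (fst \<eta>) a))),
      snd \<eta> / of_nat l - trace (gcheck \<nu> ** Poly_Mapping.lookup (fst \<eta>) 0) / of_nat l)"

definition kappa' :: "(nat \<Rightarrow> nat) \<Rightarrow> nat \<Rightarrow> 'm affine \<Rightarrow> 'm::{finite,linorder} affine" where
  "kappa' \<nu> l \<eta> =
     (\<Sum>a\<in>Poly_Mapping.keys (fst \<eta>). \<Sum>b\<in>{- int l..int l}.
        Poly_Mapping.single ((a + b) div int l)
          (geigen_proj \<nu> b (Poly_Mapping.lookup (fst \<eta>) a)),
      snd \<eta> / of_nat l + trace (gcheck \<nu> ** Poly_Mapping.lookup (fst \<eta>) 0) / of_nat l)"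

lemma block_le:
  assumes "(\<Sum>p=1..l. \<nu> p) = CARD('m)"
  shows "block \<nu> (j::'m::{finite,linorder}) \<le> l"
  unfolding block_def by (rule Least_le) (simp only: assms card_mono finite subset_UNIV)

lemma geigen_entry:
  assumes "\<xi> \<in> geigen \<nu> b" "\<xi> $ i $ j \<noteq> 0"
  shows "int (block \<nu> j) - int (block \<nu> i) = b"
proof -
  let ?D = "gcheck \<nu>"
  have l: "(?D ** \<xi>) $ i $ j = - of_nat (block \<nu> i) * \<xi> $ i $ j"
    by (simp add: matrix_matrix_mult_def gcheck_def if_distribR if_distrib cong: if_cong)
  have r: "(\<xi> ** ?D) $ i $ j = \<xi> $ i $ j * - of_nat (block \<nu> j)"
    by (simp add: matrix_matrix_mult_def gcheck_def if_distribR if_distrib cong: if_cong)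
  have "commutator ?D \<xi> $ i $ j = mscale (of_int b) \<xi> $ i $ j"
    using assms(1) by (simp add: geigen_def)
  hence "(of_nat (block \<nu> j) - of_nat (block \<nu> i)) * \<xi> $ i $ j = of_int b * \<xi> $ i $ j"
    by (simp add: commutator_def mscale_def l r algebra_simps)
  hence "of_int (int (block \<nu> j) - int (block \<nu> i)) = (of_int b :: complex)"
    using assms(2) by simp
  thus ?thesis by (simp only: of_int_eq_iff)
qed

lemma geigen_proj_geigen:
  assumes "\<xi> \<in> geigen \<nu> b"
  shows "geigen_proj \<nu> b' \<xi> = (if b' = b then \<xi> else 0)"
  using geigen_entry[OF assms] by (auto simp: geigen_proj_def vec_eq_iff)

lemma geigen_bound:
  fixes \<xi> :: "(complex, 'm::{finite,linorder}) sqmat"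
  assumes "\<xi> \<in> geigen \<nu> b" "\<xi> \<noteq> 0" "(\<Sum>p=1..l. \<nu> p) = CARD('m)"
  shows "b \<in> {- int l..int l}"
proof -
  obtain i j where "\<xi> $ i $ j \<noteq> 0"
    using assms(2) by (auto simp: vec_eq_iff)
  from geigen_entry[OF assms(1) this] block_le[OF assms(3), of i] block_le[OF assms(3), of j]
  show ?thesis by auto
qed

lemma kappa_central: "kappa \<nu> l (0, 1) = (0, 1 / of_nat l)" "kappa' \<nu> l (0, 1) = (0, 1 / of_nat l)"
  by (simp_all add: kappa_def kappa'_def matrix_matrix_mult_def trace_def)

lemma kappa_homogeneous:
  fixes \<xi> :: "(complex, 'm::{finite,linorder}) sqmat"
  assumes "(\<Sum>p=1..l. \<nu> p) = CARD('m)" "\<xi> \<in> geigen \<nu> b"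
  shows "kappa \<nu> l (laff \<xi> a) =
    (Poly_Mapping.single ((a - b) div int l) (mscale ((-1) powi (a + (a - b) div int l)) \<xi>),
     - (if a = 0 then trace (gcheck \<nu> ** \<xi>) / of_nat l else 0))"
proof (cases "\<xi> = 0")
  case True
  have "mscale c (0 :: (complex, 'm) sqmat) = 0" for c by (simp add: mscale_def vec_eq_iff)
  with True show ?thesis
    by (simp add: kappa_def laff_def matrix_matrix_mult_def trace_def)
next
  case False
  have m0: "mscale c (0 :: (complex, 'm) sqmat) = 0" for c by (simp add: mscale_def vec_eq_iff)
  have t0: "trace (0 :: (complex, 'm) sqmat) = 0"
    by (simp add: trace_def)
  have "(\<Sum>b'\<in>{- int l..int l}. Poly_Mapping.single ((a - b') div int l)
          (mscale ((-1) powi (a + (a - b') div int l)) (geigen_proj \<nu> b' \<xi>))) =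
        (\<Sum>b'\<in>{- int l..int l}. if b' = b then Poly_Mapping.single ((a - b) div int l)
          (mscale ((-1) powi (a + (a - b) div int l)) \<xi>) else 0)"
    by (intro sum.cong) (auto simp: geigen_proj_geigen[OF assms(2)] m0)
  with False geigen_bound[OF assms(2) False assms(1)] show ?thesis
    by (auto simp: kappa_def laff_def t0 lookup_single when_def)
qed

lemma kappa'_homogeneous:
  fixes \<xi> :: "(complex, 'm::{finite,linorder}) sqmat"
  assumes "(\<Sum>p=1..l. \<nu> p) = CARD('m)" "\<xi> \<in> geigen \<nu> b"
  shows "kappa' \<nu> l (laff \<xi> a) =
    (Poly_Mapping.single ((a + b) div int l) \<xi>,
     if a = 0 then trace (gcheck \<nu> ** \<xi>) / of_nat l else 0)"
proof (cases "\<xi> = 0")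
  case True
  thus ?thesis
    by (simp add: kappa'_def laff_def matrix_matrix_mult_def trace_def)
next
  case False
  have t0: "trace (0 :: (complex, 'm) sqmat) = 0"
    by (simp add: trace_def)
  have "(\<Sum>b'\<in>{- int l..int l}. Poly_Mapping.single ((a + b') div int l) (geigen_proj \<nu> b' \<xi>)) =
        (\<Sum>b'\<in>{- int l..int l}. if b' = b then Poly_Mapping.single ((a + b) div int l) \<xi> else 0)"
    by (intro sum.cong) (auto simp: geigen_proj_geigen[OF assms(2)])
  with False geigen_bound[OF assms(2) False assms(1)] show ?thesis
    by (auto simp: kappa'_def laff_def t0 lookup_single when_def)
qed


section \<open>Modules over the twisted affine Lie algebras\<close>

text \<open>\<open>L\<close> is a Lie subalgebra of the affine Lie algebra, acting on the complex vector space \<open>M\<close>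
  through \<open>\<rho>\<close>.\<close>

definition lie_module ::
  "('m::finite affine) set \<Rightarrow> (complex, 'a) module \<Rightarrow> ('m affine \<Rightarrow> 'a \<Rightarrow> 'a) \<Rightarrow> bool" where
  "lie_module L M \<rho> \<longleftrightarrow>
     Module.module (ring_on UNIV) M \<and>
     (\<forall>\<eta>\<in>L. \<rho> \<eta> \<in> lin_maps (ring_on UNIV) M M) \<and>
     (\<forall>\<eta>\<in>L. \<forall>\<theta>\<in>L. \<forall>u\<in>carrier M. \<rho> (\<eta> + \<theta>) u = \<rho> \<eta> u \<oplus>\<^bsub>M\<^esub> \<rho> \<theta> u) \<and>
     (\<forall>k. \<forall>\<eta>\<in>L. \<forall>u\<in>carrier M. \<rho> (aff_scale k \<eta>) u = k \<odot>\<^bsub>M\<^esub> \<rho> \<eta> u) \<and>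
     (\<forall>\<eta>\<in>L. \<forall>\<theta>\<in>L. \<forall>u\<in>carrier M.
        \<rho> (aff_bracket \<eta> \<theta>) u = \<rho> \<eta> (\<rho> \<theta> u) \<ominus>\<^bsub>M\<^esub> \<rho> \<theta> (\<rho> \<eta> u))"

definition has_level ::
  "nat \<Rightarrow> complex \<Rightarrow> (complex, 'a) module \<Rightarrow> ('m::finite affine \<Rightarrow> 'a \<Rightarrow> 'a) \<Rightarrow> bool" where
  "has_level l c M \<rho> \<longleftrightarrow> (\<forall>u\<in>carrier M. \<rho> (0, 1) u = (c / of_nat l) \<odot>\<^bsub>M\<^esub> u)"

definition almost_smooth ::
  "('m::finite affine) set \<Rightarrow> (complex, 'a) module \<Rightarrow> ('m affine \<Rightarrow> 'a \<Rightarrow> 'a) \<Rightarrow> bool" where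
  "almost_smooth L M \<rho> \<longleftrightarrow>
     (\<forall>u\<in>carrier M. \<exists>r::nat. \<forall>X. (X, 0) \<in> L \<and> Poly_Mapping.keys X \<subseteq> {int r..} \<longrightarrow>
        \<rho> (X, 0) u = \<zero>\<^bsub>M\<^esub>)"

text \<open>The module transported through \<open>k : L \<rightarrow> L'\<close> keeps its underlying space; \<open>k \<eta>\<close> acts on it as \<open>\<eta>\<close>
  did before.\<close>

definition transport ::
  "('m::finite affine) set \<Rightarrow> ('m affine \<Rightarrow> 'm affine) \<Rightarrow> ('m affine \<Rightarrow> 'a \<Rightarrow> 'a) \<Rightarrow>
     'm affine \<Rightarrow> 'a \<Rightarrow> 'a" where
  "transport L k \<rho> \<theta> = \<rho> (inv_into L k \<theta>)"


section \<open>Tensor products and coinvariants\<close>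

text \<open>Elements of \<open>V\<^sup>*\<close> are written in the basis dual to the standard basis of \<open>V\<close>.\<close>

definition dual_lie :: "(complex, 'm) sqmat \<Rightarrow> (complex, 'm) vec \<Rightarrow> (complex, 'm::finite) vec" where
  "dual_lie \<xi> v = - (transpose \<xi> *v v)"

definition dual_grp :: "('f::field, 'm) sqmat \<Rightarrow> ('f, 'm) vec \<Rightarrow> ('f, 'm::finite) vec" where
  "dual_grp h v = transpose (matrix_inv h) *v v"

type_synonym ('a, 'n, 'm, 'b) tgen = "'a \<times> ('n \<Rightarrow> (complex, 'm) vec) \<times> 'b"
type_synonym ('a, 'n, 'm, 'b) tens =
  "('a \<times> ('n \<Rightarrow> (complex, 'm) vec) \<times> 'b \<Rightarrow>\<^sub>0 complex) set"
type_synonym ('a, 'n, 'm, 'b) tensR =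
  "(('a, 'n, 'm, 'b) tens \<times> 'n ratf \<Rightarrow>\<^sub>0 'n ratf) set"

definition T_gens ::
  "(complex, 'a) module \<Rightarrow> (complex, 'b) module \<Rightarrow> ('a, 'n, 'm::finite, 'b) tgen set" where
  "T_gens M' M = carrier M' \<times> UNIV \<times> carrier M"

definition T_relations ::
  "(complex, 'a) module \<Rightarrow> (complex, 'b) module \<Rightarrow>
     (('a, 'n, 'm::finite, 'b) tgen \<Rightarrow>\<^sub>0 complex) set" where
  "T_relations M' M =
     (let e = (\<lambda>c u' v u. Poly_Mapping.single (u', v, u) c) in
        {e 1 (c \<odot>\<^bsub>M'\<^esub> x \<oplus>\<^bsub>M'\<^esub> y) v u - e c x v u - e 1 y v u |c x y v u.
           x \<in> carrier M' \<and> y \<in> carrier M' \<and> u \<in> carrier M}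
      \<union> {e 1 u' (v(i := c *s x + y)) u - e c u' (v(i := x)) u - e 1 u' (v(i := y)) u |c u' v i x y u.
           u' \<in> carrier M' \<and> u \<in> carrier M}
      \<union> {e 1 u' v (c \<odot>\<^bsub>M\<^esub> x \<oplus>\<^bsub>M\<^esub> y) - e c u' v x - e 1 u' v y |c u' v x y.
           u' \<in> carrier M' \<and> x \<in> carrier M \<and> y \<in> carrier M})"

definition T_mod ::
  "(complex, 'a) module \<Rightarrow> (complex, 'b) module \<Rightarrow>
     (complex, ('a, 'n, 'm::finite, 'b) tens) module" where
  "T_mod M' M = presented_module UNIV (T_gens M' M) (T_relations M' M)"

definition T_pure ::
  "(complex, 'a) module \<Rightarrow> (complex, 'b) module \<Rightarrow>
     'a \<Rightarrow> ('n \<Rightarrow> (complex, 'm) vec) \<Rightarrow> 'b \<Rightarrow> ('a, 'n, 'm::finite, 'b) tens" where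
  "T_pure M' M u' v u = presented_gen UNIV (T_gens M' M) (T_relations M' M) (u', v, u)"

text \<open>Linear operators acting on the factor \<open>0\<close>, the factor \<open>i\<close> and the factor \<open>n + 1\<close> of \<open>T(M', M)\<close>.\<close>

definition act_first ::
  "(complex, 'a) module \<Rightarrow> (complex, 'b) module \<Rightarrow> ('a \<Rightarrow> 'a) \<Rightarrow>
     ('a, 'n, 'm, 'b) tens \<Rightarrow> ('a, 'n, 'm::finite, 'b) tens" where
  "act_first M' M A =
     presented_lift id (T_mod M' M) (\<lambda>(u', v, u). T_pure M' M (A u') v u)"

definition act_mid ::
  "(complex, 'a) module \<Rightarrow> (complex, 'b) module \<Rightarrow> 'n \<Rightarrow> ((complex, 'm) vec \<Rightarrow> (complex, 'm) vec) \<Rightarrow>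
     ('a, 'n, 'm, 'b) tens \<Rightarrow> ('a, 'n, 'm::finite, 'b) tens" where
  "act_mid M' M i A =
     presented_lift id (T_mod M' M) (\<lambda>(u', v, u). T_pure M' M u' (v(i := A (v i))) u)"

definition act_last ::
  "(complex, 'a) module \<Rightarrow> (complex, 'b) module \<Rightarrow> ('b \<Rightarrow> 'b) \<Rightarrow>
     ('a, 'n, 'm, 'b) tens \<Rightarrow> ('a, 'n, 'm::finite, 'b) tens" where
  "act_last M' M A =
     presented_lift id (T_mod M' M) (\<lambda>(u', v, u). T_pure M' M u' v (A u))"

definition TR_mod ::
  "complex \<Rightarrow> nat \<Rightarrow> (complex, 'a) module \<Rightarrow> (complex, 'b) module \<Rightarrow>
     ('n ratf, ('a, 'n::{finite,linorder}, 'm::finite, 'b) tensR) module" where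
  "TR_mod \<epsilon> l M' M = base_change UNIV rconst (T_mod M' M) (Rloc \<epsilon> l)"

definition TR_tensor ::
  "complex \<Rightarrow> nat \<Rightarrow> (complex, 'a) module \<Rightarrow> (complex, 'b) module \<Rightarrow>
     ('a, 'n, 'm, 'b) tens \<Rightarrow> 'n ratf \<Rightarrow> ('a, 'n::{finite,linorder}, 'm::finite, 'b) tensR" where
  "TR_tensor \<epsilon> l M' M = bc_tensor UNIV rconst (T_mod M' M) (Rloc \<epsilon> l)"

text \<open>The operator of \<open>X = \<Sum>\<^sub>a X\<^sub>a \<otimes> z^a\<close> on \<open>T(M', M)\<^sub>R\<close>.\<close>

definition loop_act ::
  "complex \<Rightarrow> nat \<Rightarrow> (complex, 'a) module \<Rightarrow> ('m affine \<Rightarrow> 'a \<Rightarrow> 'a) \<Rightarrow>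
     (complex, 'b) module \<Rightarrow> ('m affine \<Rightarrow> 'b \<Rightarrow> 'b) \<Rightarrow> 'm loop \<Rightarrow>
     ('a, 'n, 'm, 'b) tensR \<Rightarrow> ('a, 'n::{finite,linorder}, 'm::finite, 'b) tensR" where
  "loop_act \<epsilon> l M' \<rho>' M \<rho> X =
     presented_lift id (TR_mod \<epsilon> l M' M)
       (\<lambda>(t, f). \<Oplus>\<^bsub>TR_mod \<epsilon> l M' M\<^esub>a\<in>Poly_Mapping.keys X.
          (let \<xi> = Poly_Mapping.lookup X a in
             TR_tensor \<epsilon> l M' M (act_first M' M (\<rho>' (laff \<xi> a)) t) f
             \<oplus>\<^bsub>TR_mod \<epsilon> l M' M\<^esub>
             (\<Oplus>\<^bsub>TR_mod \<epsilon> l M' M\<^esub>i\<in>UNIV.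
                TR_tensor \<epsilon> l M' M (act_mid M' M i (dual_lie \<xi>) t) (xvar i powi a * f))
             \<oplus>\<^bsub>TR_mod \<epsilon> l M' M\<^esub>
             TR_tensor \<epsilon> l M' M (act_last M' M (\<rho> (sharp \<xi> a)) t) f))"

text \<open>The image of the action of the twisted loop algebra. The action being \<open>R\<close>-linear, this is the
  \<open>R\<close>-submodule it spans.\<close>

definition coinv_kernel ::
  "complex \<Rightarrow> nat \<Rightarrow> (complex, 'm) sqmat \<Rightarrow>
     (complex, 'a) module \<Rightarrow> ('m affine \<Rightarrow> 'a \<Rightarrow> 'a) \<Rightarrow>
     (complex, 'b) module \<Rightarrow> ('m affine \<Rightarrow> 'b \<Rightarrow> 'b) \<Rightarrow>
     ('a, 'n::{finite,linorder}, 'm::finite, 'b) tensR set" where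
  "coinv_kernel \<epsilon> l g M' \<rho>' M \<rho> =
     submodule_span (ring_on (Rloc \<epsilon> l)) (TR_mod \<epsilon> l M' M)
       {loop_act \<epsilon> l M' \<rho>' M \<rho> X t |X t.
          X \<in> loop_fixed g (inverse \<epsilon>) \<and> t \<in> carrier (TR_mod \<epsilon> l M' M)}"

definition coinv ::
  "complex \<Rightarrow> nat \<Rightarrow> (complex, 'm) sqmat \<Rightarrow>
     (complex, 'a) module \<Rightarrow> ('m affine \<Rightarrow> 'a \<Rightarrow> 'a) \<Rightarrow>
     (complex, 'b) module \<Rightarrow> ('m affine \<Rightarrow> 'b \<Rightarrow> 'b) \<Rightarrow>
     ('n ratf, ('a, 'n::{finite,linorder}, 'm::finite, 'b) tensR set) module" where
  "coinv \<epsilon> l g M' \<rho>' M \<rho> = quot_module (TR_mod \<epsilon> l M' M) (coinv_kernel \<epsilon> l g M' \<rho>' M \<rho>)"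

definition coinv_proj ::
  "complex \<Rightarrow> nat \<Rightarrow> (complex, 'm) sqmat \<Rightarrow>
     (complex, 'a) module \<Rightarrow> ('m affine \<Rightarrow> 'a \<Rightarrow> 'a) \<Rightarrow>
     (complex, 'b) module \<Rightarrow> ('m affine \<Rightarrow> 'b \<Rightarrow> 'b) \<Rightarrow>
     ('a, 'n, 'm, 'b) tensR \<Rightarrow> ('a, 'n::{finite,linorder}, 'm::finite, 'b) tensR set" where
  "coinv_proj \<epsilon> l g M' \<rho>' M \<rho> t = coinv_kernel \<epsilon> l g M' \<rho>' M \<rho> +>\<^bsub>TR_mod \<epsilon> l M' M\<^esub> t"

text \<open>\<open>(\<sigma>, d)\<close> moves the vector \<open>g^(d i) v\<^sub>i\<close> to the place \<open>\<sigma> i\<close>. Powers of \<open>g\<close> are written as iterated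
  maps because \<open>^\<close> on \<^type>\<open>vec\<close> is componentwise.\<close>

definition W_T ::
  "(complex, 'm) sqmat \<Rightarrow> (complex, 'a) module \<Rightarrow> (complex, 'b) module \<Rightarrow> 'n wreath \<Rightarrow>
     ('a, 'n, 'm, 'b) tens \<Rightarrow> ('a, 'n, 'm::finite, 'b) tens" where
  "W_T g M' M w =
     presented_lift id (T_mod M' M)
       (\<lambda>(u', v, u). T_pure M' M u'
          (\<lambda>j. let i = inv_into UNIV (fst w) j in (dual_grp g ^^ snd w i) (v i)) u)"

definition W_TR ::
  "complex \<Rightarrow> nat \<Rightarrow> (complex, 'm) sqmat \<Rightarrow> (complex, 'a) module \<Rightarrow> (complex, 'b) module \<Rightarrow>
     'n wreath \<Rightarrow> ('a, 'n, 'm, 'b) tensR \<Rightarrow> ('a, 'n::{finite,linorder}, 'm::finite, 'b) tensR" where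
  "W_TR \<epsilon> l g M' M w =
     presented_lift (W_ring \<epsilon> w) (TR_mod \<epsilon> l M' M)
       (\<lambda>(t, f). TR_tensor \<epsilon> l M' M (W_T g M' M w t) (W_ring \<epsilon> w f))"

definition W_coinv ::
  "complex \<Rightarrow> nat \<Rightarrow> (complex, 'm) sqmat \<Rightarrow>
     (complex, 'a) module \<Rightarrow> ('m affine \<Rightarrow> 'a \<Rightarrow> 'a) \<Rightarrow>
     (complex, 'b) module \<Rightarrow> ('m affine \<Rightarrow> 'b \<Rightarrow> 'b) \<Rightarrow> 'n wreath \<Rightarrow>
     ('a, 'n, 'm, 'b) tensR set \<Rightarrow> ('a, 'n::{finite,linorder}, 'm::finite, 'b) tensR set" where
  "W_coinv \<epsilon> l g M' \<rho>' M \<rho> w =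
     quot_map (TR_mod \<epsilon> l M' M) (coinv_kernel \<epsilon> l g M' \<rho>' M \<rho>) (W_TR \<epsilon> l g M' M w)"

definition B_coinv ::
  "complex \<Rightarrow> nat \<Rightarrow> (complex, 'm) sqmat \<Rightarrow>
     (complex, 'a) module \<Rightarrow> ('m affine \<Rightarrow> 'a \<Rightarrow> 'a) \<Rightarrow>
     (complex, 'b) module \<Rightarrow> ('m affine \<Rightarrow> 'b \<Rightarrow> 'b) \<Rightarrow> ('n wreath \<Rightarrow> 'n ratf) \<Rightarrow>
     ('a, 'n, 'm, 'b) tensR set \<Rightarrow> ('a, 'n::{finite,linorder}, 'm::finite, 'b) tensR set" where
  "B_coinv \<epsilon> l g M' \<rho>' M \<rho> b x =
     (\<Oplus>\<^bsub>coinv \<epsilon> l g M' \<rho>' M \<rho>\<^esub>w\<in>Wgrp l.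
        b w \<odot>\<^bsub>coinv \<epsilon> l g M' \<rho>' M \<rho>\<^esub> W_coinv \<epsilon> l g M' \<rho>' M \<rho> w x)"


section \<open>The case \<open>l = 1\<close>, extended to \<open>R\<^sub>n\<^sub>,\<^sub>l\<close>\<close>

text \<open>Here \<open>N'\<close>, \<open>N\<close> carry actions of the whole affine Lie algebra.\<close>

definition TE_mod ::
  "complex \<Rightarrow> nat \<Rightarrow> (complex, 'a) module \<Rightarrow> (complex, 'b) module \<Rightarrow>
     ('n ratf, (('a, 'n::{finite,linorder}, 'm::finite, 'b) tensR \<times> 'n ratf \<Rightarrow>\<^sub>0 'n ratf) set) module"
where
  "TE_mod \<epsilon> l N' N = base_change (Rloc 1 1) (emb l) (TR_mod 1 1 N' N) (Rloc \<epsilon> l)"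

definition TE_tensor ::
  "complex \<Rightarrow> nat \<Rightarrow> (complex, 'a) module \<Rightarrow> (complex, 'b) module \<Rightarrow>
     ('a, 'n, 'm, 'b) tensR \<Rightarrow> 'n ratf \<Rightarrow>
     (('a, 'n::{finite,linorder}, 'm::finite, 'b) tensR \<times> 'n ratf \<Rightarrow>\<^sub>0 'n ratf) set" where
  "TE_tensor \<epsilon> l N' N = bc_tensor (Rloc 1 1) (emb l) (TR_mod 1 1 N' N) (Rloc \<epsilon> l)"

text \<open>The element \<open>u' \<otimes> w\<^sub>1 \<otimes> \<dots> \<otimes> w\<^sub>n \<otimes> u\<close> for \<open>w\<^sub>i\<close> in \<open>V\<^sup>* \<otimes> R\<^sub>n\<^sub>,\<^sub>l\<close>, expanded in the basis of \<open>V\<^sup>*\<close>.\<close>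

definition TE_pure ::
  "complex \<Rightarrow> nat \<Rightarrow> (complex, 'a) module \<Rightarrow> (complex, 'b) module \<Rightarrow>
     'a \<Rightarrow> ('n \<Rightarrow> ('n ratf, 'm) vec) \<Rightarrow> 'b \<Rightarrow>
     (('a, 'n::{finite,linorder}, 'm::finite, 'b) tensR \<times> 'n ratf \<Rightarrow>\<^sub>0 'n ratf) set" where
  "TE_pure \<epsilon> l N' N u' w u =
     (\<Oplus>\<^bsub>TE_mod \<epsilon> l N' N\<^esub>J\<in>UNIV.
        TE_tensor \<epsilon> l N' N
          (TR_tensor 1 1 N' N (T_pure N' N u' (\<lambda>i. axis (J i) 1) u) 1)
          (\<Prod>i\<in>UNIV. w i $ J i))"

definition CE_mod ::
  "complex \<Rightarrow> nat \<Rightarrow> (complex, 'a) module \<Rightarrow> ('m affine \<Rightarrow> 'a \<Rightarrow> 'a) \<Rightarrow>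
     (complex, 'b) module \<Rightarrow> ('m affine \<Rightarrow> 'b \<Rightarrow> 'b) \<Rightarrow>
     ('n ratf, (('a, 'n::{finite,linorder}, 'm::finite, 'b) tensR set \<times> 'n ratf \<Rightarrow>\<^sub>0 'n ratf) set)
     module" where
  "CE_mod \<epsilon> l N' \<rho>' N \<rho> =
     base_change (Rloc 1 1) (emb l) (coinv 1 1 (mat 1) N' \<rho>' N \<rho>) (Rloc \<epsilon> l)"

definition CE_tensor ::
  "complex \<Rightarrow> nat \<Rightarrow> (complex, 'a) module \<Rightarrow> ('m affine \<Rightarrow> 'a \<Rightarrow> 'a) \<Rightarrow>
     (complex, 'b) module \<Rightarrow> ('m affine \<Rightarrow> 'b \<Rightarrow> 'b) \<Rightarrow>
     ('a, 'n, 'm, 'b) tensR set \<Rightarrow> 'n ratf \<Rightarrow>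
     (('a, 'n::{finite,linorder}, 'm::finite, 'b) tensR set \<times> 'n ratf \<Rightarrow>\<^sub>0 'n ratf) set" where
  "CE_tensor \<epsilon> l N' \<rho>' N \<rho> =
     bc_tensor (Rloc 1 1) (emb l) (coinv 1 1 (mat 1) N' \<rho>' N \<rho>) (Rloc \<epsilon> l)"

text \<open>The base change of the projection \<open>T(N', N)\<^sub>R \<rightarrow> C(N', N)\<^sub>n\<^sub>,\<^sub>1\<close>.\<close>

definition CE_proj ::
  "complex \<Rightarrow> nat \<Rightarrow> (complex, 'a) module \<Rightarrow> ('m affine \<Rightarrow> 'a \<Rightarrow> 'a) \<Rightarrow>
     (complex, 'b) module \<Rightarrow> ('m affine \<Rightarrow> 'b \<Rightarrow> 'b) \<Rightarrow>
     (('a, 'n, 'm, 'b) tensR \<times> 'n ratf \<Rightarrow>\<^sub>0 'n ratf) set \<Rightarrow>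
     (('a, 'n::{finite,linorder}, 'm::finite, 'b) tensR set \<times> 'n ratf \<Rightarrow>\<^sub>0 'n ratf) set" where
  "CE_proj \<epsilon> l N' \<rho>' N \<rho> =
     presented_lift id (CE_mod \<epsilon> l N' \<rho>' N \<rho>)
       (\<lambda>(t, f). CE_tensor \<epsilon> l N' \<rho>' N \<rho> (coinv_proj 1 1 (mat 1) N' \<rho>' N \<rho> t) f)"

text \<open>The permutation part acts diagonally, the \<open>\<epsilon>\<^sub>i\<close> only on the factor \<open>R\<^sub>n\<^sub>,\<^sub>l\<close>.\<close>

definition W_CE ::
  "complex \<Rightarrow> nat \<Rightarrow> (complex, 'a) module \<Rightarrow> ('m affine \<Rightarrow> 'a \<Rightarrow> 'a) \<Rightarrow>
     (complex, 'b) module \<Rightarrow> ('m affine \<Rightarrow> 'b \<Rightarrow> 'b) \<Rightarrow> 'n wreath \<Rightarrow>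
     (('a, 'n, 'm, 'b) tensR set \<times> 'n ratf \<Rightarrow>\<^sub>0 'n ratf) set \<Rightarrow>
     (('a, 'n::{finite,linorder}, 'm::finite, 'b) tensR set \<times> 'n ratf \<Rightarrow>\<^sub>0 'n ratf) set" where
  "W_CE \<epsilon> l N' \<rho>' N \<rho> w =
     presented_lift (W_ring \<epsilon> w) (CE_mod \<epsilon> l N' \<rho>' N \<rho>)
       (\<lambda>(x, f). CE_tensor \<epsilon> l N' \<rho>' N \<rho>
          (W_coinv 1 1 (mat 1) N' \<rho>' N \<rho> (fst w, \<lambda>_. 0) x) (W_ring \<epsilon> w f))"

definition B_CE ::
  "complex \<Rightarrow> nat \<Rightarrow> (complex, 'a) module \<Rightarrow> ('m affine \<Rightarrow> 'a \<Rightarrow> 'a) \<Rightarrow>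
     (complex, 'b) module \<Rightarrow> ('m affine \<Rightarrow> 'b \<Rightarrow> 'b) \<Rightarrow> ('n wreath \<Rightarrow> 'n ratf) \<Rightarrow>
     (('a, 'n, 'm, 'b) tensR set \<times> 'n ratf \<Rightarrow>\<^sub>0 'n ratf) set \<Rightarrow>
     (('a, 'n::{finite,linorder}, 'm::finite, 'b) tensR set \<times> 'n ratf \<Rightarrow>\<^sub>0 'n ratf) set" where
  "B_CE \<epsilon> l N' \<rho>' N \<rho> b x =
     (\<Oplus>\<^bsub>CE_mod \<epsilon> l N' \<rho>' N \<rho>\<^esub>w\<in>Wgrp l.
        b w \<odot>\<^bsub>CE_mod \<epsilon> l N' \<rho>' N \<rho>\<^esub> W_CE \<epsilon> l N' \<rho>' N \<rho> w x)"

text \<open>For \<open>B = Balg \<epsilon> l\<close>, \<open>B\<close>-linearity contains linearity over \<open>R\<^sub>n\<^sub>,\<^sub>l\<close> and over \<open>CW\<close>.\<close>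

definition equivariant_iso ::
  "'c set \<Rightarrow> ('r, 'x) module \<Rightarrow> ('c \<Rightarrow> 'x \<Rightarrow> 'x) \<Rightarrow> ('r, 'y) module \<Rightarrow> ('c \<Rightarrow> 'y \<Rightarrow> 'y) \<Rightarrow>
     ('x \<Rightarrow> 'y) \<Rightarrow> bool" where
  "equivariant_iso B A \<alpha> A' \<alpha>' \<Psi> \<longleftrightarrow>
     bij_betw \<Psi> (carrier A) (carrier A') \<and>
     (\<forall>x\<in>carrier A. \<forall>y\<in>carrier A. \<Psi> (x \<oplus>\<^bsub>A\<^esub> y) = \<Psi> x \<oplus>\<^bsub>A'\<^esub> \<Psi> y) \<and>
     (\<forall>b\<in>B. \<forall>x\<in>carrier A. \<Psi> (\<alpha> b x) = \<alpha>' b (\<Psi> x))"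

end

theory Submission
  imports Defs "HOL-Computational_Algebra.Polynomial_Factorial"
begin

text \<open>
  On a basis tensor \<open>u' \<otimes> e\<^sub>J \<otimes> u\<close>, with \<open>e\<^sub>J\<close> a tensor product of basis vectors of \<open>V\<^sup>*\<close>, the cocharacter
  acts by the monomial \<open>x\<^sub>J = \<Prod>\<^sub>i x\<^sub>i ^ block (J i)\<close>. Conjugation by it turns the coefficient \<open>x\<^sub>i ^ a\<close> of a
  matrix unit of degree \<open>b\<close> into \<open>x\<^sub>i ^ (a + b)\<close>, which for a loop fixed by the twist is a power of
  \<open>y\<^sub>i = x\<^sub>i ^ l\<close>: the twisted loop algebra acts like the untwisted one. The central terms of the two
  isomorphisms of affine algebras act on the outer factors by opposite scalars and cancel. Hence
  \<open>u' \<otimes> e\<^sub>J \<otimes> u \<mapsto> x\<^sub>J (u' \<otimes> e\<^sub>J \<otimes> u)\<close> maps relations to relations in both directions (with \<open>x\<^sub>J\<close> replaced by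
  its inverse), and it is equivariant because \<open>\<epsilon>\<^sub>i\<close> multiplies \<open>e\<^sub>J\<close> by the same root of unity as \<open>x\<^sub>J\<close>.
\<close>

section \<open>Semilinear maps between modules\<close>

text \<open>All modules of the statement are presentations or quotients, and maps out of them are
  evaluated at a chosen representative, so nothing can be computed before a map is known to be well
  defined. Semilinear maps and universal properties handle all cases together, and equalities and
  memberships in kernels are checked on generators only.

  The inverse also comes from universal properties. Thus the kernel after base change never has to
  be identified, and both directions rest on the single identity \<open>compare\<close>, stated for
  an arbitrary family \<open>P\<close>.

  The case \<open>l = 1\<close> is the twisted construction at \<open>\<epsilon> = 1\<close>, since
  \<open>geps \<nu> 1 = mat 1\<close>; coinvariants are therefore studied once and instantiated
  twice.

  The scalars on the outer factors are opposite for this reason: if \<open>X\<close> is the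
  regrading of \<open>Y\<close>, inverting \<open>kappa'\<close> at \<open>Y\<close> produces the
  central component minus the trace of \<open>gcheck \<nu>\<close> against the degree zero part of
  \<open>X\<close>, inverting \<open>kappa\<close> at the sharp of \<open>Y\<close> produces plus
  that trace, and both modules have the same level. The sign in \<open>kappa\<close> ensures that
  the loop reaching the last factor is the sharp of the loop reaching the first.\<close>

definition subring_on :: "'f::comm_ring_1 set \<Rightarrow> bool" where
  "subring_on S \<longleftrightarrow> 1 \<in> S \<and> (\<forall>x\<in>S. \<forall>y\<in>S. x - y \<in> S \<and> x * y \<in> S)"

definition ring_hom_on :: "'f::comm_ring_1 set \<Rightarrow> 'g::comm_ring_1 set \<Rightarrow> ('f \<Rightarrow> 'g) \<Rightarrow> bool" where
  "ring_hom_on S S' \<tau> \<longleftrightarrow> \<tau> \<in> S \<rightarrow> S' \<and> \<tau> 1 = 1 \<and>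
     (\<forall>x\<in>S. \<forall>y\<in>S. \<tau> (x + y) = \<tau> x + \<tau> y \<and> \<tau> (x * y) = \<tau> x * \<tau> y)"

text \<open>\<open>\<tau> = id\<close> gives the linear maps of the statement, \<open>W_ring\<close>
  the action of \<open>W\<close>, \<open>rconst\<close> and \<open>emb\<close> the maps into a base
  change. Treating them at once spares a separate version of each universal property.\<close>

definition semilinear ::
  "'f set \<Rightarrow> ('f \<Rightarrow> 'g) \<Rightarrow> ('f, 'x) module \<Rightarrow> ('g, 'y) module \<Rightarrow> ('x \<Rightarrow> 'y) \<Rightarrow> bool" where
  "semilinear S \<tau> A B f \<longleftrightarrow> f \<in> carrier A \<rightarrow> carrier B \<and>
     (\<forall>x\<in>carrier A. \<forall>y\<in>carrier A. f (x \<oplus>\<^bsub>A\<^esub> y) = f x \<oplus>\<^bsub>B\<^esub> f y) \<and>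
     (\<forall>r\<in>S. \<forall>x\<in>carrier A. f (r \<odot>\<^bsub>A\<^esub> x) = \<tau> r \<odot>\<^bsub>B\<^esub> f x)"

lemma ring_on_simps [simp]:
  "carrier (ring_on S) = S" "monoid.mult (ring_on S) = (*)" "one (ring_on S) = 1"
  "zero (ring_on S) = 0" "add (ring_on S) = (+)"
  by (simp_all add: ring_on_def)

lemma subring_onD:
  assumes "subring_on S"
  shows "0 \<in> S" "1 \<in> S" "\<And>x. x \<in> S \<Longrightarrow> - x \<in> S"
    "\<And>x y. x \<in> S \<Longrightarrow> y \<in> S \<Longrightarrow> x + y \<in> S"
    "\<And>x y. x \<in> S \<Longrightarrow> y \<in> S \<Longrightarrow> x * y \<in> S"
    "\<And>x y. x \<in> S \<Longrightarrow> y \<in> S \<Longrightarrow> x - y \<in> S"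
proof -
  show d: "x - y \<in> S" and "x * y \<in> S" if "x \<in> S" "y \<in> S" for x y
    using assms that by (auto simp: subring_on_def)
  have 1: "1 \<in> S" using assms by (auto simp: subring_on_def)
  show 0: "0 \<in> S" using d[OF 1 1] by simp
  show n: "- x \<in> S" if "x \<in> S" for x using d[OF 0 that] by simp
  show "x + y \<in> S" if "x \<in> S" "y \<in> S" for x y using d[OF that(1) n[OF that(2)]] by simp
  show "1 \<in> S" by (rule 1)
qed

lemma subring_on_UNIV [simp]: "subring_on UNIV"
  by (simp add: subring_on_def)

lemma subring_on_sum:
  assumes "subring_on S" "\<And>i. i \<in> F \<Longrightarrow> c i \<in> S"
  shows "sum c F \<in> S"
  using assms(2) by (induction F rule: infinite_finite_induct) (auto simp: subring_onD[OF assms(1)])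

lemma subring_on_prod:
  assumes "subring_on S" "\<And>i. i \<in> F \<Longrightarrow> c i \<in> S"
  shows "prod c F \<in> S"
  using assms(2) by (induction F rule: infinite_finite_induct) (auto simp: subring_onD[OF assms(1)])

lemma subring_on_power: "subring_on S \<Longrightarrow> x \<in> S \<Longrightarrow> x ^ n \<in> S"
  by (induction n) (auto simp: subring_onD)

lemma cring_ring_on:
  assumes "subring_on S"
  shows "cring (ring_on S)"
proof (rule cringI)
  note S = subring_onD[OF assms]
  show "abelian_group (ring_on S)"
  proof (rule abelian_groupI)
    fix x
    assume "x \<in> carrier (ring_on S)"
    then show "\<exists>y\<in>carrier (ring_on S). y \<oplus>\<^bsub>ring_on S\<^esub> x = \<zero>\<^bsub>ring_on S\<^esub>"
      using S(3) by (intro bexI[of _ "- x"]) auto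
  qed (auto simp: S)
  show "Group.comm_monoid (ring_on S)"
    by (rule comm_monoidI) (auto simp: S)
qed (auto simp: algebra_simps)

lemma ring_hom_onD:
  assumes "ring_hom_on S S' \<tau>" "subring_on S"
  shows "\<And>x. x \<in> S \<Longrightarrow> \<tau> x \<in> S'" and "\<tau> 1 = 1" and "\<tau> 0 = 0"
    and "\<And>x y. x \<in> S \<Longrightarrow> y \<in> S \<Longrightarrow> \<tau> (x + y) = \<tau> x + \<tau> y"
    and "\<And>x y. x \<in> S \<Longrightarrow> y \<in> S \<Longrightarrow> \<tau> (x * y) = \<tau> x * \<tau> y"
proof -
  show "\<tau> x \<in> S'" if "x \<in> S" for x using assms(1) that by (auto simp: ring_hom_on_def)
  show *: "\<tau> (x + y) = \<tau> x + \<tau> y" "\<tau> (x * y) = \<tau> x * \<tau> y" if "x \<in> S" "y \<in> S" for x y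
    using assms(1) that by (auto simp: ring_hom_on_def)
  show "\<tau> 0 = 0" using *(1)[of 0 0] subring_onD(1)[OF assms(2)] by simp
  show "\<tau> 1 = 1" using assms(1) by (auto simp: ring_hom_on_def)
qed

lemma ring_hom_on_id: "ring_hom_on S S id"
  by (simp add: ring_hom_on_def)

lemma ring_hom_on_comp:
  "ring_hom_on S S' \<tau> \<Longrightarrow> ring_hom_on S' S'' \<sigma> \<Longrightarrow> ring_hom_on S S'' (\<sigma> \<circ> \<tau>)"
  by (fastforce simp: ring_hom_on_def Pi_iff)

text \<open>Modules over a subring of a type of class \<^class>\<open>comm_ring_1\<close>. The ring operations are those of the
  type, so that the axioms can be used without the record \<^const>\<open>ring_on\<close>.\<close>

locale smod =
  fixes S :: "'f::comm_ring_1 set" and A :: "('f, 'x) module" (structure)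
  assumes subring: "subring_on S" and is_module: "Module.module (ring_on S) A"
begin

sublocale Module.module "ring_on S" A
  by (rule is_module)

lemmas S_closed = subring_onD[OF subring]

lemma scale_closed [simp, intro]: "r \<in> S \<Longrightarrow> x \<in> carrier A \<Longrightarrow> r \<odot> x \<in> carrier A"
  using smult_closed by simp

lemma scale_add_left: "r \<in> S \<Longrightarrow> s \<in> S \<Longrightarrow> x \<in> carrier A \<Longrightarrow> (r + s) \<odot> x = r \<odot> x \<oplus> s \<odot> x"
  using smult_l_distr by simp

lemma scale_add_right:
  "r \<in> S \<Longrightarrow> x \<in> carrier A \<Longrightarrow> y \<in> carrier A \<Longrightarrow> r \<odot> (x \<oplus> y) = r \<odot> x \<oplus> r \<odot> y"
  using smult_r_distr by simp

lemma scale_scale: "r \<in> S \<Longrightarrow> s \<in> S \<Longrightarrow> x \<in> carrier A \<Longrightarrow> r \<odot> (s \<odot> x) = (r * s) \<odot> x"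
  using smult_assoc1 by simp

lemma scale_one [simp]: "x \<in> carrier A \<Longrightarrow> 1 \<odot> x = x"
  using smult_one by simp

lemma scale_zero_left [simp]: "x \<in> carrier A \<Longrightarrow> 0 \<odot> x = \<zero>"
  using smult_l_null by simp

lemma scale_zero_right [simp]: "r \<in> S \<Longrightarrow> r \<odot> \<zero> = \<zero>"
  using smult_r_null by simp

lemma idem_imp_zero:
  assumes "x \<in> carrier A" "x \<oplus> x = x"
  shows "x = \<zero>"
proof -
  have "\<ominus> x \<oplus> (x \<oplus> x) = \<ominus> x \<oplus> x" using assms(2) by simp
  then show ?thesis using assms(1) by (simp add: M.a_assoc[symmetric] M.l_neg)
qed

lemma minus_eq_zero_iff [simp]:
  assumes "x \<in> carrier A" "y \<in> carrier A"
  shows "x \<ominus> y = \<zero> \<longleftrightarrow> x = y"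
proof
  assume "x \<ominus> y = \<zero>"
  then have "(x \<oplus> \<ominus> y) \<oplus> y = \<zero> \<oplus> y" by (simp add: a_minus_def)
  then show "x = y" using assms by (simp add: M.a_assoc M.l_neg)
qed (use assms in \<open>simp add: a_minus_def M.r_neg\<close>)

lemma scale_finsum:
  "r \<in> S \<Longrightarrow> f \<in> F \<rightarrow> carrier A \<Longrightarrow> r \<odot> (\<Oplus>i\<in>F. f i) = (\<Oplus>i\<in>F. r \<odot> f i)"
proof (cases "finite F")
  case True
  assume "r \<in> S" "f \<in> F \<rightarrow> carrier A"
  with True show ?thesis using finsum_smult_ldistr[of F r f] by simp
qed (simp add: M.finsum_infinite)

lemma scale_sum:
  assumes "finite F" "\<And>i. i \<in> F \<Longrightarrow> c i \<in> S" "x \<in> carrier A"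
  shows "(\<Sum>i\<in>F. c i) \<odot> x = (\<Oplus>i\<in>F. c i \<odot> x)"
  using assms
proof (induction F)
  case (insert i F)
  then show ?case
    by (subst M.finsum_insert)
      (auto simp: scale_add_left subring_on_sum[OF subring])
qed (simp add: M.finsum_empty)

text \<open>Negatives are multiples by \<open>- 1\<close>, so closure under sums and scalars
  suffices.\<close>

lemma submodI:
  assumes "B \<subseteq> carrier A" "\<zero> \<in> B" "\<And>x y. x \<in> B \<Longrightarrow> y \<in> B \<Longrightarrow> x \<oplus> y \<in> B"
    "\<And>r x. r \<in> S \<Longrightarrow> x \<in> B \<Longrightarrow> r \<odot> x \<in> B"
  shows "submodule B (ring_on S) A"
proof (rule submoduleI)
  fix x assume x: "x \<in> B"
  then have xc: "x \<in> carrier A" using assms(1) by auto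
  have "x \<oplus> (- 1) \<odot> x = 1 \<odot> x \<oplus> (- 1) \<odot> x" using xc by simp
  also have "\<dots> = \<zero>" using scale_add_left[of 1 "- 1" x] xc by (simp add: S_closed)
  finally have "\<ominus> x = (- 1) \<odot> x"
    using xc M.minus_equality[of "(- 1) \<odot> x" x] by (simp add: S_closed M.a_comm)
  then show "\<ominus> x \<in> B" using assms(4)[of "- 1" x] x by (simp add: S_closed)
qed (use assms in auto)

lemma submodD:
  assumes "submodule B (ring_on S) A"
  shows "B \<subseteq> carrier A" "\<zero> \<in> B" "\<And>x y. x \<in> B \<Longrightarrow> y \<in> B \<Longrightarrow> x \<oplus> y \<in> B"
    "\<And>r x. r \<in> S \<Longrightarrow> x \<in> B \<Longrightarrow> r \<odot> x \<in> B" "\<And>x y. x \<in> B \<Longrightarrow> y \<in> B \<Longrightarrow> x \<ominus> y \<in> B"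
proof -
  note E = submoduleE[OF assms, simplified]
  show s: "B \<subseteq> carrier A" and a: "\<And>x y. x \<in> B \<Longrightarrow> y \<in> B \<Longrightarrow> x \<oplus> y \<in> B"
    and "\<And>r x. r \<in> S \<Longrightarrow> x \<in> B \<Longrightarrow> r \<odot> x \<in> B" using E by auto
  show "\<And>x y. x \<in> B \<Longrightarrow> y \<in> B \<Longrightarrow> x \<ominus> y \<in> B" using E by (auto simp: a_minus_def)
  obtain x where x: "x \<in> B" using E(2) by auto
  have "x \<oplus> \<ominus> x \<in> B" using E x by auto
  then show "\<zero> \<in> B" using x s M.r_neg[of x] by auto
qed

lemma finsum_in_submod:
  assumes "submodule B (ring_on S) A" "\<And>i. i \<in> F \<Longrightarrow> f i \<in> B"
  shows "(\<Oplus>i\<in>F. f i) \<in> B"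
  using assms(2)
proof (induction F rule: infinite_finite_induct)
  case (insert i F)
  note B = submodD[OF assms(1)]
  have "f \<in> F \<rightarrow> carrier A" "f i \<in> carrier A" using insert B by auto
  then show ?case using insert B by (simp add: M.finsum_insert)
qed (use submodD[OF assms(1)] in \<open>auto simp: M.finsum_infinite\<close>)

text \<open>\<open>G \<subseteq> carrier A\<close> makes the carrier one of the submodules in the
  intersection, which keeps the span inside the carrier.\<close>

lemma span_submod:
  assumes "G \<subseteq> carrier A"
  shows "submodule (submodule_span (ring_on S) A G) (ring_on S) A"
    and "G \<subseteq> submodule_span (ring_on S) A G"
    and "\<And>B. submodule B (ring_on S) A \<Longrightarrow> G \<subseteq> B \<Longrightarrow> submodule_span (ring_on S) A G \<subseteq> B"
proof -
  show "submodule (submodule_span (ring_on S) A G) (ring_on S) A"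
  proof (rule submodI)
    show "submodule_span (ring_on S) A G \<subseteq> carrier A"
      using carrier_is_submodule assms by (auto simp: submodule_span_def)
  qed (auto simp: submodule_span_def submodD)
qed (auto simp: submodule_span_def)

end

lemma smodI:
  fixes S :: "'f::comm_ring_1 set" and A (structure)
  assumes "subring_on S" "abelian_group A"
    and "\<And>r x. r \<in> S \<Longrightarrow> x \<in> carrier A \<Longrightarrow> r \<odot> x \<in> carrier A"
    and "\<And>r s x. r \<in> S \<Longrightarrow> s \<in> S \<Longrightarrow> x \<in> carrier A \<Longrightarrow> (r + s) \<odot> x = r \<odot> x \<oplus> s \<odot> x"
    and "\<And>r x y. r \<in> S \<Longrightarrow> x \<in> carrier A \<Longrightarrow> y \<in> carrier A \<Longrightarrow> r \<odot> (x \<oplus> y) = r \<odot> x \<oplus> r \<odot> y"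
    and "\<And>r s x. r \<in> S \<Longrightarrow> s \<in> S \<Longrightarrow> x \<in> carrier A \<Longrightarrow> (r * s) \<odot> x = r \<odot> (s \<odot> x)"
    and "\<And>x. x \<in> carrier A \<Longrightarrow> 1 \<odot> x = x"
  shows "smod S A"
  by (intro smod.intro assms(1) moduleI cring_ring_on) (use assms in simp_all)

lemma semilinearI:
  assumes "\<And>x. x \<in> carrier A \<Longrightarrow> f x \<in> carrier B"
    and "\<And>x y. x \<in> carrier A \<Longrightarrow> y \<in> carrier A \<Longrightarrow> f (x \<oplus>\<^bsub>A\<^esub> y) = f x \<oplus>\<^bsub>B\<^esub> f y"
    and "\<And>r x. r \<in> S \<Longrightarrow> x \<in> carrier A \<Longrightarrow> f (r \<odot>\<^bsub>A\<^esub> x) = \<tau> r \<odot>\<^bsub>B\<^esub> f x"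
  shows "semilinear S \<tau> A B f"
  using assms by (auto simp: semilinear_def)

lemma semilinearD:
  assumes "semilinear S \<tau> A B f"
  shows "\<And>x. x \<in> carrier A \<Longrightarrow> f x \<in> carrier B"
    and "\<And>x y. x \<in> carrier A \<Longrightarrow> y \<in> carrier A \<Longrightarrow> f (x \<oplus>\<^bsub>A\<^esub> y) = f x \<oplus>\<^bsub>B\<^esub> f y"
    and "\<And>r x. r \<in> S \<Longrightarrow> x \<in> carrier A \<Longrightarrow> f (r \<odot>\<^bsub>A\<^esub> x) = \<tau> r \<odot>\<^bsub>B\<^esub> f x"
  using assms by (auto simp: semilinear_def)

lemma lin_maps_iff: "f \<in> lin_maps (ring_on S) A B \<longleftrightarrow> semilinear S id A B f"
  by (simp add: lin_maps_def semilinear_def)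

lemma semilinear_comp:
  "semilinear S \<tau> A B f \<Longrightarrow> semilinear S' \<sigma> B C h \<Longrightarrow> ring_hom_on S S' \<tau> \<Longrightarrow>
    semilinear S (\<sigma> \<circ> \<tau>) A C (h \<circ> f)"
  by (rule semilinearI) (auto simp: semilinearD ring_hom_on_def Pi_iff)

context
  fixes S :: "'f::comm_ring_1 set" and A :: "('f, 'x) module"
    and S' :: "'g::comm_ring_1 set" and B :: "('g, 'y) module" and \<tau> :: "'f \<Rightarrow> 'g"
  assumes A: "smod S A" and B: "smod S' B" and hom: "ring_hom_on S S' \<tau>"
begin

interpretation A: smod S A by (rule A)
interpretation B: smod S' B by (rule B)

lemmas hom_closed = ring_hom_onD(1)[OF hom A.subring]

lemma semilinear_zero:
  assumes "semilinear S \<tau> A B f"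
  shows "f \<zero>\<^bsub>A\<^esub> = \<zero>\<^bsub>B\<^esub>"
  using semilinearD(1,2)[OF assms, of "\<zero>\<^bsub>A\<^esub>"] by (metis A.M.l_zero A.M.zero_closed B.M.add.l_cancel_one)

lemma semilinear_minus:
  assumes "semilinear S \<tau> A B f" "x \<in> carrier A" "y \<in> carrier A"
  shows "f (x \<ominus>\<^bsub>A\<^esub> y) = f x \<ominus>\<^bsub>B\<^esub> f y"
proof -
  have "f (x \<ominus>\<^bsub>A\<^esub> y) \<oplus>\<^bsub>B\<^esub> f y = f x"
    using semilinearD(2)[OF assms(1), of "x \<ominus>\<^bsub>A\<^esub> y" y] assms(2,3)
    by (simp add: a_minus_def A.M.a_assoc A.M.l_neg)
  then show ?thesis
    using assms semilinearD(1)[OF assms(1)]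
    by (metis A.M.minus_closed B.M.add.inv_solve_right B.M.minus_eq)
qed

lemma semilinear_finsum:
  assumes "semilinear S \<tau> A B f" "h \<in> F \<rightarrow> carrier A"
  shows "f (\<Oplus>\<^bsub>A\<^esub>i\<in>F. h i) = (\<Oplus>\<^bsub>B\<^esub>i\<in>F. f (h i))"
  using assms(2)
proof (induction F rule: infinite_finite_induct)
  case (insert i F)
  then have "h \<in> F \<rightarrow> carrier A" "h i \<in> carrier A" by auto
  then show ?case
    using insert semilinearD[OF assms(1)] by (subst A.M.finsum_insert B.M.finsum_insert; auto)+
qed (auto simp: A.M.finsum_infinite B.M.finsum_infinite semilinear_zero[OF assms(1)])

lemma semilinear_add:
  assumes "semilinear S \<tau> A B f" "semilinear S \<tau> A B h"
  shows "semilinear S \<tau> A B (\<lambda>x. f x \<oplus>\<^bsub>B\<^esub> h x)"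
proof (rule semilinearI)
  note fh = semilinearD[OF assms(1)] semilinearD[OF assms(2)]
  show "f (x \<oplus>\<^bsub>A\<^esub> y) \<oplus>\<^bsub>B\<^esub> h (x \<oplus>\<^bsub>A\<^esub> y) = f x \<oplus>\<^bsub>B\<^esub> h x \<oplus>\<^bsub>B\<^esub> (f y \<oplus>\<^bsub>B\<^esub> h y)"
    if "x \<in> carrier A" "y \<in> carrier A" for x y
    using that fh by (simp add: B.M.a_ac)
  show "f (r \<odot>\<^bsub>A\<^esub> x) \<oplus>\<^bsub>B\<^esub> h (r \<odot>\<^bsub>A\<^esub> x) = \<tau> r \<odot>\<^bsub>B\<^esub> (f x \<oplus>\<^bsub>B\<^esub> h x)"
    if "r \<in> S" "x \<in> carrier A" for r x
    using that fh by (auto simp: B.scale_add_right hom_closed)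
qed (use assms in \<open>auto simp: semilinearD\<close>)

lemma semilinear_sum:
  assumes "\<And>i. i \<in> F \<Longrightarrow> semilinear S \<tau> A B (f i)"
  shows "semilinear S \<tau> A B (\<lambda>x. \<Oplus>\<^bsub>B\<^esub>i\<in>F. f i x)"
proof (rule semilinearI)
  note fh = assms(1)[THEN semilinearD(1)] assms(1)[THEN semilinearD(2)] assms(1)[THEN semilinearD(3)]
  show "(\<Oplus>\<^bsub>B\<^esub>i\<in>F. f i (x \<oplus>\<^bsub>A\<^esub> y)) = (\<Oplus>\<^bsub>B\<^esub>i\<in>F. f i x) \<oplus>\<^bsub>B\<^esub> (\<Oplus>\<^bsub>B\<^esub>i\<in>F. f i y)"
    if "x \<in> carrier A" "y \<in> carrier A" for x y
  proof -
    have "(\<Oplus>\<^bsub>B\<^esub>i\<in>F. f i (x \<oplus>\<^bsub>A\<^esub> y)) = (\<Oplus>\<^bsub>B\<^esub>i\<in>F. f i x \<oplus>\<^bsub>B\<^esub> f i y)"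
      using that fh by (intro B.M.finsum_cong') auto
    then show ?thesis using that fh by (simp add: B.M.finsum_addf Pi_iff)
  qed
  show "(\<Oplus>\<^bsub>B\<^esub>i\<in>F. f i (r \<odot>\<^bsub>A\<^esub> x)) = \<tau> r \<odot>\<^bsub>B\<^esub> (\<Oplus>\<^bsub>B\<^esub>i\<in>F. f i x)"
    if "r \<in> S" "x \<in> carrier A" for r x
    using that fh by (subst B.scale_finsum) (auto intro!: B.M.finsum_cong' simp: hom_closed)
qed (use semilinearD(1)[OF assms] in \<open>auto intro!: B.M.finsum_closed\<close>)

lemma semilinear_scale:
  assumes "semilinear S \<tau> A B f" "s \<in> S'"
  shows "semilinear S \<tau> A B (\<lambda>x. s \<odot>\<^bsub>B\<^esub> f x)"
proof (rule semilinearI)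
  note fh = semilinearD[OF assms(1)]
  show "s \<odot>\<^bsub>B\<^esub> f (r \<odot>\<^bsub>A\<^esub> x) = \<tau> r \<odot>\<^bsub>B\<^esub> (s \<odot>\<^bsub>B\<^esub> f x)" if "r \<in> S" "x \<in> carrier A" for r x
    using that fh assms(2) by (simp add: B.scale_scale mult.commute hom_closed)
qed (use assms in \<open>auto simp: semilinearD B.scale_add_right\<close>)

lemma semilinear_vimage_submod:
  assumes "semilinear S \<tau> A B f" "submodule H (ring_on S') B"
  shows "submodule {x \<in> carrier A. f x \<in> H} (ring_on S) A"
  by (rule A.submodI)
    (use assms in \<open>auto simp: semilinearD semilinear_zero B.submodD hom_closed\<close>)

text \<open>The points where two semilinear maps agree form a submodule, so agreement on generators
  suffices. This is how the two composites and the equivariance of the comparison map are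
  verified.\<close>

lemma semilinear_eqI:
  assumes "semilinear S \<tau> A B f" "semilinear S \<tau> A B h"
    and "submodule_span (ring_on S) A G = carrier A" "G \<subseteq> carrier A"
    and "\<And>x. x \<in> G \<Longrightarrow> f x = h x" "x \<in> carrier A"
  shows "f x = h x"
proof -
  have "submodule {x \<in> carrier A. f x = h x} (ring_on S) A"
    using assms(1,2) by (intro A.submodI) (auto simp: semilinearD semilinear_zero)
  from A.span_submod(3)[OF assms(4) this] assms show ?thesis by auto
qed

text \<open>The preimage of a submodule is a submodule; hence relations need only be checked on
  generators, although spans are defined as intersections.\<close>

lemma semilinear_into_submod:
  assumes "semilinear S \<tau> A B f" "submodule H (ring_on S') B"
    and "G \<subseteq> carrier A"
    and "\<And>x. x \<in> G \<Longrightarrow> f x \<in> H" "x \<in> submodule_span (ring_on S) A G"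
  shows "f x \<in> H"
  using A.span_submod(3)[OF assms(3) semilinear_vimage_submod[OF assms(1,2)]] assms by auto

end

section \<open>Free modules, quotients and presentations\<close>

lemma in_free_module_iff:
  "p \<in> carrier (free_module S X) \<longleftrightarrow>
    Poly_Mapping.keys p \<subseteq> X \<and> (\<forall>k. Poly_Mapping.lookup p k \<in> S)"
  by (auto simp: free_module_def)

lemma free_moduleD:
  "p \<in> carrier (free_module S X) \<Longrightarrow> k \<in> Poly_Mapping.keys p \<Longrightarrow> k \<in> X"
  "p \<in> carrier (free_module S X) \<Longrightarrow> Poly_Mapping.lookup p k \<in> S"
  by (auto simp: in_free_module_iff)

lemma free_module_simps [simp]:
  "zero (free_module S X) = 0" "add (free_module S X) = (+)"
  "module.smult (free_module S X) r p = Poly_Mapping.map ((*) r) p"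
  by (simp_all add: free_module_def)

lemma lookup_map_times [simp]:
  "Poly_Mapping.lookup (Poly_Mapping.map ((*) (r::'f::comm_ring_1)) p) k = r * Poly_Mapping.lookup p k"
  by (simp add: Poly_Mapping.map.rep_eq when_def)

lemma smod_free_module:
  assumes "subring_on S"
  shows "smod S (free_module S X)"
proof (rule smodI[OF assms])
  note S = subring_onD[OF assms]
  show "abelian_group (free_module S X)"
  proof (rule abelian_groupI)
    fix p q assume "p \<in> carrier (free_module S X)" "q \<in> carrier (free_module S X)"
    then show "p \<oplus>\<^bsub>free_module S X\<^esub> q \<in> carrier (free_module S X)"
      using Poly_Mapping.keys_add[of p q] by (auto simp: in_free_module_iff lookup_add S)
  next
    fix p assume "p \<in> carrier (free_module S X)"
    then show "\<exists>q\<in>carrier (free_module S X). q \<oplus>\<^bsub>free_module S X\<^esub> p = \<zero>\<^bsub>free_module S X\<^esub>"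
      by (intro bexI[of _ "- p"]) (auto simp: S in_free_module_iff)
  qed (auto simp: S in_free_module_iff algebra_simps)
  fix r p assume "r \<in> S" "p \<in> carrier (free_module S X)"
  then show "r \<odot>\<^bsub>free_module S X\<^esub> p \<in> carrier (free_module S X)"
    by (auto simp: S in_keys_iff subset_iff in_free_module_iff) (metis mult_zero_right)
qed (auto intro!: poly_mapping_eqI simp: algebra_simps lookup_add)

lemma free_module_single:
  "subring_on S \<Longrightarrow> k \<in> X \<Longrightarrow> r \<in> S \<Longrightarrow> Poly_Mapping.single k r \<in> carrier (free_module S X)"
  by (auto simp: in_free_module_iff lookup_single when_def subring_onD)

text \<open>The defining relations are written with the subtraction of polynomial mappings; this
  translates it into the record operation to which the module lemmas apply.\<close>

lemma free_module_minus:
  assumes "subring_on S" "p \<in> carrier (free_module S X)" "q \<in> carrier (free_module S X)"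
  shows "p - q = p \<ominus>\<^bsub>free_module S X\<^esub> q" "p - q \<in> carrier (free_module S X)"
proof -
  interpret smod S "free_module S X" by (rule smod_free_module[OF assms(1)])
  have "- q \<in> carrier (free_module S X)"
    using assms by (auto simp: in_free_module_iff S_closed)
  then have "\<ominus>\<^bsub>free_module S X\<^esub> q = - q"
    using assms by (intro M.minus_equality) auto
  then show "p - q = p \<ominus>\<^bsub>free_module S X\<^esub> q" by (simp add: a_minus_def)
  then show "p - q \<in> carrier (free_module S X)" using M.minus_closed assms by metis
qed

lemma free_module_span:
  assumes "subring_on S"
  shows "submodule_span (ring_on S) (free_module S X) ((\<lambda>k. Poly_Mapping.single k 1) ` X) =
    carrier (free_module S X)" (is "?L = _")
proof
  interpret smod S "free_module S X" by (rule smod_free_module[OF assms(1)])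
  have G: "(\<lambda>k. Poly_Mapping.single k 1) ` X \<subseteq> carrier (free_module S X)"
    by (auto intro!: free_module_single[OF assms(1)] S_closed)
  note B = span_submod[OF G]
  show "?L \<subseteq> carrier (free_module S X)" using submodD(1)[OF B(1)] .
  show "carrier (free_module S X) \<subseteq> ?L"
  proof
    fix p assume p: "p \<in> carrier (free_module S X)"
    have *: "(\<Sum>k\<in>K. Poly_Mapping.single k (Poly_Mapping.lookup p k)) \<in> ?L"
      if "finite K" "K \<subseteq> X" for K
      using that
    proof (induction K)
      case (insert k K)
      have "Poly_Mapping.single k (Poly_Mapping.lookup p k) =
          Poly_Mapping.lookup p k \<odot>\<^bsub>free_module S X\<^esub> Poly_Mapping.single k 1"
        by (auto intro!: poly_mapping_eqI simp: lookup_single when_def)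
      moreover have "\<dots> \<in> ?L"
        using insert.prems free_moduleD(2)[OF p] B(2) by (intro submodD(4)[OF B(1)]) auto
      ultimately show ?case
        using insert submodD(3)[OF B(1)] by simp
    qed (use submodD(2)[OF B(1)] in simp)
    have "(\<Sum>k\<in>Poly_Mapping.keys p. Poly_Mapping.single k (Poly_Mapping.lookup p k)) = p"
      by (rule poly_mapping_eqI) (simp add: lookup_sum lookup_single when_def in_keys_iff)
    then show "p \<in> ?L"
      using *[of "Poly_Mapping.keys p"] free_moduleD(1)[OF p] by auto
  qed
qed

section \<open>Universal property of free modules\<close>

definition free_lift ::
  "('f::comm_ring_1 \<Rightarrow> 'r) \<Rightarrow> ('r, 'y) module \<Rightarrow> ('x \<Rightarrow> 'y) \<Rightarrow> ('x \<Rightarrow>\<^sub>0 'f) \<Rightarrow> 'y" where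
  "free_lift \<tau> B \<phi> p =
     (\<Oplus>\<^bsub>B\<^esub>k\<in>Poly_Mapping.keys p. \<tau> (Poly_Mapping.lookup p k) \<odot>\<^bsub>B\<^esub> \<phi> k)"

context
  fixes S :: "'f::comm_ring_1 set" and S' :: "'g::comm_ring_1 set" and B :: "('g, 'y) module"
    and \<tau> :: "'f \<Rightarrow> 'g" and X :: "'x set" and \<phi> :: "'x \<Rightarrow> 'y"
  assumes S: "subring_on S" and B: "smod S' B" and hom: "ring_hom_on S S' \<tau>"
    and \<phi>: "\<phi> \<in> X \<rightarrow> carrier B"
begin

interpretation B: smod S' B by (rule B)

text \<open>Zero coefficients contribute nothing. Two elements can thus be summed over a common
  finite set, although cancellation may shrink the keys of their sum.\<close>

lemma free_lift_superset:
  assumes "p \<in> carrier (free_module S X)" "finite K" "Poly_Mapping.keys p \<subseteq> K" "K \<subseteq> X"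
  shows "free_lift \<tau> B \<phi> p = (\<Oplus>\<^bsub>B\<^esub>k\<in>K. \<tau> (Poly_Mapping.lookup p k) \<odot>\<^bsub>B\<^esub> \<phi> k)"
  unfolding free_lift_def
proof (rule B.M.add.finprod_mono_neutral_cong_left)
  note h = ring_hom_onD[OF hom S]
  show "\<tau> (Poly_Mapping.lookup p k) \<odot>\<^bsub>B\<^esub> \<phi> k = \<zero>\<^bsub>B\<^esub>" if "k \<in> K - Poly_Mapping.keys p" for k
    using \<phi> assms(4) that by (auto simp: in_keys_iff h Pi_iff subset_iff)
  show "(\<lambda>k. \<tau> (Poly_Mapping.lookup p k) \<odot>\<^bsub>B\<^esub> \<phi> k) \<in> K \<rightarrow> carrier B"
    using \<phi> assms(4) free_moduleD(2)[OF assms(1)]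
    by (auto simp: h subset_iff Pi_iff intro!: B.scale_closed)
qed (use assms in auto)

lemma free_lift_single:
  assumes "k \<in> X" "r \<in> S"
  shows "free_lift \<tau> B \<phi> (Poly_Mapping.single k r) = \<tau> r \<odot>\<^bsub>B\<^esub> \<phi> k"
proof -
  note h = ring_hom_onD[OF hom S]
  have "free_lift \<tau> B \<phi> (Poly_Mapping.single k r) =
      (\<Oplus>\<^bsub>B\<^esub>j\<in>{k}. \<tau> (Poly_Mapping.lookup (Poly_Mapping.single k r) j) \<odot>\<^bsub>B\<^esub> \<phi> j)"
    by (rule free_lift_superset) (use assms S in \<open>auto simp: free_module_single split: if_splits\<close>)
  also have "\<dots> = \<tau> r \<odot>\<^bsub>B\<^esub> \<phi> k"
    using \<phi> assms by (subst B.M.finsum_insert) (auto simp: h Pi_iff B.M.finsum_empty)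
  finally show ?thesis .
qed

lemma semilinear_free_lift: "semilinear S \<tau> (free_module S X) B (free_lift \<tau> B \<phi>)"
proof (rule semilinearI)
  note h = ring_hom_onD[OF hom S]
  interpret F: smod S "free_module S X" by (rule smod_free_module[OF S])
  have term_closed: "\<tau> (Poly_Mapping.lookup p k) \<odot>\<^bsub>B\<^esub> \<phi> k \<in> carrier B"
    if "p \<in> carrier (free_module S X)" "k \<in> X" for p k
    using that(2) \<phi> free_moduleD(2)[OF that(1)] by (auto simp: h intro!: B.scale_closed)
  fix p assume p: "p \<in> carrier (free_module S X)"
  note pD = free_moduleD[OF p]
  show "free_lift \<tau> B \<phi> p \<in> carrier B"
    unfolding free_lift_def by (intro B.M.finsum_closed Pi_I term_closed p pD(1))
  { fix q assume q: "q \<in> carrier (free_module S X)"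
    define K where "K = Poly_Mapping.keys p \<union> Poly_Mapping.keys q"
    have K: "finite K" "K \<subseteq> X" "Poly_Mapping.keys p \<subseteq> K" "Poly_Mapping.keys q \<subseteq> K"
      "Poly_Mapping.keys (p + q) \<subseteq> K"
      using pD(1) free_moduleD(1)[OF q] Poly_Mapping.keys_add[of p q] by (auto simp: K_def)
    have pq: "p + q \<in> carrier (free_module S X)" using F.M.a_closed[OF p q] by simp
    have "(\<Oplus>\<^bsub>B\<^esub>k\<in>K. \<tau> (Poly_Mapping.lookup (p + q) k) \<odot>\<^bsub>B\<^esub> \<phi> k) =
      (\<Oplus>\<^bsub>B\<^esub>k\<in>K. \<tau> (Poly_Mapping.lookup p k) \<odot>\<^bsub>B\<^esub> \<phi> k \<oplus>\<^bsub>B\<^esub> \<tau> (Poly_Mapping.lookup q k) \<odot>\<^bsub>B\<^esub> \<phi> k)"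
    proof (rule B.M.finsum_cong'[OF refl])
      show "(\<lambda>k. \<tau> (Poly_Mapping.lookup p k) \<odot>\<^bsub>B\<^esub> \<phi> k \<oplus>\<^bsub>B\<^esub> \<tau> (Poly_Mapping.lookup q k) \<odot>\<^bsub>B\<^esub> \<phi> k)
          \<in> K \<rightarrow> carrier B"
        using K(2) by (intro Pi_I B.M.a_closed term_closed p q) auto
      fix k assume "k \<in> K"
      then have "\<phi> k \<in> carrier B" using K(2) \<phi> by auto
      then show "\<tau> (Poly_Mapping.lookup (p + q) k) \<odot>\<^bsub>B\<^esub> \<phi> k =
          \<tau> (Poly_Mapping.lookup p k) \<odot>\<^bsub>B\<^esub> \<phi> k \<oplus>\<^bsub>B\<^esub> \<tau> (Poly_Mapping.lookup q k) \<odot>\<^bsub>B\<^esub> \<phi> k"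
        using pD(2) free_moduleD(2)[OF q] by (simp add: lookup_add h B.scale_add_left)
    qed
    also have "\<dots> = (\<Oplus>\<^bsub>B\<^esub>k\<in>K. \<tau> (Poly_Mapping.lookup p k) \<odot>\<^bsub>B\<^esub> \<phi> k) \<oplus>\<^bsub>B\<^esub>
        (\<Oplus>\<^bsub>B\<^esub>k\<in>K. \<tau> (Poly_Mapping.lookup q k) \<odot>\<^bsub>B\<^esub> \<phi> k)"
      using K(2) by (intro B.M.finsum_addf Pi_I term_closed p q) auto
    finally show "free_lift \<tau> B \<phi> (p \<oplus>\<^bsub>free_module S X\<^esub> q) = free_lift \<tau> B \<phi> p \<oplus>\<^bsub>B\<^esub> free_lift \<tau> B \<phi> q"
      using K p q pq by (simp add: free_lift_superset) }
  fix r assume r: "r \<in> S"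
  then have rp: "r \<odot>\<^bsub>free_module S X\<^esub> p \<in> carrier (free_module S X)" by (intro F.scale_closed p)
  have "free_lift \<tau> B \<phi> (r \<odot>\<^bsub>free_module S X\<^esub> p) =
    (\<Oplus>\<^bsub>B\<^esub>k\<in>Poly_Mapping.keys p. \<tau> (r * Poly_Mapping.lookup p k) \<odot>\<^bsub>B\<^esub> \<phi> k)"
    by (subst free_lift_superset[OF rp, of "Poly_Mapping.keys p"])
      (use p in \<open>auto simp: in_keys_iff in_free_module_iff\<close>)
  also have "\<dots> = (\<Oplus>\<^bsub>B\<^esub>k\<in>Poly_Mapping.keys p. \<tau> r \<odot>\<^bsub>B\<^esub> (\<tau> (Poly_Mapping.lookup p k) \<odot>\<^bsub>B\<^esub> \<phi> k))"
  proof (rule B.M.finsum_cong'[OF refl])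
    show "(\<lambda>k. \<tau> r \<odot>\<^bsub>B\<^esub> (\<tau> (Poly_Mapping.lookup p k) \<odot>\<^bsub>B\<^esub> \<phi> k)) \<in> Poly_Mapping.keys p \<rightarrow> carrier B"
      by (intro Pi_I B.scale_closed h(1) r term_closed p pD(1))
    fix k assume "k \<in> Poly_Mapping.keys p"
    then have "\<phi> k \<in> carrier B" using pD(1) \<phi> by auto
    then show "\<tau> (r * Poly_Mapping.lookup p k) \<odot>\<^bsub>B\<^esub> \<phi> k = \<tau> r \<odot>\<^bsub>B\<^esub> (\<tau> (Poly_Mapping.lookup p k) \<odot>\<^bsub>B\<^esub> \<phi> k)"
      using pD(2) r by (simp add: h B.scale_scale)
  qed
  also have "\<dots> = \<tau> r \<odot>\<^bsub>B\<^esub> free_lift \<tau> B \<phi> p"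
    unfolding free_lift_def by (intro B.scale_finsum[symmetric] h(1) r Pi_I term_closed p pD(1))
  finally show "free_lift \<tau> B \<phi> (r \<odot>\<^bsub>free_module S X\<^esub> p) = \<tau> r \<odot>\<^bsub>B\<^esub> free_lift \<tau> B \<phi> p" .
qed

end

section \<open>Quotient modules and the maps induced on them\<close>

locale submod = smod S A for S :: "'f::comm_ring_1 set" and A :: "('f, 'x) module" (structure) +
  fixes B :: "'x set"
  assumes B: "submodule B (ring_on S) A"
begin

lemmas B_closed = submodD[OF B]

sublocale abelian_subgroup B A
  by (rule abelian_subgroupI3)
    (use submodule.axioms(1)[OF B] M.abelian_group_axioms in \<open>auto intro: additive_subgroup.intro\<close>)

lemma coset_eq_iff:
  assumes "x \<in> carrier A" "y \<in> carrier A"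
  shows "B +> x = B +> y \<longleftrightarrow> x \<ominus> y \<in> B"
proof -
  have "x \<ominus> y \<in> B \<longleftrightarrow> x \<in> B +> y"
    unfolding a_minus_def by (rule a_rcos_module[OF assms(2,1), symmetric])
  also have "\<dots> \<longleftrightarrow> B +> x = B +> y"
    using a_repr_independence'[OF _ assms(2), of x] a_repr_independenceD[OF assms(1), of y] by blast
  finally show ?thesis ..
qed

lemma quot_carrier: "carrier (quot_module A B) = (\<lambda>x. B +> x) ` carrier A"
  by (auto simp: quot_module_def A_RCOSETS_def')

lemma quot_add:
  "x \<in> carrier A \<Longrightarrow> y \<in> carrier A \<Longrightarrow> (B +> x) \<oplus>\<^bsub>quot_module A B\<^esub> (B +> y) = B +> (x \<oplus> y)"
  by (simp add: quot_module_def a_rcos_sum)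

lemma quot_zero: "\<zero>\<^bsub>quot_module A B\<^esub> = B +> \<zero>"
  using B_closed by (simp add: quot_module_def)

text \<open>The definition takes the union of the cosets of \<open>r \<odot> y\<close> over all
  representatives \<open>y\<close>. These cosets coincide because
  \<open>r \<odot> (y \<ominus> x)\<close> lies in \<open>B\<close>.\<close>

lemma quot_scale:
  assumes "r \<in> S" "x \<in> carrier A"
  shows "r \<odot>\<^bsub>quot_module A B\<^esub> (B +> x) = B +> (r \<odot> x)"
proof -
  have "B +> (r \<odot> y) = B +> (r \<odot> x)" if "y \<in> B +> x" for y
  proof -
    have y: "y \<in> carrier A" by (rule a_elemrcos_carrier[OF assms(2) that])
    have "y \<ominus> x \<in> B"
      unfolding a_minus_def using that a_rcos_module[OF assms(2) y] by blast
    then have "r \<odot> (y \<ominus> x) \<in> B" by (rule B_closed(4)[OF assms(1)])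
    moreover have "r \<odot> (y \<ominus> x) = r \<odot> y \<ominus> r \<odot> x"
      using assms y by (simp add: a_minus_def scale_add_right smult_r_minus)
    ultimately show ?thesis using assms y by (simp add: coset_eq_iff)
  qed
  then have "(\<Union>y\<in>B +> x. B +> (r \<odot> y)) = (\<Union>y\<in>B +> x. B +> (r \<odot> x))"
    by (rule SUP_cong[OF refl])
  also have "\<dots> = B +> (r \<odot> x)"
    using a_rcos_self[OF assms(2)] by blast
  finally show ?thesis by (simp add: quot_module_def)
qed

lemma smod_quot: "smod S (quot_module A B)"
proof (rule smodI[OF subring])
  show "abelian_group (quot_module A B)"
  proof (rule abelian_groupI)
    fix x assume "x \<in> carrier (quot_module A B)"
    then obtain y where y: "y \<in> carrier A" "x = B +> y" by (auto simp: quot_carrier)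
    then have "(B +> \<ominus> y) \<oplus>\<^bsub>quot_module A B\<^esub> x = \<zero>\<^bsub>quot_module A B\<^esub>"
      by (simp add: quot_add quot_zero M.l_neg)
    then show "\<exists>z\<in>carrier (quot_module A B). z \<oplus>\<^bsub>quot_module A B\<^esub> x = \<zero>\<^bsub>quot_module A B\<^esub>"
      using y by (auto simp: quot_carrier)
  qed (auto simp: quot_carrier quot_add quot_zero M.a_ac)
qed (unfold quot_carrier, (elim imageE, simp add: quot_add quot_scale scale_add_left
      scale_add_right scale_scale S_closed)+)

lemma semilinear_coset: "semilinear S id A (quot_module A B) (\<lambda>x. B +> x)"
  by (rule semilinearI) (auto simp: quot_carrier quot_add quot_scale)

lemma coset_eq_zero: "x \<in> B \<Longrightarrow> B +> x = \<zero>\<^bsub>quot_module A B\<^esub>"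
  unfolding quot_zero
  by (subst coset_eq_iff) (use B_closed in \<open>auto simp: a_minus_def\<close>)

lemma some_in_coset:
  assumes "x \<in> carrier A"
  shows "(SOME y. y \<in> B +> x) \<in> carrier A" "x \<ominus> (SOME y. y \<in> B +> x) \<in> B"
proof -
  have "x \<in> B +> x" using a_rcos_self assms by blast
  then have *: "(SOME y. y \<in> B +> x) \<in> B +> x" by (rule someI)
  show c: "(SOME y. y \<in> B +> x) \<in> carrier A"
    using a_elemrcos_carrier[OF assms *] .
  have "B +> x = B +> (SOME y. y \<in> B +> x)"
    using a_repr_independence'[OF * assms] by simp
  then show "x \<ominus> (SOME y. y \<in> B +> x) \<in> B" using assms c by (simp add: coset_eq_iff)
qed

text \<open>The representative picked by \<open>SOME\<close> differs from \<open>x\<close> by an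
  element of \<open>B\<close>, where \<open>f\<close> vanishes, so the choice is invisible.\<close>

lemma coset_lift:
  assumes C: "smod S' C" and f: "semilinear S \<tau> A C f" and hom: "ring_hom_on S S' \<tau>"
    and 0: "\<And>x. x \<in> B \<Longrightarrow> f x = \<zero>\<^bsub>C\<^esub>"
  shows "semilinear S \<tau> (quot_module A B) C (\<lambda>Y. f (SOME y. y \<in> Y))"
    and "\<And>x. x \<in> carrier A \<Longrightarrow> f (SOME y. y \<in> B +> x) = f x"
proof -
  interpret C: smod S' C by (rule C)
  show *: "f (SOME y. y \<in> B +> x) = f x" if x: "x \<in> carrier A" for x
  proof -
    note y = some_in_coset[OF x]
    have "f x \<ominus>\<^bsub>C\<^esub> f (SOME y. y \<in> B +> x) = \<zero>\<^bsub>C\<^esub>"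
      using semilinear_minus[OF smod_axioms C hom f x y(1)] 0[OF y(2)] by simp
    then show ?thesis
      using semilinearD(1)[OF f] x y(1) by simp
  qed
  show "semilinear S \<tau> (quot_module A B) C (\<lambda>Y. f (SOME y. y \<in> Y))"
    by (rule semilinearI) (auto simp: quot_carrier quot_add quot_scale * semilinearD[OF f])
qed

lemma semilinear_quot_map:
  assumes f: "semilinear S \<tau> A A f" and hom: "ring_hom_on S S \<tau>" and pres: "\<And>x. x \<in> B \<Longrightarrow> f x \<in> B"
  shows "semilinear S \<tau> (quot_module A B) (quot_module A B) (quot_map A B f)"
    and "\<And>x. x \<in> carrier A \<Longrightarrow> quot_map A B f (B +> x) = B +> f x"
proof -
  have "semilinear S (id \<circ> \<tau>) A (quot_module A B) ((\<lambda>x. B +> x) \<circ> f)"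
    by (rule semilinear_comp[OF f semilinear_coset hom])
  then have "semilinear S \<tau> A (quot_module A B) (\<lambda>x. B +> f x)"
    by (simp add: comp_def)
  note L = coset_lift[OF smod_quot this hom]
  show "semilinear S \<tau> (quot_module A B) (quot_module A B) (quot_map A B f)"
    "\<And>x. x \<in> carrier A \<Longrightarrow> quot_map A B f (B +> x) = B +> f x"
    using L pres coset_eq_zero by (auto simp: quot_map_def[abs_def])
qed

lemma quot_span:
  assumes "submodule_span (ring_on S) A G = carrier A" "G \<subseteq> carrier A"
  shows "submodule_span (ring_on S) (quot_module A B) ((\<lambda>x. B +> x) ` G) = carrier (quot_module A B)"
    (is "?L = _")
proof
  interpret Q: smod S "quot_module A B" by (rule smod_quot)
  have G: "(\<lambda>x. B +> x) ` G \<subseteq> carrier (quot_module A B)" using assms by (auto simp: quot_carrier)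
  note sp = Q.span_submod[OF G]
  show "?L \<subseteq> carrier (quot_module A B)" using Q.submodD(1)[OF sp(1)] .
  show "carrier (quot_module A B) \<subseteq> ?L"
    using semilinear_into_submod[OF smod_axioms smod_quot ring_hom_on_id semilinear_coset sp(1) assms(2)]
      sp(2) assms(1) by (auto simp: quot_carrier)
qed

end

context
  fixes S :: "'f::comm_ring_1 set" and S' :: "'g::comm_ring_1 set" and B :: "('g, 'y) module"
    and \<tau> :: "'f \<Rightarrow> 'g" and X :: "'x set" and \<phi> :: "'x \<Rightarrow> 'y"
  assumes S: "subring_on S" and B: "smod S' B" and hom: "ring_hom_on S S' \<tau>"
    and \<phi>: "\<phi> \<in> X \<rightarrow> carrier B"
begin

interpretation B: smod S' B by (rule B)
interpretation F: smod S "free_module S X" by (rule smod_free_module[OF S])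

text \<open>All relations of base changes and tensor products have two or three terms. Both
  directions of the equivalence serve: one reads off equations in a presented module, the other
  verifies that a lift respects the relations.\<close>

lemma free_lift_two:
  assumes "k \<in> X" "j \<in> X" "r \<in> S" "s \<in> S"
  shows "free_lift \<tau> B \<phi> (Poly_Mapping.single k r - Poly_Mapping.single j s) = \<zero>\<^bsub>B\<^esub> \<longleftrightarrow>
    \<tau> r \<odot>\<^bsub>B\<^esub> \<phi> k = \<tau> s \<odot>\<^bsub>B\<^esub> \<phi> j"
proof -
  note s = free_module_single[OF S, where X = X] free_module_minus(1)[OF S, where X = X]
  have "\<tau> r \<in> S'" "\<tau> s \<in> S'" "\<phi> k \<in> carrier B" "\<phi> j \<in> carrier B"
    using assms \<phi> ring_hom_onD(1)[OF hom S] by auto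
  then show ?thesis
    using assms semilinear_minus[OF F.smod_axioms B hom semilinear_free_lift[OF S B hom \<phi>]]
    by (simp add: s free_lift_single[OF S B hom \<phi>])
qed

lemma free_lift_three:
  assumes "k \<in> X" "j \<in> X" "i \<in> X" "r \<in> S" "s \<in> S" "t \<in> S"
  shows "free_lift \<tau> B \<phi>
      (Poly_Mapping.single k r - Poly_Mapping.single j s - Poly_Mapping.single i t) = \<zero>\<^bsub>B\<^esub> \<longleftrightarrow>
    \<tau> r \<odot>\<^bsub>B\<^esub> \<phi> k = \<tau> s \<odot>\<^bsub>B\<^esub> \<phi> j \<oplus>\<^bsub>B\<^esub> \<tau> t \<odot>\<^bsub>B\<^esub> \<phi> i"
proof -
  note s = free_module_single[OF S, where X = X] free_module_minus[OF S, where X = X]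
  have c: "\<tau> r \<odot>\<^bsub>B\<^esub> \<phi> k \<in> carrier B" "\<tau> s \<odot>\<^bsub>B\<^esub> \<phi> j \<in> carrier B" "\<tau> t \<odot>\<^bsub>B\<^esub> \<phi> i \<in> carrier B"
    using assms \<phi> ring_hom_onD(1)[OF hom S] by (auto intro!: B.scale_closed)
  have "free_lift \<tau> B \<phi> (Poly_Mapping.single k r - Poly_Mapping.single j s - Poly_Mapping.single i t) =
      \<tau> r \<odot>\<^bsub>B\<^esub> \<phi> k \<ominus>\<^bsub>B\<^esub> \<tau> s \<odot>\<^bsub>B\<^esub> \<phi> j \<ominus>\<^bsub>B\<^esub> \<tau> t \<odot>\<^bsub>B\<^esub> \<phi> i"
    using assms semilinear_minus[OF F.smod_axioms B hom semilinear_free_lift[OF S B hom \<phi>]]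
    by (simp add: s(1,2) F.M.minus_closed free_lift_single[OF S B hom \<phi>])
  also have "\<dots> = \<tau> r \<odot>\<^bsub>B\<^esub> \<phi> k \<ominus>\<^bsub>B\<^esub> (\<tau> s \<odot>\<^bsub>B\<^esub> \<phi> j \<oplus>\<^bsub>B\<^esub> \<tau> t \<odot>\<^bsub>B\<^esub> \<phi> i)"
    using c by (simp add: a_minus_def B.M.minus_add B.M.a_ac)
  finally show ?thesis using c by simp
qed

end

section \<open>Universal property of presented modules\<close>

locale presentation =
  fixes S :: "'f::comm_ring_1 set" and X :: "'x set" and G :: "('x \<Rightarrow>\<^sub>0 'f) set"
  assumes S: "subring_on S" and relations: "G \<subseteq> carrier (free_module S X)"
begin

interpretation F: smod S "free_module S X" by (rule smod_free_module[OF S])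

interpretation N: submod S "free_module S X" "submodule_span (ring_on S) (free_module S X) G"
  by (intro submod.intro submod_axioms.intro F.span_submod[OF relations] F.smod_axioms)

lemma smod_presented: "smod S (presented_module S X G)"
  unfolding presented_module_def by (rule N.smod_quot)

lemma presented_gen_closed: "x \<in> X \<Longrightarrow> presented_gen S X G x \<in> carrier (presented_module S X G)"
  unfolding presented_gen_def presented_module_def N.quot_carrier
  by (intro imageI free_module_single S subring_onD)

lemma presented_span:
  "submodule_span (ring_on S) (presented_module S X G) (presented_gen S X G ` X) =
    carrier (presented_module S X G)"
  unfolding presented_module_def presented_gen_def
  by (subst N.quot_span[OF free_module_span[OF S], symmetric])
    (auto simp: image_image free_module_single S subring_onD)

text \<open>The lift of the generator map is the quotient map itself, as both agree on the free
  generators. It therefore sends \<open>r\<close> to its own coset, which is zero.\<close>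

lemma presented_relation:
  assumes "r \<in> G"
  shows "free_lift id (presented_module S X G) (presented_gen S X G) r = \<zero>\<^bsub>presented_module S X G\<^esub>"
proof -
  let ?P = "presented_module S X G" and ?e = "presented_gen S X G"
  let ?c = "\<lambda>x. submodule_span (ring_on S) (free_module S X) G +>\<^bsub>free_module S X\<^esub> x"
  interpret P: smod S ?P by (rule smod_presented)
  have \<phi>: "?e \<in> X \<rightarrow> carrier ?P" using presented_gen_closed by auto
  have "free_lift id ?P ?e r = ?c r"
  proof (rule semilinear_eqI[OF F.smod_axioms smod_presented ring_hom_on_id
        semilinear_free_lift[OF S smod_presented ring_hom_on_id \<phi>] _ free_module_span[OF S]])
    show "semilinear S id (free_module S X) ?P ?c"
      unfolding presented_module_def by (rule N.semilinear_coset)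
    fix x :: "'x \<Rightarrow>\<^sub>0 'f"
    assume "x \<in> (\<lambda>k. Poly_Mapping.single k 1) ` X"
    then obtain k where k: "k \<in> X" "x = Poly_Mapping.single k 1" by auto
    then show "free_lift id ?P ?e x = ?c x"
      using free_lift_single[OF S smod_presented ring_hom_on_id \<phi>, of k 1] presented_gen_closed
      by (simp add: presented_gen_def subring_onD[OF S])
  qed (use assms relations in \<open>auto simp: free_module_single S subring_onD\<close>)
  also have "\<dots> = \<zero>\<^bsub>?P\<^esub>"
    unfolding presented_module_def
    by (rule N.coset_eq_zero) (use F.span_submod(2)[OF relations] assms in auto)
  finally show ?thesis .
qed

text \<open>The kernel of \<open>free_lift\<close> is a submodule containing \<open>G\<close>, hence
  contains the span of the relations, so the value at a representative depends only on the
  coset.\<close>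

lemma presented_lift:
  assumes B: "smod S' B" and hom: "ring_hom_on S S' \<tau>" and \<phi>: "\<phi> \<in> X \<rightarrow> carrier B"
    and "\<And>r. r \<in> G \<Longrightarrow> free_lift \<tau> B \<phi> r = \<zero>\<^bsub>B\<^esub>"
  shows "semilinear S \<tau> (presented_module S X G) B (presented_lift \<tau> B \<phi>)"
    and "\<And>x. x \<in> X \<Longrightarrow> presented_lift \<tau> B \<phi> (presented_gen S X G x) = \<phi> x"
proof -
  interpret B: smod S' B by (rule B)
  note sl = semilinear_free_lift[OF S B hom \<phi>]
  have eq: "presented_lift \<tau> B \<phi> = (\<lambda>Y. free_lift \<tau> B \<phi> (SOME y. y \<in> Y))"
    by (auto simp: presented_lift_def free_lift_def Let_def)
  have "submodule {x \<in> carrier (free_module S X). free_lift \<tau> B \<phi> x \<in> {\<zero>\<^bsub>B\<^esub>}}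
      (ring_on S) (free_module S X)"
    by (rule semilinear_vimage_submod[OF F.smod_axioms B hom sl])
      (rule B.submodI, auto)
  then have "submodule_span (ring_on S) (free_module S X) G \<subseteq>
      {x \<in> carrier (free_module S X). free_lift \<tau> B \<phi> x \<in> {\<zero>\<^bsub>B\<^esub>}}"
    by (rule F.span_submod(3)[OF relations]) (use assms(4) relations in auto)
  then have z: "free_lift \<tau> B \<phi> x = \<zero>\<^bsub>B\<^esub>"
    if "x \<in> submodule_span (ring_on S) (free_module S X) G" for x using that by auto
  note L = N.coset_lift[OF B sl hom z]
  show "semilinear S \<tau> (presented_module S X G) B (presented_lift \<tau> B \<phi>)"
    unfolding eq presented_module_def by (rule L)
  fix x assume x: "x \<in> X"
  then show "presented_lift \<tau> B \<phi> (presented_gen S X G x) = \<phi> x"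
    using L(2)[of "Poly_Mapping.single x 1"] free_lift_single[OF S B hom \<phi> x, of 1]
      free_module_single[OF S x, of 1] subring_onD(2)[OF S] ring_hom_onD(2)[OF hom S] \<phi>
    by (simp add: presented_gen_def eq Pi_iff)
qed

end

section \<open>Base change and its universal property\<close>

locale scalar_extension = smod R A for R :: "'r::comm_ring_1 set" and A :: "('r, 'x) module" (structure) +
  fixes h :: "'r \<Rightarrow> 's::comm_ring_1" and S :: "'s set"
  assumes S: "subring_on S" and hom: "ring_hom_on R S h"
begin

abbreviation "BC \<equiv> base_change R h A S"
abbreviation "tensor \<equiv> bc_tensor R h A S"

lemma bc_presentation: "presentation S (carrier A \<times> S) (bc_relations R h A S)"
proof (rule presentation.intro[OF S], rule subsetI)
  fix x assume x: "x \<in> bc_relations R h A S"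
  note c = free_module_single[OF S, of _ "carrier A \<times> S"] free_module_minus(2)[OF S, of _ "carrier A \<times> S"]
    subring_onD[OF S] ring_hom_onD(1)[OF hom subring]
  from x show "x \<in> carrier (free_module S (carrier A \<times> S))"
    unfolding bc_relations_def Let_def Un_iff mem_Collect_eq
    by (elim disjE exE conjE) (auto intro!: c)
qed

sublocale bcp: presentation S "carrier A \<times> S" "bc_relations R h A S"
  by (rule bc_presentation)

lemma smod_base_change: "smod S BC"
  unfolding base_change_def by (rule bcp.smod_presented)

sublocale BC: smod S BC
  by (rule smod_base_change)

lemma tensor_closed [simp, intro]: "a \<in> carrier A \<Longrightarrow> s \<in> S \<Longrightarrow> tensor a s \<in> carrier BC"
  unfolding base_change_def bc_tensor_def by (intro bcp.presented_gen_closed) auto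

lemma gen_closed: "presented_gen S (carrier A \<times> S) (bc_relations R h A S) \<in> carrier A \<times> S \<rightarrow> carrier BC"
  unfolding base_change_def using bcp.presented_gen_closed by auto

lemma tensor_add_left:
  assumes "a \<in> carrier A" "a' \<in> carrier A" "s \<in> S"
  shows "tensor (a \<oplus> a') s = tensor a s \<oplus>\<^bsub>BC\<^esub> tensor a' s"
proof -
  have "Poly_Mapping.single (a \<oplus> a', s) 1 - Poly_Mapping.single (a, s) 1
      - Poly_Mapping.single (a', s) 1 \<in> bc_relations R h A S"
    unfolding bc_relations_def Let_def Un_iff mem_Collect_eq using assms by blast
  from bcp.presented_relation[OF this] show ?thesis
    using assms free_lift_three[OF S smod_base_change ring_hom_on_id gen_closed]
    by (simp add: base_change_def[symmetric] bc_tensor_def[symmetric] S subring_onD)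
qed

lemma tensor_base:
  assumes "r \<in> R" "a \<in> carrier A" "s \<in> S"
  shows "tensor (r \<odot> a) s = tensor a (h r * s)"
proof -
  have "Poly_Mapping.single (r \<odot> a, s) 1 - Poly_Mapping.single (a, h r * s) 1 \<in> bc_relations R h A S"
    unfolding bc_relations_def Let_def Un_iff mem_Collect_eq using assms by blast
  from bcp.presented_relation[OF this] show ?thesis
    using assms free_lift_two[OF S smod_base_change ring_hom_on_id gen_closed] ring_hom_onD(1)[OF hom subring]
    by (simp add: base_change_def[symmetric] bc_tensor_def[symmetric] S subring_onD)
qed

lemma tensor_scale:
  assumes "a \<in> carrier A" "s \<in> S" "s' \<in> S"
  shows "tensor a (s' * s) = s' \<odot>\<^bsub>BC\<^esub> tensor a s"
proof -
  have "Poly_Mapping.single (a, s' * s) 1 - Poly_Mapping.single (a, s) s' \<in> bc_relations R h A S"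
    unfolding bc_relations_def Let_def Un_iff mem_Collect_eq using assms by blast
  from bcp.presented_relation[OF this] show ?thesis
    using assms free_lift_two[OF S smod_base_change ring_hom_on_id gen_closed]
    by (simp add: base_change_def[symmetric] bc_tensor_def[symmetric] S subring_onD)
qed

lemma tensor_eq_scale: "a \<in> carrier A \<Longrightarrow> s \<in> S \<Longrightarrow> tensor a s = s \<odot>\<^bsub>BC\<^esub> tensor a 1"
  using tensor_scale[of a 1 s] by (simp add: subring_onD[OF S])

lemma semilinear_tensor: "semilinear R h A BC (\<lambda>a. tensor a 1)"
  by (rule semilinearI)
    (auto simp: subring_onD[OF S] tensor_add_left tensor_base ring_hom_onD[OF hom subring]
      intro!: tensor_eq_scale)

text \<open>Scalars of \<open>S\<close> are absorbed by
  \<open>a \<otimes> s = s (a \<otimes> 1)\<close>, and \<open>a \<mapsto> a \<otimes> 1\<close> is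
  semilinear along \<open>h\<close>, so generators over \<open>R\<close> give generators over
  \<open>S\<close>.\<close>

lemma bc_span:
  assumes G: "submodule_span (ring_on R) A G = carrier A" "G \<subseteq> carrier A"
  shows "submodule_span (ring_on S) BC ((\<lambda>a. tensor a 1) ` G) = carrier BC" (is "?L = _")
proof
  have G': "(\<lambda>a. tensor a 1) ` G \<subseteq> carrier BC" using G by (auto simp: subring_onD[OF S])
  note sp = BC.span_submod[OF G']
  show "?L \<subseteq> carrier BC" using BC.submodD(1)[OF sp(1)] .
  have 1: "tensor a 1 \<in> ?L" if "a \<in> carrier A" for a
    using semilinear_into_submod[OF smod_axioms smod_base_change hom semilinear_tensor sp(1) G(2)]
      sp(2) that G(1) by auto
  have "tensor a s \<in> ?L" if "a \<in> carrier A" "s \<in> S" for a s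
    using BC.submodD(4)[OF sp(1) that(2) 1[OF that(1)]] tensor_eq_scale that by simp
  then have "presented_gen S (carrier A \<times> S) (bc_relations R h A S) ` (carrier A \<times> S) \<subseteq> ?L"
    by (auto simp: bc_tensor_def)
  moreover have "presented_gen S (carrier A \<times> S) (bc_relations R h A S) ` (carrier A \<times> S) \<subseteq> carrier BC"
    using gen_closed by auto
  ultimately show "carrier BC \<subseteq> ?L"
    using BC.span_submod(3)[OF _ sp(1)] bcp.presented_span by (metis base_change_def)
qed

text \<open>\<open>\<phi>\<close> enters through its values, because \<open>loop_act\<close>,
  \<open>W_TR\<close>, \<open>CE_proj\<close> and \<open>W_CE\<close> spell it differently.
  Semilinearity of \<open>\<psi>\<close> along \<open>\<tau> \<circ> h\<close> is what the relation
  moving scalars of \<open>R\<close> across the tensor sign demands.\<close>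

lemma bc_lift:
  assumes B: "smod S' B" and \<tau>: "ring_hom_on S S' \<tau>"
    and \<psi>: "semilinear R (\<tau> \<circ> h) A B \<psi>"
    and \<phi>: "\<And>a s. a \<in> carrier A \<Longrightarrow> s \<in> S \<Longrightarrow> \<phi> (a, s) = \<tau> s \<odot>\<^bsub>B\<^esub> \<psi> a"
  shows "semilinear S \<tau> BC B (presented_lift \<tau> B \<phi>)"
    and "\<And>a s. a \<in> carrier A \<Longrightarrow> s \<in> S \<Longrightarrow> presented_lift \<tau> B \<phi> (tensor a s) = \<tau> s \<odot>\<^bsub>B\<^esub> \<psi> a"
proof -
  interpret B: smod S' B by (rule B)
  note h = ring_hom_onD[OF hom subring] and t = ring_hom_onD[OF \<tau> S] and p = semilinearD[OF \<psi>]
  have \<phi>c: "\<phi> \<in> carrier A \<times> S \<rightarrow> carrier B"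
    using \<phi> p(1) t(1) by auto
  have rel: "free_lift \<tau> B \<phi> x = \<zero>\<^bsub>B\<^esub>" if x: "x \<in> bc_relations R h A S" for x
    using x unfolding bc_relations_def Let_def Un_iff mem_Collect_eq
    by (elim disjE exE conjE)
      (simp_all add: free_lift_three[OF S B \<tau> \<phi>c] free_lift_two[OF S B \<tau> \<phi>c] \<phi> h t p
        subring_onD[OF S] B.scale_add_left B.scale_add_right B.scale_scale B.S_closed
        B.scale_closed ac_simps)
  note L = bcp.presented_lift[OF B \<tau> \<phi>c rel]
  show "semilinear S \<tau> BC B (presented_lift \<tau> B \<phi>)"
    using L(1) by (simp add: base_change_def)
  show "presented_lift \<tau> B \<phi> (tensor a s) = \<tau> s \<odot>\<^bsub>B\<^esub> \<psi> a" if "a \<in> carrier A" "s \<in> S" for a s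
    using L(2)[of "(a, s)"] that \<phi> by (simp add: bc_tensor_def)
qed

end

section \<open>Tensor products\<close>

locale tensor_factors = M': smod UNIV M' + M: smod UNIV M
  for M' :: "(complex, 'a) module" and M :: "(complex, 'b) module"
begin

lemma T_presentation:
  "presentation UNIV (T_gens M' M :: ('a, 'n, 'm::finite, 'b) tgen set) (T_relations M' M)"
proof (rule presentation.intro[OF subring_on_UNIV], rule subsetI)
  fix x :: "('a, 'n, 'm, 'b) tgen \<Rightarrow>\<^sub>0 complex"
  assume x: "x \<in> T_relations M' M"
  from x show "x \<in> carrier (free_module UNIV (T_gens M' M))"
    unfolding T_relations_def Let_def Un_iff mem_Collect_eq
    by (elim disjE exE conjE)
      (auto intro!: free_module_single[OF subring_on_UNIV] free_module_minus(2)[OF subring_on_UNIV]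
        simp: T_gens_def)
qed

lemma smod_T: "smod UNIV (T_mod M' M :: (complex, ('a, 'n, 'm::finite, 'b) tens) module)"
  unfolding T_mod_def by (rule presentation.smod_presented[OF T_presentation])

lemma T_pure_closed [simp, intro]:
  "u' \<in> carrier M' \<Longrightarrow> u \<in> carrier M \<Longrightarrow> T_pure M' M u' v u \<in> carrier (T_mod M' M)"
  unfolding T_pure_def T_mod_def
  by (rule presentation.presented_gen_closed[OF T_presentation]) (auto simp: T_gens_def)

lemma T_span_pure:
  "submodule_span (ring_on UNIV) (T_mod M' M :: (complex, ('a, 'n, 'm::finite, 'b) tens) module)
     {T_pure M' M u' v u |u' v u. u' \<in> carrier M' \<and> u \<in> carrier M} = carrier (T_mod M' M)"
proof -
  have "{T_pure M' M u' v u |u' v u. u' \<in> carrier M' \<and> u \<in> carrier M} =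
      presented_gen UNIV (T_gens M' M) (T_relations M' M) `
        (T_gens M' M :: ('a, 'n, 'm::finite, 'b) tgen set)"
    by (fastforce simp: T_gens_def T_pure_def)
  then show ?thesis
    unfolding T_mod_def by (simp only: presentation.presented_span[OF T_presentation])
qed

text \<open>The three families of relations, one for each kind of factor, share the coefficients
  \<open>1\<close>, \<open>c\<close>, \<open>1\<close>; the three linearity rules below are
  instances.\<close>

lemma T_relation:
  fixes v v' v'' :: "'n \<Rightarrow> (complex, 'm::finite) vec"
  assumes r: "Poly_Mapping.single (x, v, y) 1 - Poly_Mapping.single (x', v', y') c -
      Poly_Mapping.single (x'', v'', y'') 1 \<in> T_relations M' M"
    and "x \<in> carrier M'" "y \<in> carrier M" "x' \<in> carrier M'" "y' \<in> carrier M"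
      "x'' \<in> carrier M'" "y'' \<in> carrier M"
  shows "T_pure M' M x v y = c \<odot>\<^bsub>T_mod M' M\<^esub> T_pure M' M x' v' y' \<oplus>\<^bsub>T_mod M' M\<^esub> T_pure M' M x'' v'' y''"
proof -
  let ?T = "T_mod M' M :: (complex, ('a, 'n, 'm, 'b) tens) module"
  let ?e = "presented_gen UNIV (T_gens M' M) (T_relations M' M) :: _ \<Rightarrow> ('a, 'n, 'm, 'b) tens"
  note P = T_presentation
  have c: "?e \<in> T_gens M' M \<rightarrow> carrier ?T"
    unfolding T_mod_def using presentation.presented_gen_closed[OF P] by auto
  interpret T: smod UNIV ?T by (rule smod_T)
  have g: "(x, v, y) \<in> T_gens M' M" "(x', v', y') \<in> T_gens M' M" "(x'', v'', y'') \<in> T_gens M' M"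
    using assms(2-) by (auto simp: T_gens_def)
  then have e: "?e (x, v, y) \<in> carrier ?T" "?e (x', v', y') \<in> carrier ?T" "?e (x'', v'', y'') \<in> carrier ?T"
    using c by auto
  have "1 \<odot>\<^bsub>?T\<^esub> ?e (x, v, y) = c \<odot>\<^bsub>?T\<^esub> ?e (x', v', y') \<oplus>\<^bsub>?T\<^esub> 1 \<odot>\<^bsub>?T\<^esub> ?e (x'', v'', y'')"
    using free_lift_three[OF subring_on_UNIV smod_T ring_hom_on_id c g, of 1 c 1]
      presentation.presented_relation[OF P r, folded T_mod_def] by simp
  then show ?thesis
    unfolding T_pure_def using e by simp
qed

lemma T_pure_first:
  assumes "x \<in> carrier M'" "y \<in> carrier M'" "u \<in> carrier M"
  shows "T_pure M' M (c \<odot>\<^bsub>M'\<^esub> x \<oplus>\<^bsub>M'\<^esub> y) v u =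
    c \<odot>\<^bsub>T_mod M' M\<^esub> T_pure M' M x v u \<oplus>\<^bsub>T_mod M' M\<^esub> T_pure M' M y v u"
  by (rule T_relation) (use assms in \<open>fastforce simp: T_relations_def\<close>)+

lemma T_pure_mid:
  assumes "u' \<in> carrier M'" "u \<in> carrier M"
  shows "T_pure M' M u' (v(i := c *s x + y)) u =
    c \<odot>\<^bsub>T_mod M' M\<^esub> T_pure M' M u' (v(i := x)) u \<oplus>\<^bsub>T_mod M' M\<^esub> T_pure M' M u' (v(i := y)) u"
  by (rule T_relation) (use assms in \<open>fastforce simp: T_relations_def\<close>)+

lemma T_pure_last:
  assumes "u' \<in> carrier M'" "x \<in> carrier M" "y \<in> carrier M"
  shows "T_pure M' M u' v (c \<odot>\<^bsub>M\<^esub> x \<oplus>\<^bsub>M\<^esub> y) =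
    c \<odot>\<^bsub>T_mod M' M\<^esub> T_pure M' M u' v x \<oplus>\<^bsub>T_mod M' M\<^esub> T_pure M' M u' v y"
  by (rule T_relation) (use assms in \<open>fastforce simp: T_relations_def\<close>)+

lemma T_lift:
  fixes \<phi> :: "('a, 'n, 'm::finite, 'b) tgen \<Rightarrow> 'y"
  assumes B: "smod S' B" and hom: "ring_hom_on UNIV S' \<tau>"
    and closed: "\<And>u' v u. u' \<in> carrier M' \<Longrightarrow> u \<in> carrier M \<Longrightarrow> \<phi> (u', v, u) \<in> carrier B"
    and first: "\<And>c x y v u. x \<in> carrier M' \<Longrightarrow> y \<in> carrier M' \<Longrightarrow> u \<in> carrier M \<Longrightarrow>
      \<phi> (c \<odot>\<^bsub>M'\<^esub> x \<oplus>\<^bsub>M'\<^esub> y, v, u) = \<tau> c \<odot>\<^bsub>B\<^esub> \<phi> (x, v, u) \<oplus>\<^bsub>B\<^esub> \<phi> (y, v, u)"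
    and mid: "\<And>u' v i c x y u. u' \<in> carrier M' \<Longrightarrow> u \<in> carrier M \<Longrightarrow>
      \<phi> (u', v(i := c *s x + y), u) =
        \<tau> c \<odot>\<^bsub>B\<^esub> \<phi> (u', v(i := x), u) \<oplus>\<^bsub>B\<^esub> \<phi> (u', v(i := y), u)"
    and last: "\<And>u' v c x y. u' \<in> carrier M' \<Longrightarrow> x \<in> carrier M \<Longrightarrow> y \<in> carrier M \<Longrightarrow>
      \<phi> (u', v, c \<odot>\<^bsub>M\<^esub> x \<oplus>\<^bsub>M\<^esub> y) = \<tau> c \<odot>\<^bsub>B\<^esub> \<phi> (u', v, x) \<oplus>\<^bsub>B\<^esub> \<phi> (u', v, y)"
  shows "semilinear UNIV \<tau> (T_mod M' M) B (presented_lift \<tau> B \<phi>)"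
    and "\<And>u' v u. u' \<in> carrier M' \<Longrightarrow> u \<in> carrier M \<Longrightarrow>
      presented_lift \<tau> B \<phi> (T_pure M' M u' v u) = \<phi> (u', v, u)"
proof -
  interpret B: smod S' B by (rule B)
  have \<phi>c: "\<phi> \<in> T_gens M' M \<rightarrow> carrier B"
    using closed by (auto simp: T_gens_def)
  note h = ring_hom_onD[OF hom subring_on_UNIV]
  have rel: "free_lift \<tau> B \<phi> x = \<zero>\<^bsub>B\<^esub>" if x: "x \<in> T_relations M' M" for x
    using x unfolding T_relations_def Let_def Un_iff mem_Collect_eq
    by (elim disjE exE conjE)
      (simp_all add: free_lift_three[OF subring_on_UNIV B hom \<phi>c] T_gens_def first mid last closed h
        B.scale_closed)
  note L = presentation.presented_lift[OF T_presentation B hom \<phi>c rel]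
  show "semilinear UNIV \<tau> (T_mod M' M) B (presented_lift \<tau> B \<phi>)"
    using L(1) by (simp add: T_mod_def)
  show "presented_lift \<tau> B \<phi> (T_pure M' M u' v u) = \<phi> (u', v, u)"
    if "u' \<in> carrier M'" "u \<in> carrier M" for u' v u
    using L(2)[of "(u', v, u)"] that by (simp add: T_pure_def T_gens_def)
qed

text \<open>Linearity with \<open>c = 1\<close> and two zero vectors gives
  \<open>z = z + z\<close>.\<close>

lemma T_pure_mid_zero:
  fixes v :: "'n \<Rightarrow> (complex, 'm::finite) vec"
  assumes "u' \<in> carrier M'" "u \<in> carrier M"
  shows "T_pure M' M u' (v(i := 0)) u = \<zero>\<^bsub>T_mod M' M\<^esub>"
proof -
  interpret T: smod UNIV "T_mod M' M :: (complex, ('a, 'n, 'm, 'b) tens) module" by (rule smod_T)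
  have "T_pure M' M u' (v(i := 0)) u =
      T_pure M' M u' (v(i := 0)) u \<oplus>\<^bsub>T_mod M' M\<^esub> T_pure M' M u' (v(i := 0)) u"
    using T_pure_mid[OF assms, of v i 1 0 0] assms by simp
  then show ?thesis using assms T.M.add.l_cancel_one' by (metis T_pure_closed)
qed

lemma T_pure_mid_scale:
  fixes v :: "'n \<Rightarrow> (complex, 'm::finite) vec"
  assumes "u' \<in> carrier M'" "u \<in> carrier M"
  shows "T_pure M' M u' (v(i := c *s x)) u = c \<odot>\<^bsub>T_mod M' M\<^esub> T_pure M' M u' (v(i := x)) u"
proof -
  interpret T: smod UNIV "T_mod M' M :: (complex, ('a, 'n, 'm, 'b) tens) module" by (rule smod_T)
  show ?thesis using T_pure_mid[OF assms, of v i c x 0] assms by (simp add: T_pure_mid_zero)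
qed

lemma T_pure_mid_expand:
  fixes w :: "(complex, 'm::finite) vec" and v :: "'n \<Rightarrow> (complex, 'm) vec"
  assumes "u' \<in> carrier M'" "u \<in> carrier M"
  shows "T_pure M' M u' (v(i := w)) u =
    (\<Oplus>\<^bsub>T_mod M' M\<^esub>j\<in>UNIV. w $ j \<odot>\<^bsub>T_mod M' M\<^esub> T_pure M' M u' (v(i := axis j 1)) u)"
proof -
  interpret T: smod UNIV "T_mod M' M :: (complex, ('a, 'n, 'm, 'b) tens) module" by (rule smod_T)
  have "T_pure M' M u' (v(i := \<Sum>j\<in>F. w $ j *s axis j 1)) u =
      (\<Oplus>\<^bsub>T_mod M' M\<^esub>j\<in>F. w $ j \<odot>\<^bsub>T_mod M' M\<^esub> T_pure M' M u' (v(i := axis j 1)) u)"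
    if "finite F" for F
    using that
  proof (induction F)
    case empty
    show ?case unfolding sum.empty T.M.finsum_empty by (rule T_pure_mid_zero[OF assms])
  next
    case (insert j F)
    have "(\<lambda>j. w $ j \<odot>\<^bsub>T_mod M' M\<^esub> T_pure M' M u' (v(i := axis j 1)) u) \<in> F \<rightarrow> carrier (T_mod M' M)"
      "w $ j \<odot>\<^bsub>T_mod M' M\<^esub> T_pure M' M u' (v(i := axis j 1)) u \<in> carrier (T_mod M' M)"
      by (intro Pi_I T.scale_closed T_pure_closed assms UNIV_I)+
    then show ?case using insert
      by (simp only: sum.insert T_pure_mid[OF assms] T.M.finsum_insert not_False_eq_True)
  qed
  from this[OF finite[of UNIV]] show ?thesis unfolding basis_expansion .
qed

lemma T_pure_scale_all:
  fixes c :: "'n::finite \<Rightarrow> complex" and v :: "'n \<Rightarrow> (complex, 'm::finite) vec"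
  assumes "u' \<in> carrier M'" "u \<in> carrier M"
  shows "T_pure M' M u' (\<lambda>i. c i *s v i) u = (\<Prod>i\<in>UNIV. c i) \<odot>\<^bsub>T_mod M' M\<^esub> T_pure M' M u' v u"
proof -
  interpret T: smod UNIV "T_mod M' M :: (complex, ('a, 'n, 'm, 'b) tens) module" by (rule smod_T)
  have "T_pure M' M u' (\<lambda>i. if i \<in> F then c i *s v i else v i) u =
      (\<Prod>i\<in>F. c i) \<odot>\<^bsub>T_mod M' M\<^esub> T_pure M' M u' v u" if "finite F" for F
    using that
  proof (induction F)
    case (insert i F)
    have "(\<lambda>j. if j \<in> insert i F then c j *s v j else v j) =
        (\<lambda>j. if j \<in> F then c j *s v j else v j)(i := c i *s v i)" by auto
    moreover have "(\<lambda>j. if j \<in> F then c j *s v j else v j)(i := v i) =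
        (\<lambda>j. if j \<in> F then c j *s v j else v j)" using insert by auto
    ultimately show ?case using insert assms by (simp add: T_pure_mid_scale T.scale_scale)
  qed (use assms in simp)
  from this[OF finite[of UNIV]] show ?thesis by simp
qed

definition basis_tensors :: "('a, 'n, 'm::finite, 'b) tens set" where
  "basis_tensors = {T_pure M' M u' (\<lambda>i. axis (J i) 1) u |u' J u. u' \<in> carrier M' \<and> u \<in> carrier M}"

lemma basis_tensors_closed: "basis_tensors \<subseteq> carrier (T_mod M' M)"
  by (auto simp: basis_tensors_def)

text \<open>Induction on a set \<open>F\<close> of places that may carry arbitrary vectors: each
  such vector is expanded in the basis, while the places outside \<open>F\<close> already carry
  basis vectors.\<close>

lemma T_span_basis:
  "submodule_span (ring_on UNIV) (T_mod M' M) basis_tensors =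
    carrier (T_mod M' M :: (complex, ('a, 'n::finite, 'm::finite, 'b) tens) module)" (is "?L = _")
proof
  interpret T: smod UNIV "T_mod M' M :: (complex, ('a, 'n, 'm, 'b) tens) module" by (rule smod_T)
  note sp = T.span_submod[OF basis_tensors_closed]
  note B = T.submodD[OF sp(1)]
  show "?L \<subseteq> carrier (T_mod M' M)" by (rule B)
  have *: "\<forall>v. (\<forall>i. i \<notin> F \<longrightarrow> v i \<in> range (\<lambda>j. axis j 1)) \<longrightarrow> T_pure M' M u' v u \<in> ?L"
    if u: "u' \<in> carrier M'" "u \<in> carrier M" and "finite F" for u' u and F :: "'n set"
    using that(3)
  proof (induction F)
    case empty
    show ?case
    proof (intro allI impI)
      fix v :: "'n \<Rightarrow> (complex, 'm) vec"
      assume "\<forall>i. i \<notin> {} \<longrightarrow> v i \<in> range (\<lambda>j. axis j 1)"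
      then have "\<forall>i. \<exists>j. v i = axis j 1" by auto
      then obtain J where "v = (\<lambda>i. axis (J i) 1)" by metis
      then show "T_pure M' M u' v u \<in> ?L" using sp(2) u by (auto simp: basis_tensors_def)
    qed
  next
    case (insert i F)
    show ?case
    proof (intro allI impI)
      fix v :: "'n \<Rightarrow> (complex, 'm) vec"
      assume v: "\<forall>k. k \<notin> insert i F \<longrightarrow> v k \<in> range (\<lambda>j. axis j 1)"
      have "T_pure M' M u' (v(i := axis j 1)) u \<in> ?L" for j
        using insert.IH v by auto
      then have "T_pure M' M u' (v(i := v i)) u \<in> ?L"
        by (subst T_pure_mid_expand[OF u]) (intro T.finsum_in_submod[OF sp(1)] B, auto)
      then show "T_pure M' M u' v u \<in> ?L" by simp
    qed
  qed
  have "{T_pure M' M u' v u |u' v u. u' \<in> carrier M' \<and> u \<in> carrier M} \<subseteq> ?L"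
    using *[OF _ _ finite[of UNIV]] by auto
  then show "carrier (T_mod M' M) \<subseteq> ?L"
    by (subst T_span_pure[symmetric], intro T.span_submod(3)[OF _ sp(1)]) auto
qed

lemma act_first:
  assumes A: "semilinear UNIV id M' M' A"
  shows "semilinear UNIV id (T_mod M' M) (T_mod M' M) (act_first M' M A)"
    and "\<And>u' v u. u' \<in> carrier M' \<Longrightarrow> u \<in> carrier M \<Longrightarrow>
      act_first M' M A (T_pure M' M u' v u) = T_pure M' M (A u') v u"
proof -
  note L = T_lift[OF smod_T ring_hom_on_id,
      where \<phi> = "\<lambda>(u', v, u). T_pure M' M (A u') v u", folded act_first_def]
  show "semilinear UNIV id (T_mod M' M) (T_mod M' M) (act_first M' M A)"
    by (rule L) (auto simp: semilinearD[OF A] T_pure_first T_pure_mid T_pure_last)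
  show "act_first M' M A (T_pure M' M u' v u) = T_pure M' M (A u') v u"
    if "u' \<in> carrier M'" "u \<in> carrier M" for u' v u
    by (subst L) (use that in \<open>auto simp: semilinearD[OF A] T_pure_first T_pure_mid T_pure_last\<close>)
qed

lemma act_last:
  assumes A: "semilinear UNIV id M M A"
  shows "semilinear UNIV id (T_mod M' M) (T_mod M' M) (act_last M' M A)"
    and "\<And>u' v u. u' \<in> carrier M' \<Longrightarrow> u \<in> carrier M \<Longrightarrow>
      act_last M' M A (T_pure M' M u' v u) = T_pure M' M u' v (A u)"
proof -
  note L = T_lift[OF smod_T ring_hom_on_id,
      where \<phi> = "\<lambda>(u', v, u). T_pure M' M u' v (A u)", folded act_last_def]
  show "semilinear UNIV id (T_mod M' M) (T_mod M' M) (act_last M' M A)"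
    by (rule L) (auto simp: semilinearD[OF A] T_pure_first T_pure_mid T_pure_last)
  show "act_last M' M A (T_pure M' M u' v u) = T_pure M' M u' v (A u)"
    if "u' \<in> carrier M'" "u \<in> carrier M" for u' v u
    by (subst L) (use that in \<open>auto simp: semilinearD[OF A] T_pure_first T_pure_mid T_pure_last\<close>)
qed

lemma act_mid:
  assumes A: "\<And>c x y. A (c *s x + y) = c *s A x + A y"
  shows "semilinear UNIV id (T_mod M' M) (T_mod M' M) (act_mid M' M i A)"
    and "\<And>u' v u. u' \<in> carrier M' \<Longrightarrow> u \<in> carrier M \<Longrightarrow>
      act_mid M' M i A (T_pure M' M u' v u) = T_pure M' M u' (v(i := A (v i))) u"
proof -
  \<comment> \<open>The place \<open>j\<close> being varied may be the place \<open>i\<close> on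
    which \<open>A\<close> acts. If it is, linearity of \<open>A\<close> is used; otherwise the two
    updates commute.\<close>
  have mid: "T_pure M' M u' ((v(j := c *s x + y))(i := A ((v(j := c *s x + y)) i))) u =
      c \<odot>\<^bsub>T_mod M' M\<^esub> T_pure M' M u' ((v(j := x))(i := A ((v(j := x)) i))) u \<oplus>\<^bsub>T_mod M' M\<^esub>
      T_pure M' M u' ((v(j := y))(i := A ((v(j := y)) i))) u"
    if "u' \<in> carrier M'" "u \<in> carrier M" for u' u v j c x y
    using that by (cases "i = j") (simp_all add: A T_pure_mid fun_upd_twist[of j i])
  note L = T_lift[OF smod_T ring_hom_on_id,
      where \<phi> = "\<lambda>(u', v, u). T_pure M' M u' (v(i := A (v i))) u", folded act_mid_def]
  show "semilinear UNIV id (T_mod M' M) (T_mod M' M) (act_mid M' M i A)"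
    by (rule L) (auto simp: T_pure_first mid T_pure_last simp del: fun_upd_apply)
  show "act_mid M' M i A (T_pure M' M u' v u) = T_pure M' M u' (v(i := A (v i))) u"
    if "u' \<in> carrier M'" "u \<in> carrier M" for u' v u
    by (subst L) (use that in \<open>auto simp: T_pure_first mid T_pure_last simp del: fun_upd_apply\<close>)
qed

end

section \<open>Rational functions and the localizations\<close>

lemma to_fract_sum: "to_fract (sum f A) = (\<Sum>i\<in>A. to_fract (f i))"
  by (induction A rule: infinite_finite_induct) simp_all

lemma to_fract_prod: "to_fract (prod f A) = (\<Prod>i\<in>A. to_fract (f i))"
  by (induction A rule: infinite_finite_induct) simp_all

lemma to_fract_power: "to_fract (p ^ n) = to_fract p ^ n"
  by (induction n) simp_all

lemma rconst_to_fract: "rconst c = to_fract (pconst c)"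
  by (simp add: rconst_def to_fract_def)

lemma xvar_to_fract: "xvar i = to_fract (pvar i)"
  by (simp add: xvar_def to_fract_def)

lemma pconst_hom:
  "pconst 0 = 0" "pconst 1 = 1" "pconst (c + d) = pconst c + pconst d"
  "pconst (c * d) = pconst c * pconst d" "pconst (- c) = - pconst c"
  by (simp_all add: pconst_def single_add mult_single single_uminus)

lemma rconst_hom [simp]:
  "rconst 0 = 0" "rconst 1 = 1" "rconst (c + d) = rconst c + rconst d"
  "rconst (c * d) = rconst c * rconst d" "rconst (- c) = - rconst c"
  by (simp_all add: rconst_to_fract pconst_hom)

lemma rconst_power: "rconst (c ^ n) = rconst c ^ n"
  by (induction n) simp_all

lemma rconst_prod: "rconst (prod f A) = (\<Prod>i\<in>A. rconst (f i))"
  by (induction A rule: infinite_finite_induct) simp_all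

lemma rconst_eq_0_iff [simp]: "rconst c = 0 \<longleftrightarrow> c = 0"
proof -
  have "pconst c = 0 \<longleftrightarrow> c = 0"
    by (metis lookup_single_eq lookup_zero pconst_def pconst_hom(1))
  then show ?thesis by (simp add: rconst_to_fract)
qed

lemma rconst_eq_iff: "rconst c = rconst d \<longleftrightarrow> c = d"
  using rconst_eq_0_iff[of "c + - d"] by (simp only: rconst_hom) (simp add: add_eq_0_iff)

lemma rconst_inverse: "rconst (inverse c) = inverse (rconst c)"
proof (cases "c = 0")
  case False
  then have "rconst (inverse c) * rconst c = 1" by (simp flip: rconst_hom(4))
  then show ?thesis by (metis inverse_unique mult.commute)
qed simp

lemma rconst_powi: "rconst (c powi k) = rconst c powi k"
  by (simp add: power_int_def rconst_power rconst_inverse)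

lemma pvar_neq: "pvar i \<noteq> 0" "i \<noteq> j \<Longrightarrow> pvar i - pconst c * pvar j \<noteq> 0"
proof -
  show "pvar i \<noteq> 0"
    by (simp add: pvar_def) (metis lookup_single_eq lookup_zero zero_neq_one)
  assume "i \<noteq> j"
  then have "Poly_Mapping.single i (1::nat) \<noteq> Poly_Mapping.single j 1"
    by (metis lookup_single_eq lookup_single_not_eq zero_neq_one)
  then have "Poly_Mapping.lookup (pvar i - pconst c * pvar j) (Poly_Mapping.single i 1) = 1"
    by (simp add: pvar_def pconst_def mult_single lookup_minus lookup_single when_def)
  then show "pvar i - pconst c * pvar j \<noteq> 0" by auto
qed

lemma xvar_neq_0 [simp]: "xvar i \<noteq> 0"
  by (simp add: xvar_to_fract pvar_neq)

lemma discr_neq_0: "(discr \<epsilon> l :: 'n::{finite,linorder} pol) \<noteq> 0"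
proof -
  have "pvar i - pconst c * pvar j \<noteq> 0" if "j \<in> UNIV - {i}" for i j :: 'n and c
    using that by (intro pvar_neq) auto
  then show ?thesis by (simp add: discr_def pvar_neq(1))
qed

definition mon :: "('n \<Rightarrow> 'n ratf) \<Rightarrow> ('n \<Rightarrow>\<^sub>0 nat) \<Rightarrow> 'n::{finite,linorder} ratf" where
  "mon a m = (\<Prod>i\<in>UNIV. a i ^ Poly_Mapping.lookup m i)"

lemma mon_add: "mon a (m + m') = mon a m * mon a m'"
  by (simp add: mon_def lookup_add power_add prod.distrib)

lemma pol_eval_superset:
  assumes "finite K" "Poly_Mapping.keys p \<subseteq> K"
  shows "pol_eval a p = (\<Sum>m\<in>K. rconst (Poly_Mapping.lookup p m) * mon a m)"
  unfolding pol_eval_def mon_def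
  by (rule sum.mono_neutral_left) (use assms in \<open>auto simp: in_keys_iff\<close>)

lemma pol_eval_add: "pol_eval a (p + q) = pol_eval a p + pol_eval a q"
proof -
  define K where "K = Poly_Mapping.keys p \<union> Poly_Mapping.keys q"
  have "finite K" "Poly_Mapping.keys p \<subseteq> K" "Poly_Mapping.keys q \<subseteq> K" "Poly_Mapping.keys (p + q) \<subseteq> K"
    using Poly_Mapping.keys_add[of p q] by (auto simp: K_def)
  then show ?thesis
    by (simp add: pol_eval_superset[of K] lookup_add algebra_simps sum.distrib)
qed

lemma pol_eval_single: "pol_eval a (Poly_Mapping.single m c) = rconst c * mon a m"
  by (subst pol_eval_superset[of "{m}"]) (auto simp: lookup_single)

lemma poly_mapping_add_induct:
  fixes p :: "'k \<Rightarrow>\<^sub>0 'c::comm_monoid_add"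
  assumes "\<And>m c. P (Poly_Mapping.single m c)" "\<And>p q. P p \<Longrightarrow> P q \<Longrightarrow> P (p + q)"
  shows "P p"
proof -
  have z: "P 0" using assms(1)[of _ 0] by simp
  have "P (\<Sum>k\<in>K. Poly_Mapping.single k (Poly_Mapping.lookup p k))" if "finite K" for K
    using that by (induction K) (auto simp: z assms)
  from this[of "Poly_Mapping.keys p"] show ?thesis
    by (subst poly_mapping_eqI[of p "\<Sum>k\<in>Poly_Mapping.keys p. Poly_Mapping.single k (Poly_Mapping.lookup p k)"])
      (simp_all add: lookup_sum lookup_single when_def in_keys_iff)
qed

lemma pol_eval_mult: "pol_eval a (p * q) = pol_eval a p * pol_eval a q"
proof (induction p rule: poly_mapping_add_induct)
  case (1 m c)
  show ?case
    by (induction q rule: poly_mapping_add_induct)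
      (simp_all add: mult_single pol_eval_single mon_add pol_eval_add algebra_simps)
qed (simp add: pol_eval_add algebra_simps)

lemma pol_eval_1: "pol_eval a 1 = 1"
  using pol_eval_single[of a 0 1] by (simp add: mon_def)

lemma pol_eval_pvar: "pol_eval a (pvar i) = a i"
proof -
  have "mon a (Poly_Mapping.single i 1) = (\<Prod>j\<in>UNIV. if j = i then a i else 1)"
    unfolding mon_def by (rule prod.cong) (auto simp: lookup_single when_def)
  then show ?thesis by (simp add: pvar_def pol_eval_single)
qed

lemma pol_eval_pconst: "pol_eval a (pconst c) = rconst c"
  using pol_eval_single[of a 0 c] by (simp add: pconst_def mon_def)

definition alg_indep :: "('n \<Rightarrow> 'n::{finite,linorder} ratf) \<Rightarrow> bool" where
  "alg_indep a \<longleftrightarrow> (\<forall>p. p \<noteq> 0 \<longrightarrow> pol_eval a p \<noteq> 0)"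

text \<open>\<open>frac_subst\<close> picks some fraction representing its argument. Evaluation
  respects cross multiplication, and algebraic independence keeps both denominators nonzero, so
  every representing fraction gives the same quotient.\<close>

lemma frac_subst_Fract:
  fixes a :: "'n::{finite,linorder} \<Rightarrow> 'n ratf"
  assumes "alg_indep a" "q \<noteq> 0"
  shows "frac_subst a (Fract p q) = pol_eval a p / pol_eval a q"
proof -
  note ai = assms(1)[unfolded alg_indep_def, rule_format]
  define s where "s = (SOME (p', q'). q' \<noteq> 0 \<and> Fract p q = Fract p' q')"
  have "case s of (p', q') \<Rightarrow> q' \<noteq> 0 \<and> Fract p q = Fract p' q'"
    unfolding s_def by (rule someI[of _ "(p, q)"]) (use assms in simp)
  then obtain p' q' where s: "s = (p', q')" "q' \<noteq> 0" "Fract p q = Fract p' q'" by (cases s) auto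
  then have "p * q' = p' * q" using assms by (simp add: eq_fract)
  then have "pol_eval a p * pol_eval a q' = pol_eval a p' * pol_eval a q"
    by (simp flip: pol_eval_mult)
  moreover have "frac_subst a (Fract p q) = pol_eval a p' / pol_eval a q'"
    using s(1) by (simp add: frac_subst_def s_def)
  ultimately show ?thesis using ai[OF assms(2)] ai[OF s(2)] by (simp add: frac_eq_eq)
qed

lemma Fract_to_fract: "q \<noteq> 0 \<Longrightarrow> Fract p q = to_fract p / to_fract q"
  by (simp add: Fract_conv_to_fract)

lemma frac_subst_hom:
  fixes a :: "'n::{finite,linorder} \<Rightarrow> 'n ratf"
  assumes a: "alg_indep a"
  shows "ring_hom_on UNIV UNIV (frac_subst a)" "frac_subst a (to_fract p) = pol_eval a p"
    "frac_subst a (rconst c) = rconst c" "frac_subst a (xvar i) = a i"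
proof -
  note ai = a[unfolded alg_indep_def, rule_format]
  show to_fract: "frac_subst a (to_fract p) = pol_eval a p" for p
    unfolding to_fract_def by (subst frac_subst_Fract[OF a]) (auto simp: pol_eval_1)
  show "frac_subst a (rconst c) = rconst c" "frac_subst a (xvar i) = a i"
    by (simp_all add: rconst_to_fract xvar_to_fract to_fract pol_eval_pconst pol_eval_pvar)
  have "frac_subst a (x + y) = frac_subst a x + frac_subst a y \<and>
      frac_subst a (x * y) = frac_subst a x * frac_subst a y" for x y :: "'n ratf"
  proof -
    obtain p q p' q' where x: "x = Fract p q" "q \<noteq> 0" and y: "y = Fract p' q'" "q' \<noteq> 0"
      by (metis Fract_cases)
    then show ?thesis
      using ai[of q] ai[of q']
      by (simp add: frac_subst_Fract[OF a] pol_eval_add pol_eval_mult field_simps)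
  qed
  then show "ring_hom_on UNIV UNIV (frac_subst a)"
    using to_fract[of 1] by (auto simp: ring_hom_on_def pol_eval_1)
qed

lemma rconst_times_to_fract:
  "rconst c * to_fract (Poly_Mapping.single m d) = to_fract (Poly_Mapping.single m (c * d))"
proof -
  have "Poly_Mapping.single m (c * d) = pconst c * Poly_Mapping.single m d"
    by (simp add: pconst_def mult_single)
  then show ?thesis by (simp add: rconst_to_fract)
qed

lemma mon_monomials:
  fixes \<sigma> :: "'n::{finite,linorder} \<Rightarrow> 'n"
  shows "mon (\<lambda>i. rconst (c i) * xvar (\<sigma> i) ^ e) m =
    to_fract (Poly_Mapping.single
      (\<Sum>i\<in>UNIV. Poly_Mapping.single (\<sigma> i) (e * Poly_Mapping.lookup m i))
      (\<Prod>i\<in>UNIV. c i ^ Poly_Mapping.lookup m i))"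
proof -
  have power_pvar: "pvar i ^ k = Poly_Mapping.single (Poly_Mapping.single i k) 1" for i :: 'n and k
    by (induction k) (simp_all add: pvar_def mult_single flip: single_add)
  have power_pconst: "pconst d ^ k = pconst (d ^ k)" for d k
    by (induction k) (simp_all add: pconst_hom)
  have "(\<Prod>i\<in>F. pconst (c i) ^ Poly_Mapping.lookup m i * pvar (\<sigma> i) ^ (e * Poly_Mapping.lookup m i)) =
    Poly_Mapping.single (\<Sum>i\<in>F. Poly_Mapping.single (\<sigma> i) (e * Poly_Mapping.lookup m i))
      (\<Prod>i\<in>F. c i ^ Poly_Mapping.lookup m i)" if "finite F" for F
    using that
  proof (induction F)
    case (insert i F)
    then show ?case by (simp add: power_pvar power_pconst) (simp add: pconst_def mult_single)
  qed simp
  note * = this[OF finite[of UNIV]]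
  have "mon (\<lambda>i. rconst (c i) * xvar (\<sigma> i) ^ e) m = to_fract
      (\<Prod>i\<in>UNIV. pconst (c i) ^ Poly_Mapping.lookup m i * pvar (\<sigma> i) ^ (e * Poly_Mapping.lookup m i))"
    by (simp add: mon_def to_fract_prod to_fract_power rconst_to_fract xvar_to_fract
        power_mult_distrib power_mult)
  then show ?thesis by (simp only: *)
qed

text \<open>Distinct monomials go to nonzero multiples of distinct monomials, because
  \<open>\<sigma>\<close> is injective and \<open>e \<ge> 1\<close>. Nothing can cancel, so the
  image of any one monomial of \<open>p\<close> survives.\<close>

lemma alg_indep_monomials:
  fixes \<sigma> :: "'n::{finite,linorder} \<Rightarrow> 'n"
  assumes "inj \<sigma>" "e \<ge> 1" "\<And>i. c i \<noteq> 0"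
  shows "alg_indep (\<lambda>i. rconst (c i) * xvar (\<sigma> i) ^ e)"
  unfolding alg_indep_def
proof (intro allI impI)
  let ?a = "\<lambda>i. rconst (c i) * xvar (\<sigma> i) ^ e"
  fix p :: "'n pol" assume "p \<noteq> 0"
  then obtain m0 where m0: "m0 \<in> Poly_Mapping.keys p" by (metis all_not_in_conv keys_eq_empty)
  define \<phi> where "\<phi> m = (\<Sum>i\<in>UNIV. Poly_Mapping.single (\<sigma> i) (e * Poly_Mapping.lookup m i))" for m
  define d where "d m = (\<Prod>i\<in>UNIV. c i ^ Poly_Mapping.lookup m i)" for m
  have \<phi>_lookup: "Poly_Mapping.lookup (\<phi> m) (\<sigma> i) = e * Poly_Mapping.lookup m i" for m i
  proof -
    have "Poly_Mapping.lookup (\<phi> m) (\<sigma> i) =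
        (\<Sum>j\<in>UNIV. if j = i then e * Poly_Mapping.lookup m i else 0)"
      unfolding \<phi>_def lookup_sum
      by (rule sum.cong) (use inj_eq[OF assms(1)] in \<open>auto simp: lookup_single when_def\<close>)
    then show ?thesis by simp
  qed
  have \<phi>_inj: "\<phi> m = \<phi> m' \<Longrightarrow> m = m'" for m m'
    by (rule poly_mapping_eqI) (use \<phi>_lookup assms(2) in \<open>metis mult_left_cancel not_one_le_zero\<close>)
  have "mon ?a m = to_fract (Poly_Mapping.single (\<phi> m) (d m))" for m
    by (simp add: mon_monomials \<phi>_def d_def)
  then have eq: "pol_eval ?a p = to_fract (\<Sum>m\<in>Poly_Mapping.keys p.
      Poly_Mapping.single (\<phi> m) (Poly_Mapping.lookup p m * d m))" (is "_ = to_fract ?P")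
    by (subst pol_eval_superset[of "Poly_Mapping.keys p"])
      (simp_all add: rconst_times_to_fract to_fract_sum)
  have "Poly_Mapping.lookup ?P (\<phi> m0) =
      (\<Sum>m\<in>Poly_Mapping.keys p. if m = m0 then Poly_Mapping.lookup p m0 * d m0 else 0)"
    unfolding lookup_sum by (rule sum.cong) (use \<phi>_inj in \<open>auto simp: lookup_single when_def\<close>)
  moreover have "\<dots> \<noteq> 0"
    using m0 assms(3) by (simp add: in_keys_iff d_def)
  ultimately have "Poly_Mapping.lookup ?P (\<phi> m0) \<noteq> 0" by (simp only: not_False_eq_True)
  then have "?P \<noteq> 0" by (metis lookup_zero)
  then show "pol_eval ?a p \<noteq> 0"
    unfolding eq to_fract_eq_0_iff .
qed

section \<open>Field homomorphisms between rational functions\<close>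

locale field_hom =
  fixes \<tau> :: "'f::field \<Rightarrow> 'g::field"
  assumes hom: "ring_hom_on UNIV UNIV \<tau>"
begin

lemma hom_simps [simp]:
  "\<tau> 0 = 0" "\<tau> 1 = 1" "\<tau> (x + y) = \<tau> x + \<tau> y" "\<tau> (x * y) = \<tau> x * \<tau> y"
  using ring_hom_onD[OF hom] by auto

lemma hom_uminus [simp]: "\<tau> (- x) = - \<tau> x"
  using hom_simps(3)[of x "- x"] by (simp add: eq_neg_iff_add_eq_0 add.commute)

lemma hom_diff [simp]: "\<tau> (x - y) = \<tau> x - \<tau> y"
  using hom_simps(3)[of x "- y"] by simp

lemma hom_inverse [simp]: "\<tau> (inverse x) = inverse (\<tau> x)"
proof (cases "x = 0")
  case False
  then have "\<tau> x * \<tau> (inverse x) = 1" by (simp flip: hom_simps(4))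
  then show ?thesis by (metis inverse_unique)
qed simp

lemma hom_divide [simp]: "\<tau> (x / y) = \<tau> x / \<tau> y"
  by (simp add: divide_inverse)

lemma hom_power [simp]: "\<tau> (x ^ n) = \<tau> x ^ n"
  by (induction n) simp_all

lemma hom_powi [simp]: "\<tau> (x powi k) = \<tau> x powi k"
  by (simp add: power_int_def)

lemma hom_sum: "\<tau> (sum f A) = (\<Sum>i\<in>A. \<tau> (f i))"
  by (induction A rule: infinite_finite_induct) simp_all

lemma hom_prod: "\<tau> (prod f A) = (\<Prod>i\<in>A. \<tau> (f i))"
  by (induction A rule: infinite_finite_induct) simp_all

end

lemma field_hom_to_fract:
  assumes "field_hom \<tau>" "\<And>c. \<tau> (rconst c) = rconst c"
  shows "\<tau> (to_fract p) = pol_eval (\<lambda>i. \<tau> (xvar i)) (p :: 'n::{finite,linorder} pol)"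
proof -
  interpret field_hom \<tau> by fact
  have mon: "mon xvar m = to_fract (Poly_Mapping.single m 1)" for m :: "'n \<Rightarrow>\<^sub>0 nat"
  proof -
    have "(\<Sum>i\<in>UNIV. Poly_Mapping.single i (Poly_Mapping.lookup m i)) = m"
      by (rule poly_mapping_eqI) (simp add: lookup_sum lookup_single when_def)
    then show ?thesis using mon_monomials[of "\<lambda>_. 1" id 1 m] by simp
  qed
  have "to_fract p = pol_eval xvar p"
  proof (induction p rule: poly_mapping_add_induct)
    case (1 m c)
    then show ?case
      by (simp add: pol_eval_single mon rconst_times_to_fract)
  qed (simp add: pol_eval_add)
  then show ?thesis
    by (simp add: pol_eval_def hom_sum hom_prod assms(2))
qed

text \<open>A rational function is a quotient of polynomial expressions in the variables. Used to
  compare \<open>W_ring\<close> after \<open>emb\<close> with \<open>emb\<close> after the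
  permutation part of \<open>W_ring\<close>.\<close>

lemma field_hom_eqI:
  fixes \<tau> \<tau>' :: "'n::{finite,linorder} ratf \<Rightarrow> 'n ratf"
  assumes "field_hom \<tau>" "\<And>c. \<tau> (rconst c) = rconst c"
    and "field_hom \<tau>'" "\<And>c. \<tau>' (rconst c) = rconst c"
    and "\<And>i. \<tau> (xvar i) = \<tau>' (xvar i)"
  shows "\<tau> f = \<tau>' f"
proof -
  obtain p q where "f = Fract p q" "q \<noteq> 0" by (metis Fract_cases)
  then show ?thesis
    using field_hom_to_fract[OF assms(1,2)] field_hom_to_fract[OF assms(3,4)] assms(5)
    by (simp add: Fract_to_fract field_hom.hom_divide[OF assms(1)] field_hom.hom_divide[OF assms(3)])
qed

lemma emb_hom:
  assumes "l \<ge> 1"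
  shows "field_hom (emb l :: 'n::{finite,linorder} ratf \<Rightarrow> _)"
    "emb l (rconst c) = (rconst c :: 'n ratf)" "emb l (xvar i) = (xvar i ^ l :: 'n ratf)"
proof -
  have a: "alg_indep (\<lambda>i::'n. xvar i ^ l)"
    using alg_indep_monomials[of id l "\<lambda>_. 1"] assms by simp
  show "field_hom (emb l :: 'n ratf \<Rightarrow> _)" "emb l (rconst c) = (rconst c :: 'n ratf)"
    "emb l (xvar i) = (xvar i ^ l :: 'n ratf)"
    using frac_subst_hom[OF a] by (auto simp: emb_def intro: field_hom.intro)
qed

lemma W_ring_hom:
  fixes w :: "'n::{finite,linorder} wreath"
  assumes "\<epsilon> \<noteq> 0" "bij (fst w)"
  shows "field_hom (W_ring \<epsilon> w)" "W_ring \<epsilon> w (rconst c) = rconst c"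
    "W_ring \<epsilon> w (xvar i) = rconst (inverse \<epsilon> ^ snd w i) * xvar (fst w i)"
proof -
  have a: "alg_indep (\<lambda>i. rconst (inverse \<epsilon> ^ snd w i) * xvar (fst w i))"
    using alg_indep_monomials[of "fst w" 1 "\<lambda>i. inverse \<epsilon> ^ snd w i"] assms
    by (simp add: bij_is_inj)
  show "field_hom (W_ring \<epsilon> w)" "W_ring \<epsilon> w (rconst c) = rconst c"
    "W_ring \<epsilon> w (xvar i) = rconst (inverse \<epsilon> ^ snd w i) * xvar (fst w i)"
    using frac_subst_hom[OF a] by (auto simp: W_ring_def intro: field_hom.intro)
qed

section \<open>Roots of unity and the localizations\<close>

locale root_of_unity =
  fixes \<epsilon> :: complex and l :: nat
  assumes l: "l \<ge> 1" and roots: "roots_group l = range (\<lambda>k::nat. \<epsilon> ^ k)"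
begin

lemma eps_power_l: "\<epsilon> ^ l = 1"
proof -
  have "\<epsilon> \<in> range (\<lambda>k::nat. \<epsilon> ^ k)" by (rule image_eqI[of _ _ 1]) auto
  then show ?thesis using roots by (auto simp: roots_group_def)
qed

lemma eps_power_power: "(\<epsilon> ^ k) ^ l = 1"
proof -
  have "(\<epsilon> ^ k) ^ l = (\<epsilon> ^ l) ^ k" by (simp only: power_mult[symmetric] mult.commute)
  then show ?thesis by (simp add: eps_power_l)
qed

lemma eps_neq_0: "\<epsilon> \<noteq> 0"
  using eps_power_l l by (metis not_one_le_zero power_0_left zero_neq_one)

lemma eps_power_mod: "\<epsilon> ^ k = \<epsilon> ^ (k mod l)"
proof -
  have "\<epsilon> ^ k = \<epsilon> ^ (l * (k div l) + k mod l)" by simp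
  also have "\<dots> = \<epsilon> ^ (k mod l)" unfolding power_add power_mult eps_power_l by simp
  finally show ?thesis .
qed

lemma root_of_unity_cases:
  assumes "z ^ l = 1"
  obtains p where "p < l" "z = \<epsilon> ^ p"
proof -
  have "z \<in> roots_group l" using assms by (simp add: roots_group_def)
  then obtain k where "z = \<epsilon> ^ k" using roots by auto
  then show thesis using that[of "k mod l"] l eps_power_mod by simp
qed

text \<open>The powers with exponent below \<open>l\<close> exhaust the \<open>l\<close>-th roots of
  unity, of which there are exactly \<open>l\<close>, so no two of them coincide. In other words,
  the assumption \<open>roots\<close> makes \<open>\<epsilon>\<close> primitive.\<close>

lemma inj_on_eps: "inj_on (\<lambda>k. \<epsilon> ^ k) {..<l}"
proof (rule eq_card_imp_inj_on)
  have "(\<lambda>k. \<epsilon> ^ k) ` {..<l} = {z. z ^ l = 1}"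
  proof
    show "{z. z ^ l = 1} \<subseteq> (\<lambda>k. \<epsilon> ^ k) ` {..<l}"
      using root_of_unity_cases by (auto simp: image_iff)
  qed (auto simp: eps_power_power)
  then show "card ((\<lambda>k. \<epsilon> ^ k) ` {..<l}) = card {..<l}"
    using card_roots_unity_eq[of l] l by simp
qed simp

text \<open>Primitivity in the form that turns the fixed point conditions of the twists into
  divisibility by \<open>l\<close>.\<close>

lemma eps_powi_eq_1_iff: "\<epsilon> powi k = 1 \<longleftrightarrow> int l dvd k"
proof -
  have "\<epsilon> powi k = \<epsilon> powi (int l * (k div int l) + k mod int l)" by simp
  also have "\<dots> = (\<epsilon> powi int l) powi (k div int l) * \<epsilon> powi (k mod int l)"
    by (subst power_int_add) (simp_all add: power_int_mult eps_neq_0)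
  also have "\<dots> = \<epsilon> ^ nat (k mod int l)"
    using l eps_power_l by (simp add: power_int_def)
  finally have eq: "\<epsilon> powi k = \<epsilon> ^ nat (k mod int l)" .
  have lt: "nat (k mod int l) < l" using l by (simp add: nat_less_iff)
  have "\<epsilon> ^ nat (k mod int l) = \<epsilon> ^ 0 \<longleftrightarrow> nat (k mod int l) = 0"
    using inj_onD[OF inj_on_eps, of "nat (k mod int l)" 0] lt l by auto
  moreover have "0 \<le> k mod int l" using l by simp
  ultimately show ?thesis by (auto simp: eq dvd_eq_mod_eq_0)
qed

text \<open>As polynomials in \<open>x\<close> both sides are monic of degree \<open>l\<close> and
  vanish at the \<open>l\<close> points \<open>\<epsilon>^p y\<close>, which are distinct because
  \<open>y\<close> is nonzero.\<close>

lemma power_diff_factor: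
  fixes x y :: "'n::{finite,linorder} ratf"
  assumes "y \<noteq> 0"
  shows "x ^ l - y ^ l = (\<Prod>p<l. x - rconst (\<epsilon> ^ p) * y)"
proof -
  define P where "P = (\<Prod>p<l. [:- (rconst (\<epsilon> ^ p) * y), 1:])"
  define Q where "Q = Polynomial.monom 1 l - [:y ^ l:]"
  let ?A = "(\<lambda>p. rconst (\<epsilon> ^ p) * y) ` {..<l}"
  have "inj_on (\<lambda>p. rconst (\<epsilon> ^ p) * y) {..<l}"
    using inj_on_eps assms by (auto simp: inj_on_def rconst_eq_iff)
  then have card: "card ?A = l" by (simp add: card_image)
  have degP: "degree P = l" unfolding P_def by (subst degree_prod_eq_sum_degree) auto
  have "lead_coeff P = 1" unfolding P_def by (simp add: lead_coeff_prod)
  then have cP: "coeff P l = 1" using degP by simp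
  have cQ: "coeff Q l = 1" using l by (simp add: Q_def) (cases l, auto)
  have degQ: "degree Q \<le> l" unfolding Q_def by (intro degree_diff_le) (auto simp: degree_monom_le)
  have "P = Q"
  proof (rule poly_eqI_degree_lead_coeff[of _ l _ ?A])
    fix z assume "z \<in> ?A"
    then obtain p where p: "p < l" "z = rconst (\<epsilon> ^ p) * y" by auto
    have "poly P z = 0" unfolding P_def poly_prod using p by (intro prod_zero) auto
    moreover have "rconst (\<epsilon> ^ p) ^ l = (1 :: 'n ratf)"
      by (simp add: rconst_power[symmetric] eps_power_power)
    then have "poly Q z = 0" by (simp add: Q_def p(2) poly_monom power_mult_distrib)
    ultimately show "poly P z = poly Q z" by simp
  qed (use cP cQ card degP degQ in auto)
  then have "poly P x = poly Q x" by simp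
  then show ?thesis by (simp add: P_def Q_def poly_prod poly_monom)
qed

lemma Rloc_iff: "f \<in> Rloc \<epsilon> l \<longleftrightarrow> (\<exists>p k. f = to_fract p / to_fract (discr \<epsilon> l) ^ k)"
  unfolding Rloc_def by (auto simp: Fract_to_fract discr_neq_0 to_fract_power)

lemma to_fract_in_Rloc: "to_fract p \<in> Rloc \<epsilon> l"
  unfolding Rloc_iff by (intro exI[of _ p] exI[of _ 0]) simp

lemma subring_Rloc: "subring_on (Rloc \<epsilon> l :: 'n::{finite,linorder} ratf set)"
  unfolding subring_on_def
proof (intro conjI ballI)
  let ?D = "to_fract (discr \<epsilon> l) :: 'n ratf"
  have D: "?D \<noteq> 0" by (simp add: discr_neq_0)
  show "1 \<in> (Rloc \<epsilon> l :: 'n ratf set)" using to_fract_in_Rloc[of 1] by simp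
  fix x y :: "'n ratf" assume "x \<in> Rloc \<epsilon> l" "y \<in> Rloc \<epsilon> l"
  then obtain p j q k where x: "x = to_fract p / ?D ^ j" and y: "y = to_fract q / ?D ^ k"
    unfolding Rloc_iff by auto
  have "x - y = to_fract (p * discr \<epsilon> l ^ k - q * discr \<epsilon> l ^ j) / ?D ^ (j + k)"
    using D by (simp add: x y to_fract_power field_simps power_add)
  then show "x - y \<in> Rloc \<epsilon> l" unfolding Rloc_iff by blast
  have "x * y = to_fract (p * q) / ?D ^ (j + k)" by (simp add: x y power_add)
  then show "x * y \<in> Rloc \<epsilon> l" unfolding Rloc_iff by blast
qed

lemmas Rloc_closed = subring_onD[OF subring_Rloc]

lemma rconst_in_Rloc [simp]: "rconst c \<in> Rloc \<epsilon> l"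
  by (simp add: rconst_to_fract to_fract_in_Rloc)

lemma xvar_in_Rloc [simp]: "xvar i \<in> Rloc \<epsilon> l"
  by (simp add: xvar_to_fract to_fract_in_Rloc)

text \<open>The inverse of a divisor is its cofactor over the discriminant.\<close>

lemma inverse_in_Rloc:
  assumes "p dvd discr \<epsilon> l"
  shows "inverse (to_fract p) \<in> Rloc \<epsilon> l"
proof -
  obtain q where q: "discr \<epsilon> l = p * q" using assms by auto
  then have "p \<noteq> 0" "q \<noteq> 0" using discr_neq_0[of \<epsilon> l] by auto
  then have "inverse (to_fract p) = to_fract q / to_fract (discr \<epsilon> l) ^ 1"
    by (simp add: q field_simps)
  then show ?thesis unfolding Rloc_iff by blast
qed

lemma inverse_xvar_in_Rloc [simp]: "inverse (xvar i) \<in> Rloc \<epsilon> l"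
  unfolding xvar_to_fract by (rule inverse_in_Rloc) (simp add: discr_def dvd_prodI dvd_mult2)

text \<open>The discriminant contains the factors for \<open>\<epsilon>^p\<close> with
  \<open>p < l\<close>, and every \<open>l\<close>-th root of unity is one of these powers.\<close>

lemma inverse_factor_in_Rloc:
  assumes "z ^ l = 1" "i \<noteq> (j :: 'n::{finite,linorder})"
  shows "inverse (xvar i - rconst z * xvar j) \<in> Rloc \<epsilon> l"
proof -
  obtain p where p: "p < l" "z = \<epsilon> ^ p" using root_of_unity_cases[OF assms(1)] .
  let ?f = "\<lambda>p i j. pvar i - pconst (\<epsilon> ^ p) * pvar (j::'n)"
  have "?f p i j dvd (\<Prod>j\<in>UNIV - {i}. ?f p i j)" using assms(2) by (intro dvd_prodI) auto
  also have "\<dots> dvd (\<Prod>i\<in>UNIV. \<Prod>j\<in>UNIV - {i}. ?f p i j)" by (rule dvd_prodI) auto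
  also have "\<dots> dvd (\<Prod>p<l. \<Prod>i\<in>UNIV. \<Prod>j\<in>UNIV - {i}. ?f p i j)" using p by (intro dvd_prodI) auto
  also have "\<dots> dvd discr \<epsilon> l" by (simp add: discr_def)
  finally have "inverse (to_fract (?f p i j)) \<in> Rloc \<epsilon> l" by (rule inverse_in_Rloc)
  then show ?thesis by (simp add: p(2) rconst_to_fract xvar_to_fract)
qed

lemma powi_in_Rloc [simp]: "xvar i powi k \<in> Rloc \<epsilon> l"
  by (simp add: power_int_def subring_on_power[OF subring_Rloc])

lemma rconst_hom_on: "ring_hom_on UNIV (Rloc \<epsilon> l) rconst"
  by (simp add: ring_hom_on_def)

text \<open>Numerators land in \<open>S\<close> as polynomial expressions in the images of the
  variables. Denominators are powers of the discriminant, whose image is invertible in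
  \<open>S\<close> factor by factor. Serves both \<open>W_ring\<close> and
  \<open>emb\<close>.\<close>

lemma field_hom_Rloc:
  fixes \<tau> :: "'n::{finite,linorder} ratf \<Rightarrow> 'n ratf"
  assumes S: "subring_on S" and \<tau>: "field_hom \<tau>" "\<And>c. \<tau> (rconst c) = rconst c" "\<And>c. rconst c \<in> S"
    and x: "\<And>i. \<tau> (xvar i) \<in> S" "\<And>i. inverse (\<tau> (xvar i)) \<in> S"
    and f: "\<And>p i j. p < l \<Longrightarrow> i \<noteq> j \<Longrightarrow> inverse (\<tau> (xvar i) - rconst (\<epsilon> ^ p) * \<tau> (xvar j)) \<in> S"
  shows "ring_hom_on (Rloc \<epsilon> l) S \<tau>"
  unfolding ring_hom_on_def
proof (intro conjI ballI)
  interpret field_hom \<tau> by fact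
  show "\<tau> \<in> Rloc \<epsilon> l \<rightarrow> S"
  proof
    fix r :: "'n ratf" assume "r \<in> Rloc \<epsilon> l"
    then obtain p k where r: "r = to_fract p / to_fract (discr \<epsilon> l) ^ k" unfolding Rloc_iff by auto
    have p: "\<tau> (to_fract p) \<in> S"
      unfolding field_hom_to_fract[OF \<tau>(1,2)] pol_eval_def
      by (intro subring_on_sum[OF S] subring_on_prod[OF S] subring_onD(5)[OF S] \<tau>(3)
          subring_on_power[OF S] x)
    have inv_prod: "inverse (prod f A) = (\<Prod>i\<in>A. inverse (f i))" for f :: "'i \<Rightarrow> 'n ratf" and A
      using prod_inversef[of f A] by (simp add: comp_def)
    have f': "inverse (\<tau> (xvar i) - rconst (\<epsilon> ^ p) * \<tau> (xvar j)) \<in> S"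
      if "p < l" "j \<in> UNIV - {i}" for p i j using that by (intro f) auto
    have "inverse (\<tau> (to_fract (discr \<epsilon> l))) \<in> S"
      unfolding discr_def
      by (simp add: to_fract_prod hom_prod rconst_to_fract[symmetric] xvar_to_fract[symmetric] \<tau>(2))
        (unfold inv_prod, intro subring_onD(5)[OF S] subring_on_prod[OF S] f' x, auto)
    then have "\<tau> (to_fract p) * inverse (\<tau> (to_fract (discr \<epsilon> l))) ^ k \<in> S"
      by (intro subring_onD(5)[OF S] subring_on_power[OF S] p)
    then show "\<tau> r \<in> S" by (simp add: r divide_inverse power_inverse)
  qed
qed (simp_all add: field_hom.hom_simps[OF \<tau>(1)])

lemma W_ring_hom_on:
  fixes w :: "'n::{finite,linorder} wreath"
  assumes "bij (fst w)"
  shows "ring_hom_on (Rloc \<epsilon> l) (Rloc \<epsilon> l) (W_ring \<epsilon> w)"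
proof (rule field_hom_Rloc[OF subring_Rloc])
  define e where "e i = inverse \<epsilon> ^ snd w i" for i
  note W = W_ring_hom[OF eps_neq_0 assms, folded e_def]
  show "field_hom (W_ring \<epsilon> w)" "W_ring \<epsilon> w (rconst c) = rconst c" for c by (rule W)+
  have e: "e i \<noteq> 0" "e i ^ l = 1" for i
    using eps_neq_0 by (simp_all add: e_def power_inverse eps_power_power)
  show "W_ring \<epsilon> w (xvar i) \<in> Rloc \<epsilon> l" for i by (simp add: W Rloc_closed)
  show "inverse (W_ring \<epsilon> w (xvar i)) \<in> Rloc \<epsilon> l" for i
    by (simp add: W Rloc_closed rconst_inverse[symmetric])
  fix p i j assume "p < l" "i \<noteq> (j::'n)"
  \<comment> \<open>The substitution takes a factor of the discriminant to the unit
    \<open>e i\<close> times the factor for the permuted indices, with the root of unity replaced by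
    \<open>?z\<close>.\<close>
  let ?z = "\<epsilon> ^ p * e j * inverse (e i)"
  have z: "?z ^ l = 1"
    by (simp add: power_mult_distrib power_inverse e(2) eps_power_power)
  have "W_ring \<epsilon> w (xvar i) - rconst (\<epsilon> ^ p) * W_ring \<epsilon> w (xvar j) =
      rconst (e i) * (xvar (fst w i) - rconst ?z * xvar (fst w j))"
    using e(1)[of i] by (simp add: W right_diff_distrib rconst_inverse mult_ac)
  then have "inverse (W_ring \<epsilon> w (xvar i) - rconst (\<epsilon> ^ p) * W_ring \<epsilon> w (xvar j)) =
      rconst (inverse (e i)) * inverse (xvar (fst w i) - rconst ?z * xvar (fst w j))"
    by (simp add: rconst_inverse)
  also have "\<dots> \<in> Rloc \<epsilon> l"
    using inverse_factor_in_Rloc[OF z, of "fst w i" "fst w j"] \<open>i \<noteq> j\<close> assms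
    by (simp add: Rloc_closed bij_is_inj inj_eq)
  finally show "inverse (W_ring \<epsilon> w (xvar i) - rconst (\<epsilon> ^ p) * W_ring \<epsilon> w (xvar j)) \<in> Rloc \<epsilon> l" .
qed simp

end

lemma root_of_unity_1: "root_of_unity 1 1"
  by standard (auto simp: roots_group_def)

text \<open>The factor \<open>y_i - y_j\<close> becomes \<open>x_i^l - x_j^l\<close>, the product of
  the \<open>x_i - \<epsilon>^p x_j\<close>, each of which is invertible in
  \<open>R_{n,l}\<close>.\<close>

lemma (in root_of_unity) emb_hom_on:
  "ring_hom_on (Rloc 1 1) (Rloc \<epsilon> l :: 'n::{finite,linorder} ratf set) (emb l)"
proof (rule root_of_unity.field_hom_Rloc[OF root_of_unity_1 subring_Rloc])
  note E = emb_hom[OF l]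
  show "field_hom (emb l :: 'n ratf \<Rightarrow> _)" "emb l (rconst c) = (rconst c :: 'n ratf)" for c by (rule E)+
  show "emb l (xvar i) \<in> Rloc \<epsilon> l" "inverse (emb l (xvar i)) \<in> Rloc \<epsilon> l" for i :: 'n
    by (simp_all add: E subring_on_power[OF subring_Rloc] power_inverse[symmetric])
  fix p :: nat and i j :: 'n assume "i \<noteq> j"
  have "emb l (xvar i) - rconst (1 ^ p) * emb l (xvar j) = (\<Prod>p<l. xvar i - rconst (\<epsilon> ^ p) * xvar j)"
    by (simp add: E power_diff_factor)
  moreover have "inverse (\<Prod>p<l. xvar i - rconst (\<epsilon> ^ p) * xvar j) \<in> Rloc \<epsilon> l"
    unfolding prod_inversef[symmetric]
    using \<open>i \<noteq> j\<close>
    by (auto intro!: subring_on_prod[OF subring_Rloc] inverse_factor_in_Rloc simp: eps_power_power)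
  ultimately show "inverse (emb l (xvar i) - rconst (1 ^ p) * emb l (xvar j)) \<in> Rloc \<epsilon> l" by simp
qed simp

lemma (in abelian_monoid) finsum_swap:
  assumes "\<And>i j. i \<in> I \<Longrightarrow> j \<in> J \<Longrightarrow> f i j \<in> carrier G"
  shows "(\<Oplus>i\<in>I. \<Oplus>j\<in>J. f i j) = (\<Oplus>j\<in>J. \<Oplus>i\<in>I. f i j)"
  using assms
proof (induction I rule: infinite_finite_induct)
  case (insert i I)
  have "(\<Oplus>k\<in>insert i I. \<Oplus>j\<in>J. f k j) = (\<Oplus>j\<in>J. f i j) \<oplus> (\<Oplus>j\<in>J. \<Oplus>k\<in>I. f k j)"
    using insert by (subst finsum_insert) (auto intro!: finsum_closed)
  also have "\<dots> = (\<Oplus>j\<in>J. f i j \<oplus> (\<Oplus>k\<in>I. f k j))"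
    using insert by (subst finsum_addf) (auto intro!: finsum_closed)
  also have "\<dots> = (\<Oplus>j\<in>J. \<Oplus>k\<in>insert i I. f k j)"
    using insert by (intro finsum_cong' refl) (auto intro!: finsum_closed simp: finsum_insert Pi_iff)
  finally show ?case .
qed (simp_all add: finsum_infinite finsum_empty finsum_zero)

context tensor_factors
begin

lemma T_pure_first_simps:
  fixes v :: "'n \<Rightarrow> (complex, 'm::finite) vec"
  assumes "x \<in> carrier M'" "u \<in> carrier M"
  shows "y \<in> carrier M' \<Longrightarrow> T_pure M' M (x \<oplus>\<^bsub>M'\<^esub> y) v u = T_pure M' M x v u \<oplus>\<^bsub>T_mod M' M\<^esub> T_pure M' M y v u"
    and "T_pure M' M (c \<odot>\<^bsub>M'\<^esub> x) v u = c \<odot>\<^bsub>T_mod M' M\<^esub> T_pure M' M x v u"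
proof -
  interpret T: smod UNIV "T_mod M' M :: (complex, ('a, 'n, 'm, 'b) tens) module" by (rule smod_T)
  have add: "T_pure M' M (x \<oplus>\<^bsub>M'\<^esub> y) v u = T_pure M' M x v u \<oplus>\<^bsub>T_mod M' M\<^esub> T_pure M' M y v u"
    if "x \<in> carrier M'" "y \<in> carrier M'" for x y
    using T_pure_first[OF that assms(2), of 1 v] that assms(2) by simp
  have "T_pure M' M \<zero>\<^bsub>M'\<^esub> v u = \<zero>\<^bsub>T_mod M' M\<^esub>"
    using add[of "\<zero>\<^bsub>M'\<^esub>" "\<zero>\<^bsub>M'\<^esub>"] assms(2) by - (rule T.idem_imp_zero, simp_all)
  then show "T_pure M' M (c \<odot>\<^bsub>M'\<^esub> x) v u = c \<odot>\<^bsub>T_mod M' M\<^esub> T_pure M' M x v u"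
    using T_pure_first[OF assms(1) M'.M.zero_closed assms(2), of c v] assms by simp
  show "T_pure M' M (x \<oplus>\<^bsub>M'\<^esub> y) v u = T_pure M' M x v u \<oplus>\<^bsub>T_mod M' M\<^esub> T_pure M' M y v u"
    if "y \<in> carrier M'" by (rule add[OF assms(1) that])
qed

lemma T_pure_last_simps:
  fixes v :: "'n \<Rightarrow> (complex, 'm::finite) vec"
  assumes "u' \<in> carrier M'" "x \<in> carrier M"
  shows "y \<in> carrier M \<Longrightarrow> T_pure M' M u' v (x \<oplus>\<^bsub>M\<^esub> y) = T_pure M' M u' v x \<oplus>\<^bsub>T_mod M' M\<^esub> T_pure M' M u' v y"
    and "T_pure M' M u' v (c \<odot>\<^bsub>M\<^esub> x) = c \<odot>\<^bsub>T_mod M' M\<^esub> T_pure M' M u' v x"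
proof -
  interpret T: smod UNIV "T_mod M' M :: (complex, ('a, 'n, 'm, 'b) tens) module" by (rule smod_T)
  have add: "T_pure M' M u' v (x \<oplus>\<^bsub>M\<^esub> y) = T_pure M' M u' v x \<oplus>\<^bsub>T_mod M' M\<^esub> T_pure M' M u' v y"
    if "x \<in> carrier M" "y \<in> carrier M" for x y
    using T_pure_last[OF assms(1) that, of v 1] that assms(1) by simp
  have "T_pure M' M u' v \<zero>\<^bsub>M\<^esub> = \<zero>\<^bsub>T_mod M' M\<^esub>"
    using add[of "\<zero>\<^bsub>M\<^esub>" "\<zero>\<^bsub>M\<^esub>"] assms(1) by - (rule T.idem_imp_zero, simp_all)
  then show "T_pure M' M u' v (c \<odot>\<^bsub>M\<^esub> x) = c \<odot>\<^bsub>T_mod M' M\<^esub> T_pure M' M u' v x"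
    using T_pure_last[OF assms M.M.zero_closed, of v c] assms by simp
  show "T_pure M' M u' v (x \<oplus>\<^bsub>M\<^esub> y) = T_pure M' M u' v x \<oplus>\<^bsub>T_mod M' M\<^esub> T_pure M' M u' v y"
    if "y \<in> carrier M" by (rule add[OF assms(2) that])
qed

end

definition TR_basis ::
  "complex \<Rightarrow> nat \<Rightarrow> (complex, 'a) module \<Rightarrow> (complex, 'b) module \<Rightarrow> 'a \<Rightarrow> ('n \<Rightarrow> 'm) \<Rightarrow> 'b \<Rightarrow>
     ('a, 'n::{finite,linorder}, 'm::finite, 'b) tensR" where
  "TR_basis \<epsilon> l M' M u' J u = TR_tensor \<epsilon> l M' M (T_pure M' M u' (\<lambda>i. axis (J i) 1) u) 1"

text \<open>The shape of the action of a loop on basis tensors. \<open>P u' J u\<close> stands for the image of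
  \<open>u' \<otimes> e\<^sub>J \<otimes> u\<close>; \<open>L'\<close>, \<open>L\<close> act on the outer factors, and the minus sign comes from the dual
  representation on the inner ones.\<close>

definition loop_sum ::
  "('r::comm_ring_1, 'y) module \<Rightarrow> ('a \<Rightarrow> ('n::finite \<Rightarrow> 'm::finite) \<Rightarrow> 'b \<Rightarrow> 'y) \<Rightarrow>
     ('a \<Rightarrow> 'a) \<Rightarrow> ('n \<Rightarrow> 'm \<Rightarrow> 'm \<Rightarrow> 'r) \<Rightarrow> ('b \<Rightarrow> 'b) \<Rightarrow> 'a \<Rightarrow> ('n \<Rightarrow> 'm) \<Rightarrow> 'b \<Rightarrow> 'y" where
  "loop_sum B P L' \<mu> L u' J u =
     P (L' u') J u \<oplus>\<^bsub>B\<^esub>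
     (\<Oplus>\<^bsub>B\<^esub>i\<in>UNIV. \<Oplus>\<^bsub>B\<^esub>j\<in>UNIV. (- \<mu> i (J i) j) \<odot>\<^bsub>B\<^esub> P u' (J(i := j)) u) \<oplus>\<^bsub>B\<^esub>
     P u' J (L u)"

text \<open>The entry \<open>(k, j)\<close> of the loop evaluated at \<open>z = x_i\<close>.\<close>

definition loop_coeff :: "'m loop \<Rightarrow> 'n \<Rightarrow> 'm \<Rightarrow> 'm::finite \<Rightarrow> 'n::{finite,linorder} ratf" where
  "loop_coeff X i k j = (\<Sum>a\<in>Poly_Mapping.keys X.
     rconst (Poly_Mapping.lookup X a $ k $ j) * xvar i powi a)"

lemma (in root_of_unity) loop_coeff_closed: "- loop_coeff X i k j \<in> Rloc \<epsilon> l"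
  unfolding loop_coeff_def
  by (intro Rloc_closed(3) subring_on_sum[OF subring_Rloc] Rloc_closed(5) rconst_in_Rloc powi_in_Rloc)

section \<open>Tensor products with coefficients in the localization\<close>

locale tensor_ring = tensor_factors M' M + root_of_unity \<epsilon> l
  for M' :: "(complex, 'a) module" and M :: "(complex, 'b) module" and \<epsilon> :: complex and l :: nat
begin

lemma TR_extension:
  "scalar_extension UNIV (T_mod M' M :: (complex, ('a, 'n::{finite,linorder}, 'm::finite, 'b) tens) module)
     rconst (Rloc \<epsilon> l :: 'n ratf set)"
  by (intro scalar_extension.intro scalar_extension_axioms.intro smod_T subring_Rloc rconst_hom_on)

lemma smod_TR:
  "smod (Rloc \<epsilon> l) (TR_mod \<epsilon> l M' M :: ('n ratf, ('a, 'n::{finite,linorder}, 'm::finite, 'b) tensR) module)"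
  unfolding TR_mod_def by (rule scalar_extension.smod_base_change[OF TR_extension])

lemma TR_tensor_closed [simp, intro]:
  "t \<in> carrier (T_mod M' M) \<Longrightarrow> f \<in> Rloc \<epsilon> l \<Longrightarrow> TR_tensor \<epsilon> l M' M t f \<in> carrier (TR_mod \<epsilon> l M' M)"
  unfolding TR_mod_def TR_tensor_def by (rule scalar_extension.tensor_closed[OF TR_extension])

lemma TR_tensor_eq_scale:
  "t \<in> carrier (T_mod M' M) \<Longrightarrow> f \<in> Rloc \<epsilon> l \<Longrightarrow>
    TR_tensor \<epsilon> l M' M t f = f \<odot>\<^bsub>TR_mod \<epsilon> l M' M\<^esub> TR_tensor \<epsilon> l M' M t 1"
  unfolding TR_mod_def TR_tensor_def by (rule scalar_extension.tensor_eq_scale[OF TR_extension])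

lemma semilinear_TR_tensor:
  "semilinear UNIV rconst (T_mod M' M) (TR_mod \<epsilon> l M' M) (\<lambda>t. TR_tensor \<epsilon> l M' M t 1)"
  unfolding TR_mod_def TR_tensor_def by (rule scalar_extension.semilinear_tensor[OF TR_extension])

lemma TR_lift:
  fixes \<phi> :: "('a, 'n::{finite,linorder}, 'm::finite, 'b) tens \<times> 'n ratf \<Rightarrow> 'y"
  assumes "smod S' B" "ring_hom_on (Rloc \<epsilon> l) S' \<tau>" "semilinear UNIV (\<tau> \<circ> rconst) (T_mod M' M) B \<psi>"
    and "\<And>t f. t \<in> carrier (T_mod M' M) \<Longrightarrow> f \<in> Rloc \<epsilon> l \<Longrightarrow> \<phi> (t, f) = \<tau> f \<odot>\<^bsub>B\<^esub> \<psi> t"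
  shows "semilinear (Rloc \<epsilon> l) \<tau> (TR_mod \<epsilon> l M' M) B (presented_lift \<tau> B \<phi>)"
    and "\<And>t f. t \<in> carrier (T_mod M' M) \<Longrightarrow> f \<in> Rloc \<epsilon> l \<Longrightarrow>
      presented_lift \<tau> B \<phi> (TR_tensor \<epsilon> l M' M t f) = \<tau> f \<odot>\<^bsub>B\<^esub> \<psi> t"
  unfolding TR_mod_def TR_tensor_def
  by (rule scalar_extension.bc_lift[OF TR_extension assms]; assumption)+

lemma TR_basis_closed [simp, intro]:
  "u' \<in> carrier M' \<Longrightarrow> u \<in> carrier M \<Longrightarrow> TR_basis \<epsilon> l M' M u' J u \<in> carrier (TR_mod \<epsilon> l M' M)"
  unfolding TR_basis_def by (intro TR_tensor_closed T_pure_closed Rloc_closed)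

definition TR_basis_set :: "('a, 'n::{finite,linorder}, 'm::finite, 'b) tensR set" where
  "TR_basis_set = {TR_basis \<epsilon> l M' M u' J u |u' J u. u' \<in> carrier M' \<and> u \<in> carrier M}"

lemma TR_basis_set_closed: "TR_basis_set \<subseteq> carrier (TR_mod \<epsilon> l M' M)"
  by (auto simp: TR_basis_set_def)

lemma TR_span:
  "submodule_span (ring_on (Rloc \<epsilon> l))
     (TR_mod \<epsilon> l M' M :: ('n ratf, ('a, 'n::{finite,linorder}, 'm::finite, 'b) tensR) module) TR_basis_set =
   carrier (TR_mod \<epsilon> l M' M)"
proof -
  have "TR_basis_set = (\<lambda>t. bc_tensor UNIV rconst (T_mod M' M) (Rloc \<epsilon> l) t 1) `
      (basis_tensors :: ('a, 'n, 'm, 'b) tens set)"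
    by (fastforce simp: TR_basis_set_def TR_basis_def basis_tensors_def TR_tensor_def)
  then show ?thesis
    unfolding TR_mod_def
    by (simp only: scalar_extension.bc_span[OF TR_extension T_span_basis basis_tensors_closed])
qed

lemma TR_into_submod:
  assumes "smod S' B" "ring_hom_on (Rloc \<epsilon> l) S' \<tau>"
    and "semilinear (Rloc \<epsilon> l) \<tau> (TR_mod \<epsilon> l M' M) B f" "submodule H (ring_on S') B"
    and "\<And>u' J u. u' \<in> carrier M' \<Longrightarrow> u \<in> carrier M \<Longrightarrow> f (TR_basis \<epsilon> l M' M u' J u) \<in> H"
    and "t \<in> carrier (TR_mod \<epsilon> l M' M)"
  shows "f t \<in> H"
  by (rule semilinear_into_submod[OF smod_TR assms(1-4) TR_basis_set_closed])
    (use assms(5,6) TR_span in \<open>auto simp: TR_basis_set_def\<close>)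

lemma semilinear_TR_basis_first:
  fixes J :: "'n::{finite,linorder} \<Rightarrow> 'm::finite"
  assumes "u \<in> carrier M"
  shows "semilinear UNIV rconst M' (TR_mod \<epsilon> l M' M) (\<lambda>u'. TR_basis \<epsilon> l M' M u' J u)"
proof (rule semilinearI)
  note s = semilinearD[OF semilinear_TR_tensor]
  show "TR_basis \<epsilon> l M' M (x \<oplus>\<^bsub>M'\<^esub> y) J u =
      TR_basis \<epsilon> l M' M x J u \<oplus>\<^bsub>TR_mod \<epsilon> l M' M\<^esub> TR_basis \<epsilon> l M' M y J u"
    if "x \<in> carrier M'" "y \<in> carrier M'" for x y
    using that assms by (simp add: TR_basis_def s T_pure_first_simps)
  show "TR_basis \<epsilon> l M' M (r \<odot>\<^bsub>M'\<^esub> x) J u = rconst r \<odot>\<^bsub>TR_mod \<epsilon> l M' M\<^esub> TR_basis \<epsilon> l M' M x J u"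
    if "x \<in> carrier M'" for x r
    using that assms by (simp add: TR_basis_def s T_pure_first_simps)
qed (use assms in auto)

lemma semilinear_TR_basis_last:
  fixes J :: "'n::{finite,linorder} \<Rightarrow> 'm::finite"
  assumes "u' \<in> carrier M'"
  shows "semilinear UNIV rconst M (TR_mod \<epsilon> l M' M) (\<lambda>u. TR_basis \<epsilon> l M' M u' J u)"
proof (rule semilinearI)
  note s = semilinearD[OF semilinear_TR_tensor]
  show "TR_basis \<epsilon> l M' M u' J (x \<oplus>\<^bsub>M\<^esub> y) =
      TR_basis \<epsilon> l M' M u' J x \<oplus>\<^bsub>TR_mod \<epsilon> l M' M\<^esub> TR_basis \<epsilon> l M' M u' J y"
    if "x \<in> carrier M" "y \<in> carrier M" for x y
    using that assms by (simp add: TR_basis_def s T_pure_last_simps)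
  show "TR_basis \<epsilon> l M' M u' J (r \<odot>\<^bsub>M\<^esub> x) = rconst r \<odot>\<^bsub>TR_mod \<epsilon> l M' M\<^esub> TR_basis \<epsilon> l M' M u' J x"
    if "x \<in> carrier M" for x r
    using that assms by (simp add: TR_basis_def s T_pure_last_simps)
qed (use assms in auto)

text \<open>Expanding the inner factors in the basis of \<open>V\<^sup>*\<close>, a map out of \<open>T(M', M)\<^sub>R\<close> is the same as a family,
  indexed by \<open>J : 'n \<Rightarrow> 'm\<close>, of maps that are linear in the two outer arguments.\<close>

lemma TR_extend:
  fixes \<beta> :: "'a \<Rightarrow> ('n::{finite,linorder} \<Rightarrow> 'm::finite) \<Rightarrow> 'b \<Rightarrow> 'y"
  assumes B: "smod S' B" and hom: "ring_hom_on (Rloc \<epsilon> l) S' \<tau>"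
    and first: "\<And>J u. u \<in> carrier M \<Longrightarrow> semilinear UNIV (\<tau> \<circ> rconst) M' B (\<lambda>u'. \<beta> u' J u)"
    and last: "\<And>u' J. u' \<in> carrier M' \<Longrightarrow> semilinear UNIV (\<tau> \<circ> rconst) M B (\<lambda>u. \<beta> u' J u)"
  obtains L where "semilinear (Rloc \<epsilon> l) \<tau> (TR_mod \<epsilon> l M' M) B L"
    and "\<And>u' J u. u' \<in> carrier M' \<Longrightarrow> u \<in> carrier M \<Longrightarrow> L (TR_basis \<epsilon> l M' M u' J u) = \<beta> u' J u"
    and "\<And>u' v u. u' \<in> carrier M' \<Longrightarrow> u \<in> carrier M \<Longrightarrow> L (TR_tensor \<epsilon> l M' M (T_pure M' M u' v u) 1) =
      (\<Oplus>\<^bsub>B\<^esub>J\<in>UNIV. \<tau> (\<Prod>i\<in>UNIV. rconst (v i $ J i)) \<odot>\<^bsub>B\<^esub> \<beta> u' J u)"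
proof -
  interpret B: smod S' B by (rule B)
  note h = ring_hom_onD[OF hom subring_Rloc]
  note \<beta>1 = semilinearD[OF first] and \<beta>2 = semilinearD[OF last]
  have p: "(\<Prod>i\<in>UNIV. rconst (v i $ J i)) \<in> (Rloc \<epsilon> l :: 'n ratf set)"
    for v :: "'n \<Rightarrow> (complex, 'm) vec" and J
    by (simp add: subring_on_prod[OF subring_Rloc])
  \<comment> \<open>Multilinear expansion: the coefficient of \<open>e_J\<close> in the tensor
    product of the \<open>v i\<close> is the product of the coordinates
    \<open>v i $ J i\<close>.\<close>
  define \<phi> where "\<phi> = (\<lambda>(u', v, u). \<Oplus>\<^bsub>B\<^esub>J\<in>UNIV. \<tau> (\<Prod>i\<in>UNIV. rconst (v i $ J i)) \<odot>\<^bsub>B\<^esub> \<beta> u' J u)"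
  have hom': "ring_hom_on UNIV S' (\<tau> \<circ> rconst)" by (rule ring_hom_on_comp[OF rconst_hom_on hom])
  have c: "\<tau> (\<Prod>i\<in>UNIV. rconst (v i $ J i)) \<odot>\<^bsub>B\<^esub> \<beta> u' J u \<in> carrier B"
    if "u' \<in> carrier M'" "u \<in> carrier M" for u' v u J
    using that by (intro B.scale_closed h p \<beta>1)
  have addc: "(\<Oplus>\<^bsub>B\<^esub>J\<in>UNIV. f J) = s \<odot>\<^bsub>B\<^esub> (\<Oplus>\<^bsub>B\<^esub>J\<in>UNIV. g J) \<oplus>\<^bsub>B\<^esub> (\<Oplus>\<^bsub>B\<^esub>J\<in>UNIV. k J)"
    if "s \<in> S'" "\<And>J. g J \<in> carrier B" "\<And>J. k J \<in> carrier B" "\<And>J. f J = s \<odot>\<^bsub>B\<^esub> g J \<oplus>\<^bsub>B\<^esub> k J"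
    for s and f g k :: "('n \<Rightarrow> 'm) \<Rightarrow> 'y"
    using that by (simp add: B.scale_finsum B.M.finsum_addf Pi_iff)
  have f1: "\<phi> (c \<odot>\<^bsub>M'\<^esub> x \<oplus>\<^bsub>M'\<^esub> y, v, u) = (\<tau> \<circ> rconst) c \<odot>\<^bsub>B\<^esub> \<phi> (x, v, u) \<oplus>\<^bsub>B\<^esub> \<phi> (y, v, u)"
    if xy: "x \<in> carrier M'" "y \<in> carrier M'" "u \<in> carrier M" for c x y v u
    unfolding \<phi>_def prod.case
    by (rule addc) (use xy c[OF xy(1,3)] c[OF xy(2,3)] in
        \<open>auto simp: \<beta>1 h p B.scale_add_right B.scale_scale mult.commute\<close>)
  have f2: "\<phi> (u', v, c \<odot>\<^bsub>M\<^esub> x \<oplus>\<^bsub>M\<^esub> y) = (\<tau> \<circ> rconst) c \<odot>\<^bsub>B\<^esub> \<phi> (u', v, x) \<oplus>\<^bsub>B\<^esub> \<phi> (u', v, y)"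
    if xy: "u' \<in> carrier M'" "x \<in> carrier M" "y \<in> carrier M" for c x y v u'
    unfolding \<phi>_def prod.case
    by (rule addc) (use xy c[OF xy(1,2)] c[OF xy(1,3)] in
        \<open>auto simp: \<beta>2 h p B.scale_add_right B.scale_scale mult.commute\<close>)
  have f3: "\<phi> (u', v(i := c *s x + y), u) =
      (\<tau> \<circ> rconst) c \<odot>\<^bsub>B\<^esub> \<phi> (u', v(i := x), u) \<oplus>\<^bsub>B\<^esub> \<phi> (u', v(i := y), u)"
    if u: "u' \<in> carrier M'" "u \<in> carrier M" for u' v i c x y u
    unfolding \<phi>_def prod.case
  proof (rule addc)
    fix J
    \<comment> \<open>Separating the factor at \<open>i\<close> shows that the coefficient is linear
      in the vector at that place.\<close>
    have split: "(\<Prod>k\<in>UNIV. rconst ((v(i := z)) k $ J k)) =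
        (rconst (z $ J i) * (\<Prod>k\<in>UNIV - {i}. rconst (v k $ J k)) :: 'n ratf)" for z
      by (subst prod.remove[of _ i]) auto
    have "(\<Prod>k\<in>UNIV. rconst ((v(i := c *s x + y)) k $ J k)) =
      (rconst c * (\<Prod>k\<in>UNIV. rconst ((v(i := x)) k $ J k)) + (\<Prod>k\<in>UNIV. rconst ((v(i := y)) k $ J k)) :: 'n ratf)"
      unfolding split by (simp add: algebra_simps)
    then show "\<tau> (\<Prod>k\<in>UNIV. rconst ((v(i := c *s x + y)) k $ J k)) \<odot>\<^bsub>B\<^esub> \<beta> u' J u =
        (\<tau> \<circ> rconst) c \<odot>\<^bsub>B\<^esub> (\<tau> (\<Prod>k\<in>UNIV. rconst ((v(i := x)) k $ J k)) \<odot>\<^bsub>B\<^esub> \<beta> u' J u) \<oplus>\<^bsub>B\<^esub>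
        \<tau> (\<Prod>k\<in>UNIV. rconst ((v(i := y)) k $ J k)) \<odot>\<^bsub>B\<^esub> \<beta> u' J u"
      using u by (simp add: h p \<beta>1 Rloc_closed B.scale_add_left B.scale_scale B.S_closed del: fun_upd_apply)
  qed (use u c[OF u] in \<open>auto simp: h simp del: fun_upd_apply\<close>)
  have f4: "\<phi> (u', v, u) \<in> carrier B" if "u' \<in> carrier M'" "u \<in> carrier M" for u' v u
    using c[OF that] by (auto simp: \<phi>_def intro!: B.M.finsum_closed)
  define K where "K = presented_lift (\<tau> \<circ> rconst) B \<phi>"
  have T: "semilinear UNIV (\<tau> \<circ> rconst) (T_mod M' M) B K"
    "\<And>u' v u. u' \<in> carrier M' \<Longrightarrow> u \<in> carrier M \<Longrightarrow> K (T_pure M' M u' v u) = \<phi> (u', v, u)"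
    unfolding K_def by (rule T_lift[OF B hom' f4 f1 f3 f2]; assumption)+
  define L where "L = presented_lift \<tau> B (\<lambda>(t, f). \<tau> f \<odot>\<^bsub>B\<^esub> K t)"
  have R: "semilinear (Rloc \<epsilon> l) \<tau> (TR_mod \<epsilon> l M' M) B L"
    "\<And>t f. t \<in> carrier (T_mod M' M) \<Longrightarrow> f \<in> Rloc \<epsilon> l \<Longrightarrow>
      L (TR_tensor \<epsilon> l M' M t f) = \<tau> f \<odot>\<^bsub>B\<^esub> K t"
    unfolding L_def by (rule TR_lift[OF B hom T(1)]; simp)+
  have pure: "L (TR_tensor \<epsilon> l M' M (T_pure M' M u' v u) 1) = \<phi> (u', v, u)"
    if "u' \<in> carrier M'" "u \<in> carrier M" for u' v u
    using R(2)[OF T_pure_closed[OF that] Rloc_closed(2)] T(2)[OF that] f4[OF that] by (simp add: h)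
  have basis: "L (TR_basis \<epsilon> l M' M u' J u) = \<beta> u' J u" if u: "u' \<in> carrier M'" "u \<in> carrier M" for u' J u
  proof -
    \<comment> \<open>In the expansion of a basis tensor one coefficient is \<open>1\<close> and all
      others vanish, so the expansion returns the prescribed value.\<close>
    have e: "(\<Prod>i\<in>UNIV. rconst (axis (J i) 1 $ J' i)) = (if J' = J then 1 else 0 :: 'n ratf)" for J'
    proof (cases "J' = J")
      case False
      then obtain i where "J' i \<noteq> J i" by auto
      then have "(\<Prod>i\<in>UNIV. rconst (axis (J i) 1 $ J' i)) = (0 :: 'n ratf)"
        by (intro prod_zero bexI[of _ i]) (auto simp: axis_def)
      then show ?thesis using False by simp
    qed simp
    have "L (TR_basis \<epsilon> l M' M u' J u) = (\<Oplus>\<^bsub>B\<^esub>J'\<in>UNIV. if J = J' then \<beta> u' J' u else \<zero>\<^bsub>B\<^esub>)"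
      unfolding TR_basis_def pure[OF u] \<phi>_def prod.case e using u \<beta>1(1)
      by (intro B.M.finsum_cong') (auto simp: h)
    also have "\<dots> = \<beta> u' J u"
      using B.M.finsum_singleton[of J UNIV "\<lambda>J. \<beta> u' J u"] u \<beta>1(1) by auto
    finally show ?thesis .
  qed
  show thesis by (rule that[of L]) (use R(1) basis pure in \<open>auto simp: \<phi>_def\<close>)
qed

text \<open>The scalar \<open>- \<mu>\<close> is carried to \<open>\<tau> (- \<mu>)\<close>, and
  \<open>loop_sum\<close> negates its coefficients once more; hence the double sign. It disappears
  wherever \<open>\<tau>\<close> is a field homomorphism.\<close>

lemma loop_sum_image:
  fixes P :: "'a \<Rightarrow> ('n::{finite,linorder} \<Rightarrow> 'm::finite) \<Rightarrow> 'b \<Rightarrow> 'y"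
  assumes B: "smod S' B" and hom: "ring_hom_on (Rloc \<epsilon> l) S' \<tau>"
    and f: "semilinear (Rloc \<epsilon> l) \<tau> (TR_mod \<epsilon> l M' M) B f"
    and "L' u' \<in> carrier M'" "L u \<in> carrier M" "\<And>i k j. - \<mu> i k j \<in> Rloc \<epsilon> l"
    and u: "u' \<in> carrier M'" "u \<in> carrier M"
    and P: "\<And>u' J u. u' \<in> carrier M' \<Longrightarrow> u \<in> carrier M \<Longrightarrow> f (TR_basis \<epsilon> l M' M u' J u) = P u' J u"
  shows "f (loop_sum (TR_mod \<epsilon> l M' M) (TR_basis \<epsilon> l M' M) L' \<mu> L u' J u) =
    loop_sum B P L' (\<lambda>i k j. - \<tau> (- \<mu> i k j)) L u' J u"
proof -
  interpret TR: smod "Rloc \<epsilon> l" "TR_mod \<epsilon> l M' M :: ('n ratf, ('a, 'n, 'm, 'b) tensR) module"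
    by (rule smod_TR)
  interpret B: smod S' B by (rule B)
  note s = semilinearD[OF f] and fs = semilinear_finsum[OF smod_TR B hom f]
  have Pc: "P u' J u \<in> carrier B" if "u' \<in> carrier M'" "u \<in> carrier M" for u' J u
    using s(1)[of "TR_basis \<epsilon> l M' M u' J u"] P that by auto
  show ?thesis
    using assms(4-6) u
    by (simp add: loop_sum_def s fs P Pi_iff TR.M.finsum_closed)
qed

text \<open>In \<open>loop_act\<close> the sum over the degrees \<open>a\<close> is outermost, but
  each inner place sees only the loop evaluated at \<open>x_i\<close>. Exchanging the sums collects
  the powers of \<open>x_i\<close> into \<open>loop_coeff\<close>.\<close>

lemma loop_act_basis:
  fixes X :: "'m::finite loop"
  assumes \<rho>': "\<And>a. a \<in> Poly_Mapping.keys X \<Longrightarrow> semilinear UNIV id M' M' (\<rho>' (laff (Poly_Mapping.lookup X a) a))"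
    and \<rho>: "\<And>a. a \<in> Poly_Mapping.keys X \<Longrightarrow> semilinear UNIV id M M (\<rho> (sharp (Poly_Mapping.lookup X a) a))"
  shows "semilinear (Rloc \<epsilon> l) id
      (TR_mod \<epsilon> l M' M :: ('n ratf, ('a, 'n::{finite,linorder}, 'm, 'b) tensR) module)
      (TR_mod \<epsilon> l M' M) (loop_act \<epsilon> l M' \<rho>' M \<rho> X)"
    and "u' \<in> carrier M' \<Longrightarrow> u \<in> carrier M \<Longrightarrow>
      loop_act \<epsilon> l M' \<rho>' M \<rho> X (TR_basis \<epsilon> l M' M u' J u) =
      (loop_sum (TR_mod \<epsilon> l M' M) (TR_basis \<epsilon> l M' M)
        (\<lambda>u'. \<Oplus>\<^bsub>M'\<^esub>a\<in>Poly_Mapping.keys X. \<rho>' (laff (Poly_Mapping.lookup X a) a) u') (loop_coeff X)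
        (\<lambda>u. \<Oplus>\<^bsub>M\<^esub>a\<in>Poly_Mapping.keys X. \<rho> (sharp (Poly_Mapping.lookup X a) a) u) u' J u
        :: ('a, 'n, 'm, 'b) tensR)"
proof -
  let ?TR = "TR_mod \<epsilon> l M' M :: ('n ratf, ('a, 'n, 'm, 'b) tensR) module"
  let ?t = "TR_tensor \<epsilon> l M' M :: _ \<Rightarrow> _ \<Rightarrow> ('a, 'n, 'm, 'b) tensR"
  let ?b = "TR_basis \<epsilon> l M' M :: _ \<Rightarrow> _ \<Rightarrow> _ \<Rightarrow> ('a, 'n, 'm, 'b) tensR"
  let ?K = "Poly_Mapping.keys X"
  let ?X = "Poly_Mapping.lookup X"
  interpret T: smod UNIV "T_mod M' M :: (complex, ('a, 'n, 'm, 'b) tens) module" by (rule smod_T)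
  interpret TR: smod "Rloc \<epsilon> l" ?TR by (rule smod_TR)
  define F where "F a t = act_first M' M (\<rho>' (laff (?X a) a)) t" for a and t :: "('a, 'n, 'm, 'b) tens"
  define D where "D a i t = act_mid M' M i (dual_lie (?X a)) t" for a i and t :: "('a, 'n, 'm, 'b) tens"
  define G where "G a t = act_last M' M (\<rho> (sharp (?X a) a)) t" for a and t :: "('a, 'n, 'm, 'b) tens"
  have dual: "dual_lie \<xi> (c *s x + y) = c *s dual_lie \<xi> x + dual_lie \<xi> y" for \<xi> :: "(complex, 'm) sqmat" and c x y
    by (simp add: dual_lie_def vec.add vec.scale)
  have F: "semilinear UNIV id (T_mod M' M) (T_mod M' M) (F a)" if "a \<in> ?K" for a
    using act_first(1)[OF \<rho>'[OF that]] by (simp add: F_def[abs_def])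
  have D: "semilinear UNIV id (T_mod M' M) (T_mod M' M) (D a i)" for a i
    using act_mid(1)[of "dual_lie (?X a)" i, OF dual] by (simp add: D_def[abs_def])
  have G: "semilinear UNIV id (T_mod M' M) (T_mod M' M) (G a)" if "a \<in> ?K" for a
    using act_last(1)[OF \<rho>[OF that]] by (simp add: G_def[abs_def])
  have t: "semilinear UNIV rconst (T_mod M' M) ?TR (\<lambda>x. ?t (f x) 1)"
    if "semilinear UNIV id (T_mod M' M) (T_mod M' M) f" for f
    using semilinear_comp[OF that semilinear_TR_tensor ring_hom_on_id] by (simp add: comp_def)
  \<comment> \<open>The action on \<open>x \<otimes> 1\<close>; on \<open>x \<otimes> f\<close> the
    action is \<open>f\<close> times this, as required by the universal property of the base
    change.\<close>
  define \<psi> where "\<psi> x = (\<Oplus>\<^bsub>?TR\<^esub>a\<in>?K. ?t (F a x) 1 \<oplus>\<^bsub>?TR\<^esub>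
      (\<Oplus>\<^bsub>?TR\<^esub>i\<in>UNIV. xvar i powi a \<odot>\<^bsub>?TR\<^esub> ?t (D a i x) 1) \<oplus>\<^bsub>?TR\<^esub> ?t (G a x) 1)" for x
  note sl = smod_T smod_TR rconst_hom_on
  have \<psi>: "semilinear UNIV rconst (T_mod M' M) ?TR \<psi>"
    unfolding \<psi>_def[abs_def]
    by (intro semilinear_sum[OF sl] semilinear_add[OF sl] semilinear_scale[OF sl] t F D G powi_in_Rloc)
  have closed: "F a x \<in> carrier (T_mod M' M)" "D a i x \<in> carrier (T_mod M' M)" "G a x \<in> carrier (T_mod M' M)"
    if "a \<in> ?K" "x \<in> carrier (T_mod M' M)" for a i x
    using semilinearD(1)[OF F] semilinearD(1)[OF D] semilinearD(1)[OF G] that by auto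
  let ?\<phi> = "\<lambda>(t, f). \<Oplus>\<^bsub>?TR\<^esub>a\<in>?K. (let \<xi> = ?X a in
      ?t (act_first M' M (\<rho>' (laff \<xi> a)) t) f \<oplus>\<^bsub>?TR\<^esub>
      (\<Oplus>\<^bsub>?TR\<^esub>i\<in>UNIV. ?t (act_mid M' M i (dual_lie \<xi>) t) (xvar i powi a * f)) \<oplus>\<^bsub>?TR\<^esub>
      ?t (act_last M' M (\<rho> (sharp \<xi> a)) t) f)"
  have \<phi>: "?\<phi> (x, f) = id f \<odot>\<^bsub>?TR\<^esub> \<psi> x" if x: "x \<in> carrier (T_mod M' M)" and f: "f \<in> Rloc \<epsilon> l" for x f
  proof -
    have summand: "?t (F a x) f \<oplus>\<^bsub>?TR\<^esub> (\<Oplus>\<^bsub>?TR\<^esub>i\<in>UNIV. ?t (D a i x) (xvar i powi a * f)) \<oplus>\<^bsub>?TR\<^esub> ?t (G a x) f =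
      f \<odot>\<^bsub>?TR\<^esub> (?t (F a x) 1 \<oplus>\<^bsub>?TR\<^esub> (\<Oplus>\<^bsub>?TR\<^esub>i\<in>UNIV. xvar i powi a \<odot>\<^bsub>?TR\<^esub> ?t (D a i x) 1) \<oplus>\<^bsub>?TR\<^esub> ?t (G a x) 1)"
      if a: "a \<in> ?K" for a
    proof -
      have "?t (F a x) f = f \<odot>\<^bsub>?TR\<^esub> ?t (F a x) 1" "?t (G a x) f = f \<odot>\<^bsub>?TR\<^esub> ?t (G a x) 1"
        "?t (D a i x) (xvar i powi a * f) = f \<odot>\<^bsub>?TR\<^esub> (xvar i powi a \<odot>\<^bsub>?TR\<^esub> ?t (D a i x) 1)" for i
        using closed[OF a x] f TR_tensor_eq_scale[of "F a x" f] TR_tensor_eq_scale[of "G a x" f]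
          TR_tensor_eq_scale[of "D a i x" "xvar i powi a * f"]
        by (auto simp: Rloc_closed TR.scale_scale mult.commute)
      then show ?thesis
        using closed[OF a x] f
        by (simp add: TR.scale_add_right TR.scale_finsum Rloc_closed Pi_iff TR.M.finsum_closed)
    qed
    show ?thesis
      unfolding prod.case Let_def F_def[symmetric] D_def[symmetric] G_def[symmetric] \<psi>_def id_apply
    proof (subst TR.scale_finsum, goal_cases)
      case 3
      show ?case
        by (rule TR.M.finsum_cong'[OF refl])
          (simp_all only: summand, intro Pi_I TR.scale_closed f TR.M.a_closed TR.M.finsum_closed
            TR_tensor_closed closed x Rloc_closed powi_in_Rloc)
    qed (intro f Pi_I TR.scale_closed TR.M.a_closed TR.M.finsum_closed TR_tensor_closed closed x
        Rloc_closed powi_in_Rloc; assumption)+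
  qed
  have eq: "loop_act \<epsilon> l M' \<rho>' M \<rho> X = presented_lift id ?TR ?\<phi>"
    by (simp add: loop_act_def)
  have "semilinear UNIV (id \<circ> rconst) (T_mod M' M) ?TR \<psi>" using \<psi> by (simp add: comp_def)
  note L = TR_lift[OF smod_TR ring_hom_on_id this \<phi>, folded eq]
  show "semilinear (Rloc \<epsilon> l) id ?TR ?TR (loop_act \<epsilon> l M' \<rho>' M \<rho> X)" by (rule L)
  assume u: "u' \<in> carrier M'" "u \<in> carrier M"
  let ?p = "\<lambda>J. T_pure M' M u' (\<lambda>i. axis (J i) 1) u :: ('a, 'n, 'm, 'b) tens"
  have l1: "?t (F a (?p J)) 1 = ?b (\<rho>' (laff (?X a) a) u') J u" if "a \<in> ?K" for a
    by (simp add: F_def TR_basis_def act_first(2)[OF \<rho>'[OF that] u])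
  have l2: "?t (G a (?p J)) 1 = ?b u' J (\<rho> (sharp (?X a) a) u)" if "a \<in> ?K" for a
    by (simp add: G_def TR_basis_def act_last(2)[OF \<rho>[OF that] u])
  have l3: "?t (D a i (?p J)) 1 = (\<Oplus>\<^bsub>?TR\<^esub>j\<in>UNIV. rconst (- ?X a $ J i $ j) \<odot>\<^bsub>?TR\<^esub> ?b u' (J(i := j)) u)" for a i
  proof -
    \<comment> \<open>The dual representation is minus the transpose, so a dual basis vector goes to
      minus a row of the matrix: \<open>J i\<close> becomes the row index, in agreement with the
      index order of \<open>loop_coeff\<close>.\<close>
    have ax: "dual_lie (?X a) (axis (J i) 1) $ j = - ?X a $ J i $ j" for j
      by (simp add: dual_lie_def matrix_vector_mult_def transpose_def axis_def if_distrib cong: if_cong)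
    have upd: "(\<lambda>i. axis (J i) 1)(i := axis j 1) = (\<lambda>k. axis ((J(i := j)) k) (1::complex))" for j
      by auto
    have "D a i (?p J) = T_pure M' M u' ((\<lambda>i. axis (J i) 1)(i := dual_lie (?X a) (axis (J i) 1))) u"
      unfolding D_def by (rule act_mid(2)[of "dual_lie (?X a)", OF dual u])
    also have "\<dots> = (\<Oplus>\<^bsub>T_mod M' M\<^esub>j\<in>UNIV. (- ?X a $ J i $ j) \<odot>\<^bsub>T_mod M' M\<^esub> ?p (J(i := j)))"
      unfolding T_pure_mid_expand[OF u] ax upd ..
    finally show ?thesis
      by (simp only:) (subst semilinear_finsum[OF sl semilinear_TR_tensor],
        simp_all add: Pi_iff TR_basis_def u semilinearD(3)[OF semilinear_TR_tensor] del: rconst_hom fun_upd_apply)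
  qed
  have bc: "?b u' J u \<in> carrier ?TR" if "u' \<in> carrier M'" "u \<in> carrier M" for u' J u using that by simp
  have rc: "\<rho>' (laff (?X a) a) u' \<in> carrier M'" "\<rho> (sharp (?X a) a) u \<in> carrier M" if "a \<in> ?K" for a
    using semilinearD(1)[OF \<rho>'[OF that]] semilinearD(1)[OF \<rho>[OF that]] u by auto
  have "loop_act \<epsilon> l M' \<rho>' M \<rho> X (?b u' J u) = \<psi> (?p J)"
    using L(2)[of "?p J" 1] u semilinearD(1)[OF \<psi>, of "?p J"] by (simp add: TR_basis_def Rloc_closed)
  also have "\<dots> = (\<Oplus>\<^bsub>?TR\<^esub>a\<in>?K. ?b (\<rho>' (laff (?X a) a) u') J u \<oplus>\<^bsub>?TR\<^esub>
      (\<Oplus>\<^bsub>?TR\<^esub>i\<in>UNIV. \<Oplus>\<^bsub>?TR\<^esub>j\<in>UNIV. (xvar i powi a * rconst (- ?X a $ J i $ j)) \<odot>\<^bsub>?TR\<^esub> ?b u' (J(i := j)) u) \<oplus>\<^bsub>?TR\<^esub>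
      ?b u' J (\<rho> (sharp (?X a) a) u))"
    unfolding \<psi>_def using u rc
    by (intro TR.M.finsum_cong')
      (auto simp: l1 l2 l3 TR.scale_finsum TR.scale_scale Rloc_closed Pi_iff simp del: rconst_hom
        intro!: TR.M.finsum_closed TR.M.a_closed)
  also have "\<dots> = (\<Oplus>\<^bsub>?TR\<^esub>a\<in>?K. ?b (\<rho>' (laff (?X a) a) u') J u) \<oplus>\<^bsub>?TR\<^esub>
      (\<Oplus>\<^bsub>?TR\<^esub>i\<in>UNIV. \<Oplus>\<^bsub>?TR\<^esub>j\<in>UNIV. \<Oplus>\<^bsub>?TR\<^esub>a\<in>?K.
        (xvar i powi a * rconst (- ?X a $ J i $ j)) \<odot>\<^bsub>?TR\<^esub> ?b u' (J(i := j)) u) \<oplus>\<^bsub>?TR\<^esub>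
      (\<Oplus>\<^bsub>?TR\<^esub>a\<in>?K. ?b u' J (\<rho> (sharp (?X a) a) u))"
    using u rc
    by (simp add: TR.M.finsum_addf Pi_iff TR.M.finsum_closed Rloc_closed TR.M.finsum_swap[of ?K UNIV] del: rconst_hom)
  also have "\<dots> = loop_sum ?TR ?b (\<lambda>u'. \<Oplus>\<^bsub>M'\<^esub>a\<in>?K. \<rho>' (laff (?X a) a) u') (loop_coeff X)
      (\<lambda>u. \<Oplus>\<^bsub>M\<^esub>a\<in>?K. \<rho> (sharp (?X a) a) u) u' J u"
  proof -
    have coeff: "- loop_coeff X i k j = (\<Sum>a\<in>?K. xvar i powi a * rconst (- ?X a $ k $ j))" for i :: 'n and k j
      by (simp add: loop_coeff_def mult.commute flip: sum_negf)
    have scale: "(\<Sum>a\<in>?K. xvar i powi a * rconst (- ?X a $ k $ j)) \<odot>\<^bsub>?TR\<^esub> x =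
        (\<Oplus>\<^bsub>?TR\<^esub>a\<in>?K. (xvar i powi a * rconst (- ?X a $ k $ j)) \<odot>\<^bsub>?TR\<^esub> x)" if "x \<in> carrier ?TR" for x k j and i :: 'n
      by (rule TR.scale_sum) (use that in \<open>auto simp: Rloc_closed simp del: rconst_hom\<close>)
    show ?thesis
      using u rc
      by (simp add: loop_sum_def Pi_iff coeff scale
          semilinear_finsum[OF M'.smod_axioms smod_TR rconst_hom_on semilinear_TR_basis_first]
          semilinear_finsum[OF M.smod_axioms smod_TR rconst_hom_on semilinear_TR_basis_last] del: rconst_hom)
  qed
  finally show "loop_act \<epsilon> l M' \<rho>' M \<rho> X (?b u' J u) =
    loop_sum ?TR ?b (\<lambda>u'. \<Oplus>\<^bsub>M'\<^esub>a\<in>?K. \<rho>' (laff (?X a) a) u') (loop_coeff X)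
      (\<lambda>u. \<Oplus>\<^bsub>M\<^esub>a\<in>?K. \<rho> (sharp (?X a) a) u) u' J u" .
qed

end

section \<open>Regrading of loops\<close>

definition diag_mat :: "('m \<Rightarrow> 'f::field) \<Rightarrow> ('f, 'm::finite) sqmat" where
  "diag_mat d = (\<chi> i j. if i = j then d i else 0)"

lemma diag_mat_mult_left: "(diag_mat d ** A) $ i $ j = d i * A $ i $ j"
  by (simp add: diag_mat_def matrix_matrix_mult_def if_distribR if_distrib cong: if_cong)

lemma diag_mat_mult_right: "(A ** diag_mat d) $ i $ j = A $ i $ j * d j"
  by (simp add: diag_mat_def matrix_matrix_mult_def if_distribR if_distrib cong: if_cong)

lemma diag_mat_mult_vec: "(diag_mat d *v v) $ i = d i * v $ i"
  by (simp add: diag_mat_def matrix_vector_mult_def if_distribR if_distrib cong: if_cong)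

lemma transpose_diag_mat: "transpose (diag_mat d) = diag_mat d"
  by (simp add: diag_mat_def transpose_def vec_eq_iff)

lemma matrix_inv_eqI:
  fixes A B :: "('f::field, 'm::finite) sqmat"
  assumes "A ** B = mat 1" "B ** A = mat 1"
  shows "matrix_inv A = B"
proof -
  have "A ** matrix_inv A = mat 1 \<and> matrix_inv A ** A = mat 1"
    unfolding matrix_inv_def by (rule someI[of _ B]) (use assms in simp)
  then have "matrix_inv A = (matrix_inv A ** A) ** B"
    by (metis assms(1) matrix_mul_assoc matrix_mul_rid)
  then show ?thesis using \<open>A ** matrix_inv A = mat 1 \<and> matrix_inv A ** A = mat 1\<close> by simp
qed

lemma matrix_inv_diag_mat:
  assumes "\<And>i. d i \<noteq> 0"
  shows "matrix_inv (diag_mat d) = diag_mat (\<lambda>i. inverse (d i))"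
  by (rule matrix_inv_eqI)
    (use assms in \<open>simp_all add: vec_eq_iff diag_mat_mult_left, simp_all add: diag_mat_def mat_def\<close>)

lemma cochar_eq: "cochar \<nu> z = diag_mat (\<lambda>i. inverse (z ^ block \<nu> i))"
  by (simp add: cochar_def diag_mat_def power_int_minus vec_eq_iff)

text \<open>The cocharacter has exponents \<open>- p\<close> and the dual action inverts it, so the
  exponents become the block numbers themselves.\<close>

lemma dual_cochar:
  assumes "z \<noteq> 0"
  shows "dual_grp (cochar \<nu> z) v $ j = z ^ block \<nu> j * v $ j"
  using assms by (simp add: dual_grp_def cochar_eq matrix_inv_diag_mat transpose_diag_mat diag_mat_mult_vec)

lemma geps_eq:
  assumes "\<epsilon> \<noteq> 0"
  shows "geps \<nu> \<epsilon> = diag_mat (\<lambda>i. \<epsilon> ^ block \<nu> i)"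
  using assms by (simp add: geps_def cochar_eq matrix_inv_diag_mat)

text \<open>\<open>g\<close> inverts the cocharacter at \<open>\<epsilon>\<close> and the dual
  action inverts once more, which leaves inverse powers of \<open>\<epsilon>\<close>.
  \<open>W_ring\<close> multiplies \<open>x_i ^ block\<close> by the same root of unity.\<close>

lemma dual_geps:
  assumes "\<epsilon> \<noteq> 0"
  shows "(dual_grp (geps \<nu> \<epsilon>) ^^ d) v $ j = inverse \<epsilon> ^ (block \<nu> j * d) * v $ j"
proof -
  have "dual_grp (geps \<nu> \<epsilon>) v $ j = inverse \<epsilon> ^ block \<nu> j * v $ j" for v j
    using assms by (simp add: dual_grp_def geps_eq matrix_inv_diag_mat transpose_diag_mat
        diag_mat_mult_vec power_inverse)
  note * = this
  show ?thesis
    by (induction d) (simp_all add: * power_add mult.assoc)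
qed

text \<open>Recognizes the untwisted coinvariants, which are written with \<open>mat 1\<close>, as
  the case \<open>\<epsilon> = 1\<close>, \<open>l = 1\<close> of the twisted ones.\<close>

lemma geps_one: "geps \<nu> 1 = mat 1"
  by (simp add: geps_eq diag_mat_def mat_def)

lemma mscale_nth [simp]: "mscale c A $ i $ j = c * A $ i $ j"
  by (simp add: mscale_def)

lemma lookup_mscale_map:
  fixes X :: "'m::finite loop"
  shows "Poly_Mapping.lookup (Poly_Mapping.map (mscale c) X) a = mscale c (Poly_Mapping.lookup X a)"
  by (simp add: Poly_Mapping.map.rep_eq when_def mscale_def vec_eq_iff)

lemma trace_add: "trace (A ** (X + Y)) = trace (A ** X) + trace (A ** (Y :: ('f::field, 'm::finite) sqmat))"
  by (simp add: trace_def matrix_matrix_mult_def sum.distrib algebra_simps)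

text \<open>The eigenvalue of the commutator with \<open>gcheck \<nu>\<close> on the matrix unit at
  \<open>(i, j)\<close>.\<close>

definition bdeg :: "(nat \<Rightarrow> nat) \<Rightarrow> 'm::{finite,linorder} \<Rightarrow> 'm \<Rightarrow> int" where
  "bdeg \<nu> i j = int (block \<nu> j) - int (block \<nu> i)"

text \<open>For \<open>s = 1\<close> these are the loops fixed by \<open>F\<close>, for
  \<open>s = - 1\<close> those fixed by \<open>F'\<close> and by the automorphism of the loop
  algebra; see \<open>loop_fixed_eps\<close> and \<open>loop_fixed_inverse_eps\<close>. For
  \<open>l = 1\<close> they are all loops.\<close>

definition graded_loops :: "(nat \<Rightarrow> nat) \<Rightarrow> nat \<Rightarrow> int \<Rightarrow> 'm::{finite,linorder} loop set" where
  "graded_loops \<nu> l s = {X. \<forall>a i j. Poly_Mapping.lookup X a $ i $ j \<noteq> 0 \<longrightarrow> int l dvd a - s * bdeg \<nu> i j}"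

text \<open>For \<open>s = 1\<close> (resp. \<open>s = -1\<close>), \<open>down\<close> is the loop part of \<open>kappa\<close> (resp. \<open>kappa'\<close>) and \<open>up\<close> its inverse;
  \<open>c\<close> collects the signs.\<close>

definition down :: "(nat \<Rightarrow> nat) \<Rightarrow> nat \<Rightarrow> (int \<Rightarrow> complex) \<Rightarrow> int \<Rightarrow> 'm loop \<Rightarrow> 'm::{finite,linorder} loop" where
  "down \<nu> l c s X = (\<Sum>a\<in>Poly_Mapping.keys X. \<Sum>b\<in>{- int l..int l}.
     Poly_Mapping.single ((a - s * b) div int l)
       (mscale (c (a + (a - s * b) div int l)) (geigen_proj \<nu> b (Poly_Mapping.lookup X a))))"

definition up :: "(nat \<Rightarrow> nat) \<Rightarrow> nat \<Rightarrow> (int \<Rightarrow> complex) \<Rightarrow> int \<Rightarrow> 'm loop \<Rightarrow> 'm::{finite,linorder} loop" where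
  "up \<nu> l c s Y = (\<Sum>k\<in>Poly_Mapping.keys Y. \<Sum>b\<in>{- int l..int l}.
     Poly_Mapping.single (int l * k + s * b)
       (mscale (c (int l * k + s * b + k)) (geigen_proj \<nu> b (Poly_Mapping.lookup Y k))))"

lemma lookup_sum_nth:
  "Poly_Mapping.lookup (sum F A) k $ i $ j = (\<Sum>a\<in>A. Poly_Mapping.lookup (F a) k $ i $ j)"
  by (simp add: lookup_sum)

text \<open>A matrix entry belongs to a single eigenspace, so of the projections only the one for
  \<open>bdeg \<nu> i j\<close> contributes. The bound on block numbers puts this value into the
  range of summation.\<close>

lemma lookup_regrade:
  fixes X :: "'m::{finite,linorder} loop"
  assumes "(\<Sum>p=1..l. \<nu> p) = CARD('m)"
  shows "Poly_Mapping.lookup (\<Sum>a\<in>Poly_Mapping.keys X. \<Sum>b\<in>{- int l..int l}.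
      Poly_Mapping.single (f a b) (mscale (c a b) (geigen_proj \<nu> b (Poly_Mapping.lookup X a)))) k $ i $ j =
    (\<Sum>a\<in>Poly_Mapping.keys X. if f a (bdeg \<nu> i j) = k
       then c a (bdeg \<nu> i j) * Poly_Mapping.lookup X a $ i $ j else 0)"
proof -
  let ?b = "bdeg \<nu> i j"
  have "block \<nu> i \<le> l" "block \<nu> j \<le> l" using block_le[OF assms] by auto
  then have b: "?b \<in> {- int l..int l}" by (auto simp: bdeg_def)
  have "(\<Sum>b\<in>{- int l..int l}. Poly_Mapping.lookup (Poly_Mapping.single (f a b)
      (mscale (c a b) (geigen_proj \<nu> b (Poly_Mapping.lookup X a)))) k $ i $ j) =
    (\<Sum>b\<in>{- int l..int l}. if b = ?b then if f a ?b = k then c a ?b * Poly_Mapping.lookup X a $ i $ j else 0 else 0)"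
    for a
    by (rule sum.cong) (auto simp: lookup_single when_def geigen_proj_def bdeg_def)
  then show ?thesis using b by (simp add: lookup_sum_nth sum.delta)
qed

text \<open>\<open>a0\<close> may lie outside the keys of \<open>X\<close>; the entry is then zero
  and the formula still holds.\<close>

lemma sum_single_key:
  fixes X :: "'m::finite loop"
  assumes "\<And>a. Poly_Mapping.lookup X a $ i $ j \<noteq> 0 \<Longrightarrow> f a = k \<Longrightarrow> a = a0" "f a0 = k"
  shows "(\<Sum>a\<in>Poly_Mapping.keys X. if f a = k then c a * Poly_Mapping.lookup X a $ i $ j else 0) =
    c a0 * Poly_Mapping.lookup X a0 $ i $ j"
proof -
  have "(\<Sum>a\<in>Poly_Mapping.keys X. if f a = k then c a * Poly_Mapping.lookup X a $ i $ j else 0) =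
      (\<Sum>a\<in>Poly_Mapping.keys X. if a = a0 then c a0 * Poly_Mapping.lookup X a0 $ i $ j else 0)"
    by (rule sum.cong) (use assms in auto)
  also have "\<dots> = c a0 * Poly_Mapping.lookup X a0 $ i $ j"
    by (auto simp: in_keys_iff)
  finally show ?thesis .
qed

context
  fixes \<nu> :: "nat \<Rightarrow> nat" and l :: nat
  assumes \<nu>: "(\<Sum>p=1..l. \<nu> p) = CARD('m::{finite,linorder})" and l: "l \<ge> 1"
begin

text \<open>Divisibility makes the division exact, so that a single source degree contributes to
  \<open>k\<close>; in general several degrees round to the same quotient.\<close>

lemma lookup_down:
  fixes X :: "'m loop"
  assumes "X \<in> graded_loops \<nu> l s"
  shows "Poly_Mapping.lookup (down \<nu> l c s X) k $ i $ j =
    c (int l * k + s * bdeg \<nu> i j + k) * Poly_Mapping.lookup X (int l * k + s * bdeg \<nu> i j) $ i $ j"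
proof -
  let ?a = "int l * k + s * bdeg \<nu> i j"
  have "Poly_Mapping.lookup (down \<nu> l c s X) k $ i $ j =
      c (?a + (?a - s * bdeg \<nu> i j) div int l) * Poly_Mapping.lookup X ?a $ i $ j"
    unfolding down_def lookup_regrade[OF \<nu>]
  proof (rule sum_single_key)
    fix a assume "Poly_Mapping.lookup X a $ i $ j \<noteq> 0" "(a - s * bdeg \<nu> i j) div int l = k"
    moreover from this have "int l dvd a - s * bdeg \<nu> i j" using assms by (auto simp: graded_loops_def)
    ultimately show "a = ?a" by auto
  qed (use l in simp)
  then show ?thesis using l by simp
qed

lemma lookup_up:
  fixes Y :: "'m loop"
  shows "Poly_Mapping.lookup (up \<nu> l c s Y) a $ i $ j =
    (if int l dvd a - s * bdeg \<nu> i j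
     then c (a + (a - s * bdeg \<nu> i j) div int l) * Poly_Mapping.lookup Y ((a - s * bdeg \<nu> i j) div int l) $ i $ j
     else 0)"
proof (cases "int l dvd a - s * bdeg \<nu> i j")
  case True
  let ?k = "(a - s * bdeg \<nu> i j) div int l"
  have a: "int l * ?k + s * bdeg \<nu> i j = a" using True by simp
  have "Poly_Mapping.lookup (up \<nu> l c s Y) a $ i $ j =
      c (int l * ?k + s * bdeg \<nu> i j + ?k) * Poly_Mapping.lookup Y ?k $ i $ j"
    unfolding up_def lookup_regrade[OF \<nu>]
    by (rule sum_single_key) (use l a in auto)
  then show ?thesis using True a by simp
next
  case False
  have "int l * k + s * bdeg \<nu> i j \<noteq> a" for k using False by auto
  then show ?thesis using False unfolding up_def lookup_regrade[OF \<nu>] by simp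
qed

lemma up_in_graded_loops: "up \<nu> l c s (Y :: 'm loop) \<in> graded_loops \<nu> l s"
  unfolding graded_loops_def by (auto simp: lookup_up)

text \<open>\<open>down\<close> and \<open>up\<close> evaluate \<open>c\<close> at the same number,
  the sum of the old and the new degree, so the two signs meet as a square.\<close>

lemma down_up:
  fixes Y :: "'m loop"
  assumes "\<And>n. c n * c n = 1"
  shows "down \<nu> l c s (up \<nu> l c s Y) = Y"
proof (rule poly_mapping_eqI)
  fix k show "Poly_Mapping.lookup (down \<nu> l c s (up \<nu> l c s Y)) k = Poly_Mapping.lookup Y k"
    using l assms by (simp add: vec_eq_iff lookup_down[OF up_in_graded_loops] lookup_up mult.assoc[symmetric])
qed

lemma up_down:
  fixes X :: "'m loop"
  assumes "\<And>n. c n * c n = 1" "X \<in> graded_loops \<nu> l s"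
  shows "up \<nu> l c s (down \<nu> l c s X) = X"
proof (rule poly_mapping_eqI)
  fix a
  have "Poly_Mapping.lookup (up \<nu> l c s (down \<nu> l c s X)) a $ i $ j = Poly_Mapping.lookup X a $ i $ j" for i j
  proof (cases "int l dvd a - s * bdeg \<nu> i j")
    case True
    then show ?thesis
      using assms(1) by (simp add: lookup_up lookup_down[OF assms(2)] mult.assoc[symmetric])
  next
    case False
    then have "Poly_Mapping.lookup X a $ i $ j = 0" using assms(2) by (auto simp: graded_loops_def)
    then show ?thesis using False by (simp add: lookup_up)
  qed
  then show "Poly_Mapping.lookup (up \<nu> l c s (down \<nu> l c s X)) a = Poly_Mapping.lookup X a"
    by (simp add: vec_eq_iff)
qed

lemma up_add: "up \<nu> l c s (X + Y :: 'm loop) = up \<nu> l c s X + up \<nu> l c s Y"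
  by (rule poly_mapping_eqI) (simp add: vec_eq_iff lookup_up lookup_add algebra_simps)

end

section \<open>Fixed points of the twists as graded loops\<close>

context root_of_unity
begin

text \<open>Conjugation by the diagonal matrix \<open>g\<close> scales each matrix entry separately,
  so being fixed is a condition on each nonzero entry of each coefficient.\<close>

lemma loop_fixed_iff:
  fixes X :: "'m::{finite,linorder} loop"
  assumes "e \<noteq> 0"
  shows "X \<in> loop_fixed (geps \<nu> \<epsilon>) e \<longleftrightarrow>
    (\<forall>a i j. Poly_Mapping.lookup X a $ i $ j \<noteq> 0 \<longrightarrow> e powi a * \<epsilon> powi (- bdeg \<nu> i j) = 1)"
proof -
  have g: "(geps \<nu> \<epsilon> ** \<xi> ** matrix_inv (geps \<nu> \<epsilon>)) $ i $ j = \<epsilon> powi (- bdeg \<nu> i j) * \<xi> $ i $ j"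
    for \<xi> :: "(complex, 'm) sqmat" and i j
  proof -
    have "\<epsilon> powi (- bdeg \<nu> i j) = \<epsilon> ^ block \<nu> i * inverse (\<epsilon> ^ block \<nu> j)"
      using eps_neq_0 by (simp add: bdeg_def power_int_diff divide_inverse)
    then show ?thesis
      using eps_neq_0 by (simp add: geps_eq matrix_inv_diag_mat diag_mat_mult_left diag_mat_mult_right)
  qed
  have "X \<in> loop_fixed (geps \<nu> \<epsilon>) e \<longleftrightarrow>
      (\<forall>a. Poly_Mapping.lookup (loop_twist (geps \<nu> \<epsilon>) e X) a = Poly_Mapping.lookup X a)"
    by (auto simp: loop_fixed_def intro: poly_mapping_eqI)
  also have "\<dots> \<longleftrightarrow> (\<forall>a i j. e powi a * (\<epsilon> powi (- bdeg \<nu> i j) * Poly_Mapping.lookup X a $ i $ j) =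
      Poly_Mapping.lookup X a $ i $ j)"
  proof -
    have "Poly_Mapping.lookup (loop_twist (geps \<nu> \<epsilon>) e X) a $ i $ j =
        e powi a * (\<epsilon> powi (- bdeg \<nu> i j) * Poly_Mapping.lookup X a $ i $ j)" for a i j
      by (cases "a \<in> Poly_Mapping.keys X")
        (simp_all add: loop_twist_def lookup_mapp when_def g in_keys_iff)
    then show ?thesis by (simp add: vec_eq_iff)
  qed
  also have "\<dots> \<longleftrightarrow> (\<forall>a i j. Poly_Mapping.lookup X a $ i $ j \<noteq> 0 \<longrightarrow> e powi a * \<epsilon> powi (- bdeg \<nu> i j) = 1)"
    by (simp add: mult.assoc[symmetric]) blast
  finally show ?thesis .
qed

lemma loop_fixed_eps: "loop_fixed (geps \<nu> \<epsilon>) \<epsilon> = graded_loops \<nu> l 1"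
proof -
  have "\<epsilon> powi a * \<epsilon> powi (- b) = 1 \<longleftrightarrow> int l dvd a - 1 * b" for a b
    using eps_neq_0 by (simp add: eps_powi_eq_1_iff flip: power_int_add)
  then show ?thesis using loop_fixed_iff[of \<epsilon>] eps_neq_0 by (auto simp: graded_loops_def)
qed

lemma loop_fixed_inverse_eps: "loop_fixed (geps \<nu> \<epsilon>) (inverse \<epsilon>) = graded_loops \<nu> l (- 1)"
proof -
  have "inverse \<epsilon> powi a * \<epsilon> powi (- b) = 1 \<longleftrightarrow> int l dvd a - (- 1) * b" for a b
  proof -
    have "inverse \<epsilon> powi a * \<epsilon> powi (- b) = \<epsilon> powi (- (a + b))"
      using eps_neq_0 by (simp add: power_int_diff power_int_minus power_int_inverse power_int_add divide_inverse)
    also have "\<dots> = 1 \<longleftrightarrow> int l dvd a - (- 1) * b"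
      by (simp only: eps_powi_eq_1_iff dvd_minus_iff) simp
    finally show ?thesis .
  qed
  then show ?thesis using loop_fixed_iff[of "inverse \<epsilon>"] eps_neq_0 by (auto simp: graded_loops_def)
qed

end

section \<open>Explicit inverses of the isomorphisms of affine Lie algebras\<close>

lemma aff_fixed_iff: "\<eta> \<in> aff_fixed g e \<longleftrightarrow> fst \<eta> \<in> loop_fixed g e"
  by (cases \<eta>) (auto simp: aff_fixed_def loop_fixed_def)

definition sgn_pow :: "int \<Rightarrow> complex" where "sgn_pow n = (-1) powi n"

lemma sgn_pow_square: "sgn_pow n * sgn_pow n = 1"
  by (simp add: sgn_pow_def flip: power_int_mult_distrib)

lemma kappa_eq:
  "kappa \<nu> l \<eta> = (down \<nu> l sgn_pow 1 (fst \<eta>),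
     snd \<eta> / of_nat l - trace (gcheck \<nu> ** Poly_Mapping.lookup (fst \<eta>) 0) / of_nat l)"
  by (simp add: kappa_def down_def sgn_pow_def)

lemma kappa'_eq:
  fixes \<eta> :: "'m::{finite,linorder} affine"
  shows
  "kappa' \<nu> l \<eta> = (down \<nu> l (\<lambda>_. 1) (- 1) (fst \<eta>),
     snd \<eta> / of_nat l + trace (gcheck \<nu> ** Poly_Mapping.lookup (fst \<eta>) 0) / of_nat l)"
proof -
  have "mscale 1 \<xi> = \<xi>" for \<xi> :: "(complex, 'm) sqmat" by (simp add: vec_eq_iff)
  then show ?thesis by (simp add: kappa'_def down_def)
qed

text \<open>The central component solves the equation defining \<open>kappa\<close>, whose
  correction involves the degree zero coefficient of its argument; hence the trace is taken of the
  regraded loop \<open>X\<close> and not of the loop in \<open>\<theta>\<close>.\<close>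

definition kappa_inv :: "(nat \<Rightarrow> nat) \<Rightarrow> nat \<Rightarrow> 'm affine \<Rightarrow> 'm::{finite,linorder} affine" where
  "kappa_inv \<nu> l \<theta> = (let X = up \<nu> l sgn_pow 1 (fst \<theta>)
     in (X, of_nat l * snd \<theta> + trace (gcheck \<nu> ** Poly_Mapping.lookup X 0)))"

definition kappa'_inv :: "(nat \<Rightarrow> nat) \<Rightarrow> nat \<Rightarrow> 'm affine \<Rightarrow> 'm::{finite,linorder} affine" where
  "kappa'_inv \<nu> l \<theta> = (let X = up \<nu> l (\<lambda>_. 1) (- 1) (fst \<theta>)
     in (X, of_nat l * snd \<theta> - trace (gcheck \<nu> ** Poly_Mapping.lookup X 0)))"

text \<open>The substitution \<open>t \<mapsto> - 1/t\<close>: the sum of the loop parts of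
  \<open>sharp\<close> over the homogeneous components.\<close>

definition sharp_loop :: "'m loop \<Rightarrow> 'm::finite loop" where
  "sharp_loop X = (\<Sum>a\<in>Poly_Mapping.keys X. Poly_Mapping.single (- a) (mscale (sgn_pow a) (Poly_Mapping.lookup X a)))"

lemma lookup_sharp_loop: "Poly_Mapping.lookup (sharp_loop X) a = mscale (sgn_pow a) (Poly_Mapping.lookup X (- a))"
proof -
  have m: "sgn_pow (- a) = sgn_pow a" by (simp add: sgn_pow_def power_int_minus flip: power_int_inverse)
  have "Poly_Mapping.lookup (sharp_loop X) a =
      (\<Sum>b\<in>Poly_Mapping.keys X. if b = - a then mscale (sgn_pow a) (Poly_Mapping.lookup X (- a)) else 0)"
    unfolding sharp_loop_def lookup_sum
    by (rule sum.cong) (auto simp: lookup_single when_def m)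
  also have "\<dots> = mscale (sgn_pow a) (Poly_Mapping.lookup X (- a))"
    by (auto simp: in_keys_iff vec_eq_iff)
  finally show ?thesis .
qed

context root_of_unity
begin

context
  fixes \<nu> :: "nat \<Rightarrow> nat"
  assumes \<nu>: "(\<Sum>p=1..l. \<nu> p) = CARD('m::{finite,linorder})"
begin

text \<open>\<open>transport\<close> is defined through \<open>inv_into\<close>. An explicit
  two-sided inverse with values in the fixed points replaces that choice by a formula.\<close>

lemma inv_into_kappa:
  fixes \<theta> :: "'m affine"
  shows "inv_into (aff_fixed (geps \<nu> \<epsilon>) \<epsilon>) (kappa \<nu> l) \<theta> = kappa_inv \<nu> l \<theta>"
proof (rule inv_into_f_eq)
  show "inj_on (kappa \<nu> l) (aff_fixed (geps \<nu> \<epsilon>) \<epsilon> :: 'm affine set)"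
  proof (rule inj_on_inverseI)
    fix \<eta> :: "'m affine" assume "\<eta> \<in> aff_fixed (geps \<nu> \<epsilon>) \<epsilon>"
    then have "fst \<eta> \<in> graded_loops \<nu> l 1" by (simp add: aff_fixed_iff loop_fixed_eps)
    then show "kappa_inv \<nu> l (kappa \<nu> l \<eta>) = \<eta>"
      using l by (cases \<eta>) (simp add: kappa_eq kappa_inv_def up_down[OF \<nu> l sgn_pow_square] field_simps)
  qed
  show "kappa_inv \<nu> l \<theta> \<in> aff_fixed (geps \<nu> \<epsilon>) \<epsilon>"
    by (simp add: aff_fixed_iff loop_fixed_eps kappa_inv_def Let_def up_in_graded_loops[OF \<nu> l])
  show "kappa \<nu> l (kappa_inv \<nu> l \<theta>) = \<theta>"
    using l by (cases \<theta>) (simp add: kappa_eq kappa_inv_def Let_def down_up[OF \<nu> l sgn_pow_square] field_simps)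
qed

lemma inv_into_kappa':
  fixes \<theta> :: "'m affine"
  shows "inv_into (aff_fixed (geps \<nu> \<epsilon>) (inverse \<epsilon>)) (kappa' \<nu> l) \<theta> = kappa'_inv \<nu> l \<theta>"
proof (rule inv_into_f_eq)
  show "inj_on (kappa' \<nu> l) (aff_fixed (geps \<nu> \<epsilon>) (inverse \<epsilon>) :: 'm affine set)"
  proof (rule inj_on_inverseI)
    fix \<eta> :: "'m affine" assume "\<eta> \<in> aff_fixed (geps \<nu> \<epsilon>) (inverse \<epsilon>)"
    then have "fst \<eta> \<in> graded_loops \<nu> l (- 1)" by (simp add: aff_fixed_iff loop_fixed_inverse_eps)
    then show "kappa'_inv \<nu> l (kappa' \<nu> l \<eta>) = \<eta>"
      using l by (cases \<eta>) (simp add: kappa'_eq kappa'_inv_def up_down[OF \<nu> l] field_simps)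
  qed
  show "kappa'_inv \<nu> l \<theta> \<in> aff_fixed (geps \<nu> \<epsilon>) (inverse \<epsilon>)"
    by (simp add: aff_fixed_iff loop_fixed_inverse_eps kappa'_inv_def Let_def up_in_graded_loops[OF \<nu> l])
  show "kappa' \<nu> l (kappa'_inv \<nu> l \<theta>) = \<theta>"
    using l by (cases \<theta>) (simp add: kappa'_eq kappa'_inv_def Let_def down_up[OF \<nu> l] field_simps)
qed

lemma kappa_inv_add: "kappa_inv \<nu> l (\<eta> + \<theta> :: 'm affine) = kappa_inv \<nu> l \<eta> + kappa_inv \<nu> l \<theta>"
  by (simp add: kappa_inv_def Let_def up_add[OF \<nu> l] lookup_add trace_add algebra_simps)

lemma kappa'_inv_add: "kappa'_inv \<nu> l (\<eta> + \<theta> :: 'm affine) = kappa'_inv \<nu> l \<eta> + kappa'_inv \<nu> l \<theta>"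
  by (simp add: kappa'_inv_def Let_def up_add[OF \<nu> l] lookup_add trace_add algebra_simps)

lemma kappa_inv_fixed: "kappa_inv \<nu> l (\<theta> :: 'm affine) \<in> aff_fixed (geps \<nu> \<epsilon>) \<epsilon>"
  by (simp add: aff_fixed_iff loop_fixed_eps kappa_inv_def Let_def up_in_graded_loops[OF \<nu> l])

lemma kappa'_inv_fixed: "kappa'_inv \<nu> l (\<theta> :: 'm affine) \<in> aff_fixed (geps \<nu> \<epsilon>) (inverse \<epsilon>)"
  by (simp add: aff_fixed_iff loop_fixed_inverse_eps kappa'_inv_def Let_def up_in_graded_loops[OF \<nu> l])

text \<open>This compatibility is what the sign in \<open>kappa\<close> is for. At an entry of
  degree \<open>b\<close> and \<open>a = l k + b\<close> the two sides carry the signs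
  \<open>(-1)^(a+k) (-1)^k\<close> and \<open>(-1)^a\<close>. Consequently the outer factors receive
  one and the same twisted loop, the last one through its sharp.\<close>

lemma up_sharp_loop: "up \<nu> l sgn_pow 1 (sharp_loop Y) = sharp_loop (up \<nu> l (\<lambda>_. 1) (- 1) (Y :: 'm loop))"
proof (rule poly_mapping_eqI)
  fix a
  have "Poly_Mapping.lookup (up \<nu> l sgn_pow 1 (sharp_loop Y)) a $ i $ j =
      Poly_Mapping.lookup (sharp_loop (up \<nu> l (\<lambda>_. 1) (- 1) Y)) a $ i $ j" for i j
  proof (cases "int l dvd a - bdeg \<nu> i j")
    case True
    then obtain k where "a - bdeg \<nu> i j = int l * k" by auto
    then have k: "a = int l * k + bdeg \<nu> i j" by simp
    have d: "- (int l * k) div int l = - k"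
      using l by (metis mult_minus_right nonzero_mult_div_cancel_left not_one_le_zero of_nat_eq_0_iff)
    have "sgn_pow (a + k) * sgn_pow k = sgn_pow a"
    proof -
      have "sgn_pow (a + k) = sgn_pow a * sgn_pow k" by (simp add: sgn_pow_def power_int_add)
      then show ?thesis using sgn_pow_square[of k] by simp
    qed
    then show ?thesis
      using l by (simp add: k d lookup_up[OF \<nu> l] lookup_sharp_loop mult.assoc[symmetric])
  next
    case False
    moreover have "\<not> int l dvd - a + bdeg \<nu> i j"
      using False dvd_minus_iff[of "int l" "a - bdeg \<nu> i j"] by simp
    ultimately show ?thesis by (simp add: lookup_up[OF \<nu> l] lookup_sharp_loop)
  qed
  then show "Poly_Mapping.lookup (up \<nu> l sgn_pow 1 (sharp_loop Y)) a =
      Poly_Mapping.lookup (sharp_loop (up \<nu> l (\<lambda>_. 1) (- 1) Y)) a" by (simp add: vec_eq_iff)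
qed

text \<open>An entry of degree \<open>b\<close> of the \<open>q\<close>-th coefficient of
  \<open>Y\<close> sits in degree \<open>l q - b\<close> of the regraded loop. The factor
  \<open>x_i^b\<close> raises the power to \<open>x_i^(l q)\<close>, which is the image of
  \<open>y_i^q\<close>.\<close>

lemma emb_loop_coeff:
  fixes Y :: "'m loop" and i :: "'n::{finite,linorder}"
  shows "loop_coeff (up \<nu> l (\<lambda>_. 1) (- 1) Y) i k j * xvar i powi bdeg \<nu> k j = emb l (loop_coeff Y i k j)"
proof -
  let ?X = "up \<nu> l (\<lambda>_. 1) (- 1) Y" and ?b = "bdeg \<nu> k j"
  interpret E: field_hom "emb l :: 'n ratf \<Rightarrow> 'n ratf" by (rule emb_hom[OF l])
  let ?f = "\<lambda>a. rconst (Poly_Mapping.lookup ?X a $ k $ j) * xvar i powi a :: 'n ratf"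
  define S where "S = (\<lambda>q. int l * q - ?b) ` Poly_Mapping.keys Y"
  have inj: "inj_on (\<lambda>q. int l * q - ?b) (Poly_Mapping.keys Y)" using l by (auto simp: inj_on_def)
  have X: "Poly_Mapping.lookup ?X (int l * q - ?b) $ k $ j = Poly_Mapping.lookup Y q $ k $ j" for q
    using l by (simp add: lookup_up[OF \<nu> l])
  have out: "Poly_Mapping.lookup ?X a $ k $ j = 0" if "a \<notin> S" for a
  proof (cases "int l dvd a + ?b")
    case True
    then obtain q where q: "a + ?b = int l * q" by auto
    then have "a = int l * q - ?b" by simp
    then have "q \<notin> Poly_Mapping.keys Y" using that by (auto simp: S_def)
    then show ?thesis using q l True by (simp add: lookup_up[OF \<nu> l] in_keys_iff)
  qed (simp add: lookup_up[OF \<nu> l])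
  have "loop_coeff ?X i k j = (\<Sum>a\<in>Poly_Mapping.keys ?X \<union> S. ?f a)"
    unfolding loop_coeff_def by (rule sum.mono_neutral_left) (auto simp: S_def in_keys_iff)
  also have "\<dots> = (\<Sum>a\<in>S. ?f a)"
    by (rule sum.mono_neutral_right) (use out in \<open>auto simp: S_def\<close>)
  also have "\<dots> = (\<Sum>q\<in>Poly_Mapping.keys Y. rconst (Poly_Mapping.lookup Y q $ k $ j) * xvar i powi (int l * q - ?b))"
    unfolding S_def by (simp add: sum.reindex[OF inj] X)
  finally have "loop_coeff ?X i k j * xvar i powi ?b =
      (\<Sum>q\<in>Poly_Mapping.keys Y. rconst (Poly_Mapping.lookup Y q $ k $ j) * (xvar i powi (int l * q - ?b) * xvar i powi ?b))"
    by (simp add: sum_distrib_right mult.assoc)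
  also have "\<dots> = emb l (loop_coeff Y i k j)"
    by (simp add: loop_coeff_def E.hom_sum emb_hom[OF l] power_int_mult flip: power_int_add)
  finally show ?thesis .
qed

end

end

section \<open>Coinvariants\<close>

text \<open>Used with \<open>\<sigma>\<close> the permutation part of an element of
  \<open>W\<close>, and with \<open>\<sigma> = id\<close> and \<open>w = xw\<close>. Acting at place
  \<open>i\<close> replaces \<open>J i\<close> by \<open>j\<close>, so the weights affect the inner
  sum only through the passage from \<open>w J\<close> to \<open>w (J(i := j))\<close>, which
  \<open>twist\<close> trades against the coefficients.\<close>

lemma loop_sum_twist:
  fixes P :: "'a \<Rightarrow> ('n::finite \<Rightarrow> 'm::finite) \<Rightarrow> 'b \<Rightarrow> 'y" and \<sigma> :: "'n \<Rightarrow> 'n"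
  assumes B: "smod S B" and \<sigma>: "bij \<sigma>"
    and c: "L' u' \<in> U'" "L u \<in> U" "u' \<in> U'" "u \<in> U"
    and P: "\<And>u' J u. u' \<in> U' \<Longrightarrow> u \<in> U \<Longrightarrow> P u' J u \<in> carrier B"
    and w: "\<And>J. w J \<in> S" and \<mu>: "\<And>i k j. - \<mu> i k j \<in> S" "\<And>i k j. - \<mu>' i k j \<in> S"
    and P': "\<And>u' J u. u' \<in> U' \<Longrightarrow> u \<in> U \<Longrightarrow> P' u' J u = w J \<odot>\<^bsub>B\<^esub> P u' (J \<circ> inv_into UNIV \<sigma>) u"
    and twist: "\<And>J i j. \<mu>' i (J i) j * w (J(i := j)) = w J * \<mu> (\<sigma> i) (J i) j"
  shows "loop_sum B P' L' \<mu>' L u' J u = w J \<odot>\<^bsub>B\<^esub> loop_sum B P L' \<mu> L u' (J \<circ> inv_into UNIV \<sigma>) u"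
proof -
  interpret B: smod S B by (rule B)
  let ?J = "J \<circ> inv_into UNIV \<sigma>"
  let ?F = "\<lambda>i j. (- \<mu> i (?J i) j) \<odot>\<^bsub>B\<^esub> P u' (?J(i := j)) u"
  have inv: "inv_into UNIV \<sigma> (\<sigma> i) = i" "\<sigma> (inv_into UNIV \<sigma> i) = i" for i
    using \<sigma> by (simp_all add: bij_is_inj bij_is_surj surj_f_inv_f)
  \<comment> \<open>Relabelling place \<open>i\<close> before the permutation is relabelling place
    \<open>\<sigma> i\<close> after it; the sum over \<open>i\<close> is reindexed by
    \<open>\<sigma>\<close> below.\<close>
  have upd: "J(i := j) \<circ> inv_into UNIV \<sigma> = ?J(\<sigma> i := j)" for i j
    using inv by (auto simp: fun_eq_iff)
  have Fc: "?F i j \<in> carrier B" for i j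
    using c P \<mu> by (intro B.scale_closed) auto
  have "(- \<mu>' i (J i) j) \<odot>\<^bsub>B\<^esub> P' u' (J(i := j)) u = w J \<odot>\<^bsub>B\<^esub> ?F (\<sigma> i) j" for i j
  proof -
    have tw: "(- \<mu>' i (J i) j) * w (J(i := j)) = w J * - \<mu> (\<sigma> i) (J i) j"
      using twist[of i J j] by simp
    have J: "J i = ?J (\<sigma> i)" by (simp add: inv)
    have "(- \<mu>' i (J i) j) \<odot>\<^bsub>B\<^esub> P' u' (J(i := j)) u =
        ((- \<mu>' i (J i) j) * w (J(i := j))) \<odot>\<^bsub>B\<^esub> P u' (?J(\<sigma> i := j)) u"
      unfolding P'[OF c(3,4)] upd by (rule B.scale_scale[OF \<mu>(2) w P[OF c(3,4)]])
    then show ?thesis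
      unfolding tw by (simp only: B.scale_scale[OF w \<mu>(1) P[OF c(3,4)]] J[symmetric])
  qed
  then have "(\<Oplus>\<^bsub>B\<^esub>i\<in>UNIV. \<Oplus>\<^bsub>B\<^esub>j\<in>UNIV. (- \<mu>' i (J i) j) \<odot>\<^bsub>B\<^esub> P' u' (J(i := j)) u) =
      (\<Oplus>\<^bsub>B\<^esub>i\<in>UNIV. w J \<odot>\<^bsub>B\<^esub> (\<Oplus>\<^bsub>B\<^esub>j\<in>UNIV. ?F (\<sigma> i) j))"
    using w Fc by (simp add: B.scale_finsum Pi_iff)
  also have "\<dots> = w J \<odot>\<^bsub>B\<^esub> (\<Oplus>\<^bsub>B\<^esub>i\<in>UNIV. \<Oplus>\<^bsub>B\<^esub>j\<in>UNIV. ?F (\<sigma> i) j)"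
    by (rule B.scale_finsum[symmetric]) (use w Fc in \<open>auto intro: B.M.finsum_closed\<close>)
  also have "(\<Oplus>\<^bsub>B\<^esub>i\<in>UNIV. \<Oplus>\<^bsub>B\<^esub>j\<in>UNIV. ?F (\<sigma> i) j) = (\<Oplus>\<^bsub>B\<^esub>i\<in>UNIV. \<Oplus>\<^bsub>B\<^esub>j\<in>UNIV. ?F i j)"
    using B.M.finsum_reindex[where f = "\<lambda>i. \<Oplus>\<^bsub>B\<^esub>j\<in>UNIV. ?F i j" and h = \<sigma> and A = UNIV] \<sigma> Fc
    by (simp add: Pi_iff B.M.finsum_closed bij_is_inj bij_is_surj)
  finally have mid: "(\<Oplus>\<^bsub>B\<^esub>i\<in>UNIV. \<Oplus>\<^bsub>B\<^esub>j\<in>UNIV. (- \<mu>' i (J i) j) \<odot>\<^bsub>B\<^esub> P' u' (J(i := j)) u) =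
      w J \<odot>\<^bsub>B\<^esub> (\<Oplus>\<^bsub>B\<^esub>i\<in>UNIV. \<Oplus>\<^bsub>B\<^esub>j\<in>UNIV. ?F i j)" .
  have "(\<Oplus>\<^bsub>B\<^esub>i\<in>UNIV. \<Oplus>\<^bsub>B\<^esub>j\<in>UNIV. ?F i j) \<in> carrier B"
    by (intro B.M.finsum_closed Pi_I Fc)
  then show ?thesis
    unfolding loop_sum_def mid using c P w
    by (simp add: P' B.scale_add_right B.M.a_closed del: o_apply)
qed

text \<open>The shifts by \<open>s\<close> on the first factor and \<open>- s\<close> on the last
  add opposite multiples of the same tensor. This absorbs the central terms of \<open>kappa\<close>
  and \<open>kappa'\<close>.\<close>

lemma loop_sum_shift:
  fixes P :: "'a \<Rightarrow> ('n::finite \<Rightarrow> 'm::finite) \<Rightarrow> 'b \<Rightarrow> 'y"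
  assumes B: "smod S B" and hom: "ring_hom_on UNIV S r" and M': "smod UNIV M'" and M: "smod UNIV M"
    and first: "semilinear UNIV r M' B (\<lambda>u'. P u' J u)"
    and last: "semilinear UNIV r M B (\<lambda>u. P u' J u)"
    and c: "L' u' \<in> carrier M'" "L u \<in> carrier M" "u' \<in> carrier M'" "u \<in> carrier M"
    and L: "K' u' = L' u' \<oplus>\<^bsub>M'\<^esub> s \<odot>\<^bsub>M'\<^esub> u'" "K u = L u \<oplus>\<^bsub>M\<^esub> (- s) \<odot>\<^bsub>M\<^esub> u"
    and mid: "(\<Oplus>\<^bsub>B\<^esub>i\<in>UNIV. \<Oplus>\<^bsub>B\<^esub>j\<in>UNIV. (- \<mu> i (J i) j) \<odot>\<^bsub>B\<^esub> P u' (J(i := j)) u) \<in> carrier B"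
  shows "loop_sum B P K' \<mu> K u' J u = loop_sum B P L' \<mu> L u' J u"
proof -
  interpret B: smod S B by (rule B)
  interpret M': smod UNIV M' by (rule M')
  interpret M: smod UNIV M by (rule M)
  let ?E = "\<Oplus>\<^bsub>B\<^esub>i\<in>UNIV. \<Oplus>\<^bsub>B\<^esub>j\<in>UNIV. (- \<mu> i (J i) j) \<odot>\<^bsub>B\<^esub> P u' (J(i := j)) u"
  note h = ring_hom_onD[OF hom subring_on_UNIV]
  have Pc: "P u' J u \<in> carrier B" "P (L' u') J u \<in> carrier B" "P u' J (L u) \<in> carrier B"
    using semilinearD(1)[OF first] semilinearD(1)[OF last] c by auto
  have z: "r s \<odot>\<^bsub>B\<^esub> P u' J u \<oplus>\<^bsub>B\<^esub> r (- s) \<odot>\<^bsub>B\<^esub> P u' J u = \<zero>\<^bsub>B\<^esub>"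
    using B.scale_add_left[of "r s" "r (- s)" "P u' J u"] Pc h(4)[of s "- s"] h by simp
  have rc: "r s \<odot>\<^bsub>B\<^esub> P u' J u \<in> carrier B" "r (- s) \<odot>\<^bsub>B\<^esub> P u' J u \<in> carrier B"
    using Pc h by (auto intro!: B.scale_closed)
  have "loop_sum B P K' \<mu> K u' J u = (P (L' u') J u \<oplus>\<^bsub>B\<^esub> r s \<odot>\<^bsub>B\<^esub> P u' J u) \<oplus>\<^bsub>B\<^esub> ?E \<oplus>\<^bsub>B\<^esub>
      (P u' J (L u) \<oplus>\<^bsub>B\<^esub> r (- s) \<odot>\<^bsub>B\<^esub> P u' J u)"
    using c by (simp add: loop_sum_def L semilinearD[OF first] semilinearD[OF last])
  also have "\<dots> = P (L' u') J u \<oplus>\<^bsub>B\<^esub> ?E \<oplus>\<^bsub>B\<^esub> P u' J (L u) \<oplus>\<^bsub>B\<^esub>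
      (r s \<odot>\<^bsub>B\<^esub> P u' J u \<oplus>\<^bsub>B\<^esub> r (- s) \<odot>\<^bsub>B\<^esub> P u' J u)"
    using Pc rc mid by (simp add: B.M.a_ac)
  finally show ?thesis using Pc mid by (simp add: z loop_sum_def)
qed

section \<open>Action of \<open>W\<close> on basis tensors\<close>

context tensor_ring
begin

text \<open>The product of the eigenvalues in \<open>dual_geps\<close>: the scalar by which the
  diagonal part of \<open>w\<close> acts on \<open>e_J\<close>.\<close>

definition W_weight :: "(nat \<Rightarrow> nat) \<Rightarrow> 'n wreath \<Rightarrow> ('n::finite \<Rightarrow> 'm::{finite,linorder}) \<Rightarrow> complex" where
  "W_weight \<nu> w J = (\<Prod>i\<in>UNIV. inverse \<epsilon> ^ (block \<nu> (J i) * snd w i))"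

lemma W_T_basis:
  fixes w :: "'n::{finite,linorder} wreath"
  assumes "bij (fst w)"
  shows "semilinear UNIV id (T_mod M' M :: (complex, ('a, 'n, 'm::{finite,linorder}, 'b) tens) module)
      (T_mod M' M) (W_T (geps \<nu> \<epsilon>) M' M w)"
    and "u' \<in> carrier M' \<Longrightarrow> u \<in> carrier M \<Longrightarrow>
      W_T (geps \<nu> \<epsilon>) M' M w (T_pure M' M u' (\<lambda>i. axis (J i) 1) u) =
      W_weight \<nu> w J \<odot>\<^bsub>T_mod M' M\<^esub>
        (T_pure M' M u' (\<lambda>i. axis ((J \<circ> inv_into UNIV (fst w)) i) 1) u :: ('a, 'n, 'm, 'b) tens)"
proof -
  let ?\<sigma> = "fst w" and ?d = "snd w"
  define A where "A i = dual_grp (geps \<nu> \<epsilon> :: (complex, 'm) sqmat) ^^ ?d i" for i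
  define F where "F v j = A (inv_into UNIV ?\<sigma> j) (v (inv_into UNIV ?\<sigma> j))" for v j
  have A: "A i (c *s x + y) = c *s A i x + A i y" for i c x y
    by (simp add: vec_eq_iff A_def dual_geps[OF eps_neq_0] algebra_simps)
  \<comment> \<open>The vector from place \<open>i\<close> lands at place \<open>\<sigma> i\<close>,
    so \<open>F\<close> turns a linear combination at one place into a linear combination at one
    place, and the tensor relations are respected.\<close>
  have F: "F (v(i := z)) = (F v)(?\<sigma> i := A i z)" for v i z
    using assms by (auto simp: F_def fun_eq_iff bij_is_inj bij_is_surj surj_f_inv_f)
  have eq: "W_T (geps \<nu> \<epsilon>) M' M w = presented_lift id (T_mod M' M) (\<lambda>(u', v, u). T_pure M' M u' (F v) u)"
    by (simp add: W_T_def F_def[abs_def] A_def Let_def)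
  note L = T_lift[OF smod_T ring_hom_on_id, where \<phi> = "\<lambda>(u', v, u). T_pure M' M u' (F v) u", folded eq]
  show "semilinear UNIV id (T_mod M' M :: (complex, ('a, 'n, 'm, 'b) tens) module)
      (T_mod M' M) (W_T (geps \<nu> \<epsilon>) M' M w)"
    by (rule L) (simp_all add: T_pure_first T_pure_last F A T_pure_mid del: fun_upd_apply)
  assume u: "u' \<in> carrier M'" "u \<in> carrier M"
  have "W_T (geps \<nu> \<epsilon>) M' M w (T_pure M' M u' (\<lambda>i. axis (J i) 1) u) =
      (T_pure M' M u' (F (\<lambda>i. axis (J i) 1)) u :: ('a, 'n, 'm, 'b) tens)"
    by (subst L(2)) (use u in \<open>simp_all add: T_pure_first T_pure_last F A T_pure_mid del: fun_upd_apply\<close>)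
  also have "F (\<lambda>i. axis (J i) 1) = (\<lambda>j. inverse \<epsilon> ^ (block \<nu> (J (inv_into UNIV ?\<sigma> j)) * ?d (inv_into UNIV ?\<sigma> j)) *s
      axis ((J \<circ> inv_into UNIV ?\<sigma>) j) 1)"
    by (auto simp: fun_eq_iff vec_eq_iff F_def A_def dual_geps[OF eps_neq_0] axis_def)
  also have "T_pure M' M u' \<dots> u = (\<Prod>j\<in>UNIV. inverse \<epsilon> ^ (block \<nu> (J (inv_into UNIV ?\<sigma> j)) * ?d (inv_into UNIV ?\<sigma> j))) \<odot>\<^bsub>T_mod M' M\<^esub>
      (T_pure M' M u' (\<lambda>i. axis ((J \<circ> inv_into UNIV ?\<sigma>) i) 1) u :: ('a, 'n, 'm, 'b) tens)"
    by (rule T_pure_scale_all[OF u])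
  also have "(\<Prod>j\<in>UNIV. inverse \<epsilon> ^ (block \<nu> (J (inv_into UNIV ?\<sigma> j)) * ?d (inv_into UNIV ?\<sigma> j))) = W_weight \<nu> w J"
    unfolding W_weight_def
    by (rule prod.reindex_bij_betw[OF bij_imp_bij_inv[OF assms]])
  finally show "W_T (geps \<nu> \<epsilon>) M' M w (T_pure M' M u' (\<lambda>i. axis (J i) 1) u) =
      W_weight \<nu> w J \<odot>\<^bsub>T_mod M' M\<^esub>
        (T_pure M' M u' (\<lambda>i. axis ((J \<circ> inv_into UNIV ?\<sigma>) i) 1) u :: ('a, 'n, 'm, 'b) tens)" .
qed

lemma W_TR_basis:
  fixes w :: "'n::{finite,linorder} wreath"
  assumes w: "bij (fst w)"
  shows "semilinear (Rloc \<epsilon> l) (W_ring \<epsilon> w)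
      (TR_mod \<epsilon> l M' M :: ('n ratf, ('a, 'n, 'm::{finite,linorder}, 'b) tensR) module)
      (TR_mod \<epsilon> l M' M) (W_TR \<epsilon> l (geps \<nu> \<epsilon>) M' M w)"
    and "u' \<in> carrier M' \<Longrightarrow> u \<in> carrier M \<Longrightarrow>
      W_TR \<epsilon> l (geps \<nu> \<epsilon>) M' M w (TR_basis \<epsilon> l M' M u' J u) =
      rconst (W_weight \<nu> w J) \<odot>\<^bsub>TR_mod \<epsilon> l M' M\<^esub>
        (TR_basis \<epsilon> l M' M u' (J \<circ> inv_into UNIV (fst w)) u :: ('a, 'n, 'm, 'b) tensR)"
proof -
  let ?TR = "TR_mod \<epsilon> l M' M :: ('n ratf, ('a, 'n, 'm, 'b) tensR) module"
  let ?W = "W_T (geps \<nu> \<epsilon>) M' M w :: _ \<Rightarrow> ('a, 'n, 'm, 'b) tens"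
  interpret TR: smod "Rloc \<epsilon> l" ?TR by (rule smod_TR)
  note W = W_ring_hom[OF eps_neq_0 w] and Wh = W_ring_hom_on[OF w]
  note WT = W_T_basis[OF w, where \<nu> = \<nu>]
  have "semilinear UNIV (rconst \<circ> id) (T_mod M' M) ?TR ((\<lambda>t. TR_tensor \<epsilon> l M' M t 1) \<circ> ?W)"
    by (rule semilinear_comp[OF WT(1) semilinear_TR_tensor ring_hom_on_id])
  then have \<psi>: "semilinear UNIV (W_ring \<epsilon> w \<circ> rconst) (T_mod M' M) ?TR (\<lambda>t. TR_tensor \<epsilon> l M' M (?W t) 1)"
    by (simp add: comp_def W)
  have "TR_tensor \<epsilon> l M' M (?W t) (W_ring \<epsilon> w f) = W_ring \<epsilon> w f \<odot>\<^bsub>?TR\<^esub> TR_tensor \<epsilon> l M' M (?W t) 1"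
    if "t \<in> carrier (T_mod M' M)" "f \<in> Rloc \<epsilon> l" for t f
    by (rule TR_tensor_eq_scale[OF semilinearD(1)[OF WT(1) that(1)] ring_hom_onD(1)[OF Wh subring_Rloc that(2)]])
  then have \<phi>: "(case (t, f) of (t, f) \<Rightarrow> TR_tensor \<epsilon> l M' M (?W t) (W_ring \<epsilon> w f)) =
      W_ring \<epsilon> w f \<odot>\<^bsub>?TR\<^esub> TR_tensor \<epsilon> l M' M (?W t) 1"
    if "t \<in> carrier (T_mod M' M)" "f \<in> Rloc \<epsilon> l" for t f using that by simp
  note L = TR_lift[OF smod_TR Wh \<psi> \<phi>, folded W_TR_def]
  show "semilinear (Rloc \<epsilon> l) (W_ring \<epsilon> w) ?TR ?TR (W_TR \<epsilon> l (geps \<nu> \<epsilon>) M' M w)"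
    by (rule L; assumption)
  assume u: "u' \<in> carrier M'" "u \<in> carrier M"
  let ?p = "\<lambda>J. T_pure M' M u' (\<lambda>i. axis (J i) 1) u :: ('a, 'n, 'm, 'b) tens"
  have pc: "?p J \<in> carrier (T_mod M' M)" for J using u by (rule T_pure_closed)
  have "W_TR \<epsilon> l (geps \<nu> \<epsilon>) M' M w (TR_basis \<epsilon> l M' M u' J u) = W_ring \<epsilon> w 1 \<odot>\<^bsub>?TR\<^esub> TR_tensor \<epsilon> l M' M (?W (?p J)) 1"
    unfolding TR_basis_def by (rule L(2)[OF _ _ pc Rloc_closed(2)]; assumption)
  also have "\<dots> = TR_tensor \<epsilon> l M' M (?W (?p J)) 1"
    using semilinearD(1)[OF \<psi> pc] field_hom.hom_simps(2)[OF W(1)] by simp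
  also have "\<dots> = rconst (W_weight \<nu> w J) \<odot>\<^bsub>?TR\<^esub> TR_basis \<epsilon> l M' M u' (J \<circ> inv_into UNIV (fst w)) u"
    unfolding WT(2)[OF u] TR_basis_def by (rule semilinearD(3)[OF semilinear_TR_tensor UNIV_I pc])
  finally show "W_TR \<epsilon> l (geps \<nu> \<epsilon>) M' M w (TR_basis \<epsilon> l M' M u' J u) =
      rconst (W_weight \<nu> w J) \<odot>\<^bsub>?TR\<^esub> TR_basis \<epsilon> l M' M u' (J \<circ> inv_into UNIV (fst w)) u" .
qed

lemma W_weight_update:
  fixes w :: "'n::{finite,linorder} wreath"
  shows "W_weight \<nu> w (J(i := j)) = W_weight \<nu> w J * inverse \<epsilon> powi (bdeg \<nu> (J i) j * int (snd w i))"
proof -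
  let ?R = "\<Prod>k\<in>UNIV - {i}. inverse \<epsilon> ^ (block \<nu> (J k) * snd w k)"
  let ?e = "inverse \<epsilon>"
  have e: "?e \<noteq> 0" using eps_neq_0 by simp
  have r: "W_weight \<nu> w (J(i := k)) = ?e powi (int (block \<nu> k) * int (snd w i)) * ?R" for k
    unfolding W_weight_def by (subst prod.remove[of _ i]) (simp_all flip: of_nat_mult)
  have "W_weight \<nu> w J = ?e powi (int (block \<nu> (J i)) * int (snd w i)) * ?R"
    using r[of "J i"] by simp
  moreover have "?e powi (int (block \<nu> j) * int (snd w i)) =
      ?e powi (int (block \<nu> (J i)) * int (snd w i)) * ?e powi (bdeg \<nu> (J i) j * int (snd w i))"
    using e by (simp add: bdeg_def left_diff_distrib flip: power_int_add)
  ultimately show ?thesis by (simp add: r)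
qed

text \<open>With \<open>d = snd w i\<close>, a coefficient in degree \<open>a\<close> at an entry of
  degree \<open>b\<close> picks up \<open>\<epsilon>^(-d a)\<close> from the substitution and
  \<open>\<epsilon>^(-d b)\<close> from the weights. For a fixed loop \<open>l\<close> divides
  \<open>a + b\<close>, so the product is \<open>1\<close>.\<close>

lemma W_ring_loop_coeff:
  fixes w :: "'n::{finite,linorder} wreath"
  assumes w: "bij (fst w)" and X: "X \<in> graded_loops \<nu> l (- 1)"
  shows "W_ring \<epsilon> w (loop_coeff X i k j) * rconst (inverse \<epsilon> powi (bdeg \<nu> k j * int (snd w i))) =
    loop_coeff X (fst w i) k j"
proof -
  note W = W_ring_hom[OF eps_neq_0 w]
  interpret W: field_hom "W_ring \<epsilon> w" by (rule W)
  let ?X = "Poly_Mapping.lookup X"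
  have "rconst (?X a $ k $ j) * (rconst (inverse \<epsilon> ^ snd w i) * xvar (fst w i)) powi a *
      rconst (inverse \<epsilon> powi (bdeg \<nu> k j * int (snd w i))) =
    rconst (?X a $ k $ j) * xvar (fst w i) powi a" for a
  proof (cases "?X a $ k $ j = 0")
    case False
    then obtain q where q: "a + bdeg \<nu> k j = int l * q" using X by (fastforce simp: graded_loops_def)
    have e: "inverse \<epsilon> \<noteq> 0" using eps_neq_0 by simp
    have "(inverse \<epsilon> ^ snd w i) powi a * inverse \<epsilon> powi (bdeg \<nu> k j * int (snd w i)) =
        inverse \<epsilon> powi (int (snd w i) * a + bdeg \<nu> k j * int (snd w i))"
      using e by (simp only: power_int_add power_int_mult power_int_of_nat simp_thms)
    also have "int (snd w i) * a + bdeg \<nu> k j * int (snd w i) = int l * (q * int (snd w i))"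
      using q by (simp add: algebra_simps flip: distrib_left) (metis distrib_left mult.commute mult.left_commute)
    also have "inverse \<epsilon> powi (int l * (q * int (snd w i))) = 1"
      by (simp add: power_int_mult power_inverse eps_power_l)
    finally have "rconst ((inverse \<epsilon> ^ snd w i) powi a * inverse \<epsilon> powi (bdeg \<nu> k j * int (snd w i))) = (1 :: 'n ratf)"
      by simp
    then have "rconst (inverse \<epsilon> ^ snd w i) powi a * rconst (inverse \<epsilon> powi (bdeg \<nu> k j * int (snd w i))) = (1 :: 'n ratf)"
      by (simp only: rconst_hom rconst_powi)
    then show ?thesis by (simp add: power_int_mult_distrib mult_ac)
  qed simp
  note summand = this
  have "W_ring \<epsilon> w (loop_coeff X i k j) * rconst (inverse \<epsilon> powi (bdeg \<nu> k j * int (snd w i))) =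
      (\<Sum>a\<in>Poly_Mapping.keys X. rconst (?X a $ k $ j) * (rconst (inverse \<epsilon> ^ snd w i) * xvar (fst w i)) powi a *
        rconst (inverse \<epsilon> powi (bdeg \<nu> k j * int (snd w i))))"
    by (simp add: loop_coeff_def W.hom_sum W sum_distrib_right)
  also have "\<dots> = loop_coeff X (fst w i) k j"
    unfolding loop_coeff_def by (rule sum.cong[OF refl summand])
  finally show ?thesis .
qed

end

text \<open>Instantiated at \<open>(\<epsilon>, l)\<close> with the given actions and at
  \<open>(1, 1)\<close> with the transported ones. The assumptions provide the linearity asked for
  by \<open>loop_act_basis\<close>.\<close>

locale coinv_data = tensor_ring M' M \<epsilon> l
  for M' :: "(complex, 'a) module" and M :: "(complex, 'b) module" and \<epsilon> :: complex and l :: nat +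
  fixes \<nu> :: "nat \<Rightarrow> nat"
    and \<rho>' :: "'m::{finite,linorder} affine \<Rightarrow> 'a \<Rightarrow> 'a" and \<rho> :: "'m affine \<Rightarrow> 'b \<Rightarrow> 'b"
  assumes \<rho>': "\<And>X a. X \<in> graded_loops \<nu> l (- 1) \<Longrightarrow>
      semilinear UNIV id M' M' (\<rho>' (laff (Poly_Mapping.lookup X a) a))"
    and \<rho>: "\<And>X a. X \<in> graded_loops \<nu> l (- 1) \<Longrightarrow>
      semilinear UNIV id M M (\<rho> (sharp (Poly_Mapping.lookup X a) a))"
begin

abbreviation "TR \<equiv> TR_mod \<epsilon> l M' M :: ('n::{finite,linorder} ratf, ('a, 'n, 'm, 'b) tensR) module"
abbreviation "bas \<equiv> TR_basis \<epsilon> l M' M :: 'a \<Rightarrow> ('n::{finite,linorder} \<Rightarrow> 'm) \<Rightarrow> 'b \<Rightarrow> ('a, 'n, 'm, 'b) tensR"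
abbreviation "kern \<equiv> coinv_kernel \<epsilon> l (geps \<nu> \<epsilon>) M' \<rho>' M \<rho> :: ('a, 'n::{finite,linorder}, 'm, 'b) tensR set"
abbreviation "Co \<equiv> coinv \<epsilon> l (geps \<nu> \<epsilon>) M' \<rho>' M \<rho> ::
  ('n::{finite,linorder} ratf, ('a, 'n, 'm, 'b) tensR set) module"
abbreviation "proj \<equiv> coinv_proj \<epsilon> l (geps \<nu> \<epsilon>) M' \<rho>' M \<rho> ::
  ('a, 'n::{finite,linorder}, 'm, 'b) tensR \<Rightarrow> _"

definition left_op :: "'m loop \<Rightarrow> 'a \<Rightarrow> 'a" where
  "left_op X u' = (\<Oplus>\<^bsub>M'\<^esub>a\<in>Poly_Mapping.keys X. \<rho>' (laff (Poly_Mapping.lookup X a) a) u')"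

definition right_op :: "'m loop \<Rightarrow> 'b \<Rightarrow> 'b" where
  "right_op X u = (\<Oplus>\<^bsub>M\<^esub>a\<in>Poly_Mapping.keys X. \<rho> (sharp (Poly_Mapping.lookup X a) a) u)"

abbreviation rel where
  "rel X u' J u \<equiv> loop_sum TR bas (left_op X) (loop_coeff X) (right_op X) u' J u"

lemma op_closed:
  assumes "X \<in> graded_loops \<nu> l (- 1)"
  shows "u' \<in> carrier M' \<Longrightarrow> left_op X u' \<in> carrier M'" "u \<in> carrier M \<Longrightarrow> right_op X u \<in> carrier M"
  unfolding left_op_def right_op_def
  using semilinearD(1)[OF \<rho>'[OF assms]] semilinearD(1)[OF \<rho>[OF assms]]
  by (auto intro!: M'.M.finsum_closed M.M.finsum_closed)

lemma loop_act_rel: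
  assumes "X \<in> graded_loops \<nu> l (- 1)"
  shows "semilinear (Rloc \<epsilon> l) id TR TR (loop_act \<epsilon> l M' \<rho>' M \<rho> X)"
    and "u' \<in> carrier M' \<Longrightarrow> u \<in> carrier M \<Longrightarrow> loop_act \<epsilon> l M' \<rho>' M \<rho> X (bas u' J u) = rel X u' J u"
  unfolding left_op_def[abs_def] right_op_def[abs_def]
  by (rule loop_act_basis; (rule \<rho>'[OF assms] \<rho>[OF assms])?; assumption?)+

definition kernel_gens :: "('a, 'n::{finite,linorder}, 'm, 'b) tensR set" where
  "kernel_gens = {loop_act \<epsilon> l M' \<rho>' M \<rho> X t |X t. X \<in> graded_loops \<nu> l (- 1) \<and> t \<in> carrier TR}"

lemma kernel_gens_closed: "kernel_gens \<subseteq> carrier TR"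
  using semilinearD(1)[OF loop_act_rel(1)] by (auto simp: kernel_gens_def)

lemma kern_eq: "kern = submodule_span (ring_on (Rloc \<epsilon> l)) TR kernel_gens"
  by (simp add: coinv_kernel_def kernel_gens_def loop_fixed_inverse_eps)

lemma kern_submod: "submod (Rloc \<epsilon> l) TR kern"
  unfolding kern_eq
  by (intro submod.intro submod_axioms.intro smod_TR smod.span_submod[OF smod_TR] kernel_gens_closed)

lemma rel_in_kern:
  assumes "X \<in> graded_loops \<nu> l (- 1)" "u' \<in> carrier M'" "u \<in> carrier M"
  shows "rel X u' J u \<in> kern"
proof -
  have "rel X u' J u \<in> kernel_gens"
    unfolding kernel_gens_def
    using assms by (auto intro!: exI[of _ X] exI[of _ "bas u' J u"] simp: loop_act_rel(2))
  then show ?thesis using smod.span_submod(2)[OF smod_TR kernel_gens_closed] by (auto simp: kern_eq)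
qed

text \<open>Two generation arguments are combined: the kernel is spanned by the
  \<open>loop_act\<close> images of all \<open>t\<close>, and for fixed \<open>X\<close> the element
  \<open>t\<close> runs over the span of the basis tensors. What remains to be checked is one
  explicit relation for each \<open>X\<close> and each basis tensor.\<close>

lemma kern_into_submod:
  fixes f :: "('a, 'n::{finite,linorder}, 'm, 'b) tensR \<Rightarrow> 'y"
  assumes B: "smod S' B" and hom: "ring_hom_on (Rloc \<epsilon> l) S' \<tau>" and f: "semilinear (Rloc \<epsilon> l) \<tau> TR B f"
    and H: "submodule H (ring_on S') B"
    and rel: "\<And>X u' J u. X \<in> graded_loops \<nu> l (- 1) \<Longrightarrow> u' \<in> carrier M' \<Longrightarrow> u \<in> carrier M \<Longrightarrow> f (rel X u' J u) \<in> H"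
    and x: "x \<in> kern"
  shows "f x \<in> H"
proof (rule semilinear_into_submod[OF smod_TR B hom f H kernel_gens_closed])
  show "x \<in> submodule_span (ring_on (Rloc \<epsilon> l)) TR kernel_gens" using x by (simp add: kern_eq)
  fix y :: "('a, 'n, 'm, 'b) tensR" assume "y \<in> kernel_gens"
  then obtain X t where y: "y = loop_act \<epsilon> l M' \<rho>' M \<rho> X t" "X \<in> graded_loops \<nu> l (- 1)" "t \<in> carrier TR"
    by (auto simp: kernel_gens_def)
  have "semilinear (Rloc \<epsilon> l) (\<tau> \<circ> id) TR B (f \<circ> loop_act \<epsilon> l M' \<rho>' M \<rho> X)"
    by (rule semilinear_comp[OF loop_act_rel(1)[OF y(2)] f ring_hom_on_id])
  then have "semilinear (Rloc \<epsilon> l) \<tau> TR B (f \<circ> loop_act \<epsilon> l M' \<rho>' M \<rho> X)" by (simp add: comp_def)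
  then have "(f \<circ> loop_act \<epsilon> l M' \<rho>' M \<rho> X) t \<in> H"
    by (rule TR_into_submod[OF B hom _ H _ y(3)]) (simp add: loop_act_rel(2)[OF y(2)] rel[OF y(2)])
  then show "f y \<in> H" by (simp add: y(1))
qed

lemma kern_zero:
  fixes f :: "('a, 'n::{finite,linorder}, 'm, 'b) tensR \<Rightarrow> 'y"
  assumes B: "smod S' B" and hom: "ring_hom_on (Rloc \<epsilon> l) S' \<tau>" and f: "semilinear (Rloc \<epsilon> l) \<tau> TR B f"
    and rel: "\<And>X u' J u. X \<in> graded_loops \<nu> l (- 1) \<Longrightarrow> u' \<in> carrier M' \<Longrightarrow> u \<in> carrier M \<Longrightarrow>
      f (rel X u' J u) = \<zero>\<^bsub>B\<^esub>"
    and x: "x \<in> kern"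
  shows "f x = \<zero>\<^bsub>B\<^esub>"
proof -
  interpret B: smod S' B by (rule B)
  have "submodule {\<zero>\<^bsub>B\<^esub>} (ring_on S') B" by (rule B.submodI) auto
  from kern_into_submod[OF B hom f this _ x] rel show ?thesis by blast
qed

lemma smod_Co: "smod (Rloc \<epsilon> l) Co"
  unfolding coinv_def by (rule submod.smod_quot[OF kern_submod])

lemma semilinear_proj: "semilinear (Rloc \<epsilon> l) id TR Co proj"
  unfolding coinv_def coinv_proj_def[abs_def] by (rule submod.semilinear_coset[OF kern_submod])

lemma proj_kern: "x \<in> kern \<Longrightarrow> proj x = \<zero>\<^bsub>Co\<^esub>"
  unfolding coinv_def coinv_proj_def by (rule submod.coset_eq_zero[OF kern_submod])

lemma Co_carrier: "carrier Co = proj ` carrier TR"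
  unfolding coinv_def coinv_proj_def by (rule submod.quot_carrier[OF kern_submod])

lemma Co_lift:
  assumes "smod S' B" "semilinear (Rloc \<epsilon> l) \<tau> TR B f" "ring_hom_on (Rloc \<epsilon> l) S' \<tau>"
    and "\<And>x. x \<in> kern \<Longrightarrow> f x = \<zero>\<^bsub>B\<^esub>"
  obtains h where "semilinear (Rloc \<epsilon> l) \<tau> Co B h" "\<And>x. x \<in> carrier TR \<Longrightarrow> h (proj x) = f x"
  using submod.coset_lift[OF kern_submod assms] unfolding coinv_def coinv_proj_def by metis

definition Co_basis :: "('a, 'n::{finite,linorder}, 'm, 'b) tensR set set" where
  "Co_basis = proj ` TR_basis_set"

lemma Co_basis_closed: "Co_basis \<subseteq> carrier Co"
  unfolding Co_basis_def Co_carrier using TR_basis_set_closed by (rule image_mono)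

lemma Co_span: "submodule_span (ring_on (Rloc \<epsilon> l)) Co Co_basis = carrier Co"
  using submod.quot_span[OF kern_submod TR_span TR_basis_set_closed]
  by (simp add: Co_basis_def coinv_def coinv_proj_def[abs_def])

text \<open>Up to the weight, \<open>w\<close> takes the relation of \<open>X\<close> at
  \<open>J\<close> to the relation of the same \<open>X\<close> at the permuted \<open>J\<close>,
  because the roots of unity cancel by \<open>W_ring_loop_coeff\<close>.\<close>

lemma W_TR_kern:
  fixes w :: "'n::{finite,linorder} wreath"
  assumes w: "bij (fst w)" and x: "x \<in> kern"
  shows "W_TR \<epsilon> l (geps \<nu> \<epsilon>) M' M w x \<in> kern"
proof -
  interpret N: submod "Rloc \<epsilon> l" "TR :: ('n ratf, _) module" kern by (rule kern_submod)
  note WTR = W_TR_basis[OF w, where \<nu> = \<nu>]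
  note Wh = W_ring_hom_on[OF w]
  interpret W: field_hom "W_ring \<epsilon> w" by (rule W_ring_hom[OF eps_neq_0 w])
  show ?thesis
  proof (rule kern_into_submod[OF smod_TR Wh WTR(1) N.B _ x])
    fix X :: "'m loop" and u' u and J :: "'n \<Rightarrow> 'm"
    assume X: "X \<in> graded_loops \<nu> l (- 1)" and u: "u' \<in> carrier M'" "u \<in> carrier M"
    note c = op_closed[OF X]
    note coeff = loop_coeff_closed[of X]
    let ?P = "\<lambda>u' J u. rconst (W_weight \<nu> w J) \<odot>\<^bsub>TR\<^esub> bas u' (J \<circ> inv_into UNIV (fst w)) u"
    have "W_TR \<epsilon> l (geps \<nu> \<epsilon>) M' M w (rel X u' J u) =
      loop_sum TR ?P (left_op X) (\<lambda>i k j. - W_ring \<epsilon> w (- loop_coeff X i k j)) (right_op X) u' J u"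
      by (rule loop_sum_image[OF smod_TR Wh WTR(1)])
        (rule c(1)[OF u(1)] c(2)[OF u(2)] coeff u | rule WTR(2); assumption)+
    also have "\<dots> = rconst (W_weight \<nu> w J) \<odot>\<^bsub>TR\<^esub> rel X u' (J \<circ> inv_into UNIV (fst w)) u"
    proof (rule loop_sum_twist[where U' = "carrier M'" and U = "carrier M" and \<sigma> = "fst w"
          and w = "\<lambda>J. rconst (W_weight \<nu> w J)", OF smod_TR w])
      show "left_op X u' \<in> carrier M'" "right_op X u \<in> carrier M" "u' \<in> carrier M'" "u \<in> carrier M"
        using c u by auto
      show "- (- W_ring \<epsilon> w (- loop_coeff X i k j)) \<in> Rloc \<epsilon> l" for i k j
        using ring_hom_onD(1)[OF Wh subring_Rloc coeff] by simp
      show "- W_ring \<epsilon> w (- loop_coeff X i (J i) j) * rconst (W_weight \<nu> w (J(i := j))) =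
          rconst (W_weight \<nu> w J) * loop_coeff X (fst w i) (J i) j" for J i j
        by (simp add: W_weight_update mult_ac flip: W_ring_loop_coeff[OF w X])
    qed (use coeff in auto)
    also have "\<dots> \<in> kern"
      by (intro N.B_closed(4) rconst_in_Rloc rel_in_kern X u)
    finally show "W_TR \<epsilon> l (geps \<nu> \<epsilon>) M' M w (rel X u' J u) \<in> kern" .
  qed
qed

lemma W_Co:
  fixes w :: "'n::{finite,linorder} wreath"
  assumes w: "bij (fst w)"
  shows "semilinear (Rloc \<epsilon> l) (W_ring \<epsilon> w) Co Co (W_coinv \<epsilon> l (geps \<nu> \<epsilon>) M' \<rho>' M \<rho> w)"
    and "x \<in> carrier TR \<Longrightarrow>
      W_coinv \<epsilon> l (geps \<nu> \<epsilon>) M' \<rho>' M \<rho> w (proj x) = proj (W_TR \<epsilon> l (geps \<nu> \<epsilon>) M' M w x)"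
  unfolding W_coinv_def coinv_def coinv_proj_def
  by (rule submod.semilinear_quot_map[OF kern_submod W_TR_basis(1)[OF w] W_ring_hom_on[OF w] W_TR_kern[OF w]];
      assumption)+

end

section \<open>The comparison map\<close>

text \<open>The two shift assumptions are all that the comparison retains of \<open>kappa\<close>
  and \<open>kappa'\<close>: an untwisted loop acts on the outer factors like its regrading, up to
  opposite scalars at the two ends.\<close>

locale comparison =
  A: coinv_data M' M \<epsilon> l \<nu> \<rho>' \<rho> + O: coinv_data M' M 1 1 \<nu> \<rho>1' \<rho>1
  for M' :: "(complex, 'a) module" and M :: "(complex, 'b) module" and \<epsilon> :: complex and l :: nat
    and \<nu> :: "nat \<Rightarrow> nat"
    and \<rho>' :: "'m::{finite,linorder} affine \<Rightarrow> 'a \<Rightarrow> 'a" and \<rho> :: "'m affine \<Rightarrow> 'b \<Rightarrow> 'b"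
    and \<rho>1' :: "'m affine \<Rightarrow> 'a \<Rightarrow> 'a" and \<rho>1 :: "'m affine \<Rightarrow> 'b \<Rightarrow> 'b" +
  fixes s :: "'m loop \<Rightarrow> complex"
  assumes \<nu>: "(\<Sum>p=1..l. \<nu> p) = CARD('m)"
    and left_shift: "\<And>Y u'. u' \<in> carrier M' \<Longrightarrow>
      O.left_op Y u' = A.left_op (up \<nu> l (\<lambda>_. 1) (- 1) Y) u' \<oplus>\<^bsub>M'\<^esub> s Y \<odot>\<^bsub>M'\<^esub> u'"
    and right_shift: "\<And>Y u. u \<in> carrier M \<Longrightarrow>
      O.right_op Y u = A.right_op (up \<nu> l (\<lambda>_. 1) (- 1) Y) u \<oplus>\<^bsub>M\<^esub> (- s Y) \<odot>\<^bsub>M\<^esub> u"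
begin

abbreviation "TE \<equiv> TE_mod \<epsilon> l M' M ::
  ('n::{finite,linorder} ratf, (('a, 'n, 'm, 'b) tensR \<times> 'n ratf \<Rightarrow>\<^sub>0 'n ratf) set) module"
abbreviation "te \<equiv> TE_tensor \<epsilon> l M' M ::
  ('a, 'n::{finite,linorder}, 'm, 'b) tensR \<Rightarrow> 'n ratf \<Rightarrow> _"
abbreviation "CE \<equiv> CE_mod \<epsilon> l M' \<rho>1' M \<rho>1 ::
  ('n::{finite,linorder} ratf, (('a, 'n, 'm, 'b) tensR set \<times> 'n ratf \<Rightarrow>\<^sub>0 'n ratf) set) module"
abbreviation "ce \<equiv> CE_tensor \<epsilon> l M' \<rho>1' M \<rho>1 ::
  ('a, 'n::{finite,linorder}, 'm, 'b) tensR set \<Rightarrow> 'n ratf \<Rightarrow> _"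

lemma TE_extension:
  "scalar_extension (Rloc 1 1) (O.TR :: ('n::{finite,linorder} ratf, _) module) (emb l) (Rloc \<epsilon> l)"
  by (intro scalar_extension.intro scalar_extension_axioms.intro O.smod_TR A.subring_Rloc A.emb_hom_on)

lemma CE_extension:
  "scalar_extension (Rloc 1 1) (O.Co :: ('n::{finite,linorder} ratf, _) module) (emb l) (Rloc \<epsilon> l)"
  by (intro scalar_extension.intro scalar_extension_axioms.intro O.smod_Co A.subring_Rloc A.emb_hom_on)

lemma CE_eq: "CE = base_change (Rloc 1 1) (emb l) O.Co (Rloc \<epsilon> l)"
  "ce = bc_tensor (Rloc 1 1) (emb l) O.Co (Rloc \<epsilon> l)"
  by (simp_all add: CE_mod_def CE_tensor_def[abs_def] geps_one)

lemma smod_TE: "smod (Rloc \<epsilon> l) TE"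
  unfolding TE_mod_def by (rule scalar_extension.smod_base_change[OF TE_extension])

lemma smod_CE: "smod (Rloc \<epsilon> l) CE"
  unfolding CE_eq by (rule scalar_extension.smod_base_change[OF CE_extension])

lemma te_closed: "t \<in> carrier O.TR \<Longrightarrow> f \<in> Rloc \<epsilon> l \<Longrightarrow> te t f \<in> carrier TE"
  unfolding TE_mod_def TE_tensor_def by (rule scalar_extension.tensor_closed[OF TE_extension])

lemma te_scale: "t \<in> carrier O.TR \<Longrightarrow> f \<in> Rloc \<epsilon> l \<Longrightarrow> te t f = f \<odot>\<^bsub>TE\<^esub> te t 1"
  unfolding TE_mod_def TE_tensor_def by (rule scalar_extension.tensor_eq_scale[OF TE_extension])

lemma ce_scale: "c \<in> carrier O.Co \<Longrightarrow> f \<in> Rloc \<epsilon> l \<Longrightarrow> ce c f = f \<odot>\<^bsub>CE\<^esub> ce c 1"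
  unfolding CE_eq by (rule scalar_extension.tensor_eq_scale[OF CE_extension])

lemma semilinear_te: "semilinear (Rloc 1 1) (emb l) O.TR TE (\<lambda>t. te t 1)"
  unfolding TE_mod_def TE_tensor_def by (rule scalar_extension.semilinear_tensor[OF TE_extension])

lemma semilinear_ce: "semilinear (Rloc 1 1) (emb l) O.Co CE (\<lambda>c. ce c 1)"
  unfolding CE_eq by (rule scalar_extension.semilinear_tensor[OF CE_extension])

definition CE_basis :: "(('a, 'n::{finite,linorder}, 'm, 'b) tensR set \<times> 'n ratf \<Rightarrow>\<^sub>0 'n ratf) set set" where
  "CE_basis = (\<lambda>c. ce c 1) ` O.Co_basis"

lemma CE_basis_closed: "CE_basis \<subseteq> carrier CE"
  using O.Co_basis_closed semilinearD(1)[OF semilinear_ce] by (auto simp: CE_basis_def)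

lemma CE_span: "submodule_span (ring_on (Rloc \<epsilon> l)) CE CE_basis = carrier CE"
  unfolding CE_basis_def CE_eq
  by (rule scalar_extension.bc_span[OF CE_extension O.Co_span O.Co_basis_closed])

lemma emb_rconst: "emb l \<circ> rconst = (rconst :: complex \<Rightarrow> 'n::{finite,linorder} ratf)"
  by (auto simp: emb_hom[OF A.l])

definition Q :: "'a \<Rightarrow> ('n::{finite,linorder} \<Rightarrow> 'm) \<Rightarrow> 'b \<Rightarrow>
    (('a, 'n, 'm, 'b) tensR set \<times> 'n ratf \<Rightarrow>\<^sub>0 'n ratf) set" where
  "Q u' J u = ce (O.proj (O.bas u' J u)) 1"

lemma semilinear_ce_proj: "semilinear (Rloc 1 1) (emb l) O.TR CE (\<lambda>t. ce (O.proj t) 1)"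
  using semilinear_comp[OF O.semilinear_proj semilinear_ce ring_hom_on_id] by (simp add: comp_def)

lemma semilinear_Q:
  shows "u \<in> carrier M \<Longrightarrow> semilinear UNIV rconst M' CE (\<lambda>u'. Q u' J u)"
    and "u' \<in> carrier M' \<Longrightarrow> semilinear UNIV rconst M CE (\<lambda>u. Q u' J u)"
  using semilinear_comp[OF O.semilinear_TR_basis_first semilinear_ce_proj O.rconst_hom_on]
    semilinear_comp[OF O.semilinear_TR_basis_last semilinear_ce_proj O.rconst_hom_on]
  unfolding emb_rconst by (simp_all add: comp_def Q_def)

definition xw :: "('n::{finite,linorder} \<Rightarrow> 'm) \<Rightarrow> 'n ratf" where
  "xw J = (\<Prod>i\<in>UNIV. xvar i ^ block \<nu> (J i))"

text \<open>The variables are inverted in \<open>R_{n,l}\<close>, so the monomial is a unit; this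
  makes the comparison map invertible.\<close>

lemma xw_closed [simp]: "xw J \<in> Rloc \<epsilon> l" "inverse (xw J) \<in> Rloc \<epsilon> l"
proof -
  show "xw J \<in> Rloc \<epsilon> l"
    unfolding xw_def
    by (intro subring_on_prod[OF A.subring_Rloc] subring_on_power[OF A.subring_Rloc] A.xvar_in_Rloc)
  have "inverse (xw J) = (\<Prod>i\<in>UNIV. inverse (xvar i) ^ block \<nu> (J i))"
    by (simp add: xw_def prod_inversef[symmetric] comp_def power_inverse)
  also have "\<dots> \<in> Rloc \<epsilon> l"
    by (intro subring_on_prod[OF A.subring_Rloc] subring_on_power[OF A.subring_Rloc] A.inverse_xvar_in_Rloc)
  finally show "inverse (xw J) \<in> Rloc \<epsilon> l" .
qed

lemma xw_neq_0 [simp]: "xw J \<noteq> 0"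
  by (simp add: xw_def)

text \<open>The exponent at \<open>i\<close> changes by the degree of the matrix unit
  \<open>(J i, j)\<close>, which supplies the factor required in
  \<open>emb_loop_coeff\<close>.\<close>

lemma xw_update: "xw (J(i := j)) = xw J * xvar i powi bdeg \<nu> (J i) j"
proof -
  have r: "xw (J(i := k)) = xvar i powi int (block \<nu> k) * (\<Prod>k\<in>UNIV - {i}. xvar k ^ block \<nu> (J k))" for k
    unfolding xw_def by (subst prod.remove[of _ i]) simp_all
  have "xw J = xvar i powi int (block \<nu> (J i)) * (\<Prod>k\<in>UNIV - {i}. xvar k ^ block \<nu> (J k))"
    using r[of "J i"] by simp
  moreover have "xvar i powi int (block \<nu> j) = xvar i powi int (block \<nu> (J i)) * xvar i powi bdeg \<nu> (J i) j"
    using power_int_add[of "xvar i" "int (block \<nu> (J i))" "bdeg \<nu> (J i) j"] by (simp add: bdeg_def)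
  ultimately show ?thesis by (simp only: r mult_ac)
qed

text \<open>The roots of unity produced by the substitution are the eigenvalues of the powers of
  \<open>g\<close> on the dual basis vectors. Equivariance on generators reduces to this
  identity.\<close>

lemma W_ring_xw:
  fixes w :: "'n::{finite,linorder} wreath"
  assumes w: "bij (fst w)"
  shows "W_ring \<epsilon> w (xw J) = rconst (A.W_weight \<nu> w J) * xw (J \<circ> inv_into UNIV (fst w))"
proof -
  note W = W_ring_hom[OF A.eps_neq_0 w]
  interpret W: field_hom "W_ring \<epsilon> w" by (rule W)
  have "xw (J \<circ> inv_into UNIV (fst w)) = (\<Prod>i\<in>UNIV. xvar (fst w i) ^ block \<nu> (J i))"
    unfolding xw_def using w
    by (subst prod.reindex_bij_betw[OF w, symmetric]) (simp add: bij_is_inj)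
  then show ?thesis
    by (simp add: xw_def W.hom_prod W power_mult_distrib prod.distrib A.W_weight_def rconst_prod
        rconst_power power_mult mult.commute[of "block _ _"])
qed

text \<open>Multiplication by \<open>x_J\<close> conjugates the twisted coefficients into embedded
  untwisted ones, and the scalar shifts cancel. \<open>P\<close> is arbitrary because both
  directions use it: \<open>P = Q\<close> shows that the comparison map kills relations, and the
  classes of basis tensors divided by \<open>x_J\<close> do the same for its inverse.\<close>

lemma compare:
  fixes P :: "'a \<Rightarrow> ('n::{finite,linorder} \<Rightarrow> 'm) \<Rightarrow> 'b \<Rightarrow> 'y"
  assumes B: "smod (Rloc \<epsilon> l) B"
    and first: "\<And>J u. u \<in> carrier M \<Longrightarrow> semilinear UNIV rconst M' B (\<lambda>u'. P u' J u)"
    and last: "\<And>J u'. u' \<in> carrier M' \<Longrightarrow> semilinear UNIV rconst M B (\<lambda>u. P u' J u)"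
    and u: "u' \<in> carrier M'" "u \<in> carrier M" and X: "X = up \<nu> l (\<lambda>_. 1) (- 1) Y"
  shows "loop_sum B (\<lambda>u' J u. xw J \<odot>\<^bsub>B\<^esub> P u' J u) (A.left_op X) (loop_coeff X) (A.right_op X) u' J u =
    xw J \<odot>\<^bsub>B\<^esub> loop_sum B P (O.left_op Y) (\<lambda>i k j. emb l (loop_coeff Y i k j)) (O.right_op Y) u' J u"
proof -
  interpret B: smod "Rloc \<epsilon> l" B by (rule B)
  interpret E: field_hom "emb l :: 'n ratf \<Rightarrow> 'n ratf" by (rule emb_hom[OF A.l])
  have Pc: "P u' J u \<in> carrier B" if "u' \<in> carrier M'" "u \<in> carrier M" for u' J u
    using semilinearD(1)[OF first[OF that(2)] that(1)] .
  have coeff': "- emb l (loop_coeff Y i k j) \<in> Rloc \<epsilon> l" for i :: 'n and k j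
    using ring_hom_onD(1)[OF A.emb_hom_on O.subring_Rloc O.loop_coeff_closed[of Y i k j]] by simp
  have Xg: "X \<in> graded_loops \<nu> l (- 1)" unfolding X by (rule up_in_graded_loops[OF \<nu> A.l])
  have Xc: "A.left_op X u' \<in> carrier M'" "A.right_op X u \<in> carrier M"
    using A.op_closed[OF Xg] u by auto
  have "loop_sum B (\<lambda>u' J u. xw J \<odot>\<^bsub>B\<^esub> P u' J u) (A.left_op X) (loop_coeff X) (A.right_op X) u' J u =
    xw J \<odot>\<^bsub>B\<^esub> loop_sum B P (A.left_op X) (\<lambda>i k j. emb l (loop_coeff Y i k j)) (A.right_op X) u' (J \<circ> inv_into UNIV id) u"
  proof (rule loop_sum_twist[where U' = "carrier M'" and U = "carrier M" and \<sigma> = id and w = xw, OF B bij_id])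
    show "loop_coeff X i (J i) j * xw (J(i := j)) = xw J * emb l (loop_coeff Y (id i) (J i) j)" for J i j
      unfolding X by (simp add: xw_update mult_ac flip: A.emb_loop_coeff[OF \<nu>])
  qed (use u Xc Pc A.loop_coeff_closed coeff' in auto)
  also have "J \<circ> inv_into UNIV id = J" by (simp add: inv_id)
  also have "loop_sum B P (A.left_op X) (\<lambda>i k j. emb l (loop_coeff Y i k j)) (A.right_op X) u' J u =
      loop_sum B P (O.left_op Y) (\<lambda>i k j. emb l (loop_coeff Y i k j)) (O.right_op Y) u' J u"
  proof (rule loop_sum_shift[where P = P and J = J and L' = "A.left_op X" and L = "A.right_op X" and u' = u'
        and u = u and K' = "O.left_op Y" and K = "O.right_op Y" and s = "s Y" and r = rconst, OF B A.rconst_hom_on A.M'.smod_axioms A.M.smod_axioms first[OF u(2)] last[OF u(1)] Xc u,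
        symmetric])
    show "O.left_op Y u' = A.left_op X u' \<oplus>\<^bsub>M'\<^esub> s Y \<odot>\<^bsub>M'\<^esub> u'" unfolding X by (rule left_shift[OF u(1)])
    show "O.right_op Y u = A.right_op X u \<oplus>\<^bsub>M\<^esub> (- s Y) \<odot>\<^bsub>M\<^esub> u" unfolding X by (rule right_shift[OF u(2)])
    show "(\<Oplus>\<^bsub>B\<^esub>i\<in>UNIV. \<Oplus>\<^bsub>B\<^esub>j\<in>UNIV. (- emb l (loop_coeff Y i (J i) j)) \<odot>\<^bsub>B\<^esub> P u' (J(i := j)) u) \<in> carrier B"
      by (intro B.M.finsum_closed Pi_I B.scale_closed coeff' Pc u)
  qed
  finally show ?thesis .
qed

text \<open>The map is prescribed on basis tensors. Its value on every pure tensor is then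
  \<open>TE_pure\<close>, because the dual action of the cocharacter merely scales coordinates, and
  the product of the scaling factors along \<open>J\<close> is \<open>x_J\<close>.\<close>

lemma obtain_Phi:
  obtains \<Phi> where "semilinear (Rloc \<epsilon> l) id A.TR TE \<Phi>"
    and "\<And>u' J u. u' \<in> carrier M' \<Longrightarrow> u \<in> carrier M \<Longrightarrow> \<Phi> (A.bas u' J u) = xw J \<odot>\<^bsub>TE\<^esub> te (O.bas u' J u) 1"
    and "\<And>u' v u. u' \<in> carrier M' \<Longrightarrow> u \<in> carrier M \<Longrightarrow>
      \<Phi> (TR_tensor \<epsilon> l M' M (T_pure M' M u' v u) 1) =
      TE_pure \<epsilon> l M' M u'
        (\<lambda>i. dual_grp (cochar \<nu> (xvar i)) (\<chi> j. rconst (v i $ j) :: ('n::{finite,linorder} ratf, 'm) vec)) u"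
proof -
  let ?TE = "TE :: ('n ratf, _) module"
  interpret TE: smod "Rloc \<epsilon> l" ?TE by (rule smod_TE)
  define \<beta> where "\<beta> u' J u = xw J \<odot>\<^bsub>?TE\<^esub> te (O.bas u' J u) 1" for u' J u
  note 1 = semilinear_comp[OF O.semilinear_TR_basis_first semilinear_te O.rconst_hom_on, unfolded emb_rconst]
  note 2 = semilinear_comp[OF O.semilinear_TR_basis_last semilinear_te O.rconst_hom_on, unfolded emb_rconst]
  have "semilinear UNIV rconst M' ?TE (\<lambda>u'. te (O.bas u' J u) 1)" if "u \<in> carrier M" for J u
    using 1[OF that] by (simp add: comp_def)
  then have \<beta>1: "semilinear UNIV (id \<circ> rconst) M' ?TE (\<lambda>u'. \<beta> u' J u)" if "u \<in> carrier M" for J u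
    unfolding \<beta>_def id_o using that
    by (intro semilinear_scale[OF A.M'.smod_axioms smod_TE A.rconst_hom_on] xw_closed)
  have "semilinear UNIV rconst M ?TE (\<lambda>u. te (O.bas u' J u) 1)" if "u' \<in> carrier M'" for J u'
    using 2[OF that] by (simp add: comp_def)
  then have \<beta>2: "semilinear UNIV (id \<circ> rconst) M ?TE (\<lambda>u. \<beta> u' J u)" if "u' \<in> carrier M'" for J u'
    unfolding \<beta>_def id_o using that
    by (intro semilinear_scale[OF A.M.smod_axioms smod_TE A.rconst_hom_on] xw_closed)
  obtain \<Phi> where \<Phi>: "semilinear (Rloc \<epsilon> l) id A.TR ?TE \<Phi>"
    "\<And>u' J u. u' \<in> carrier M' \<Longrightarrow> u \<in> carrier M \<Longrightarrow> \<Phi> (A.bas u' J u) = \<beta> u' J u"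
    "\<And>u' v u. u' \<in> carrier M' \<Longrightarrow> u \<in> carrier M \<Longrightarrow> \<Phi> (TR_tensor \<epsilon> l M' M (T_pure M' M u' v u) 1) =
      (\<Oplus>\<^bsub>?TE\<^esub>J\<in>UNIV. id (\<Prod>i\<in>UNIV. rconst (v i $ J i)) \<odot>\<^bsub>?TE\<^esub> \<beta> u' J u)"
    by (rule A.TR_extend[where \<beta> = \<beta>, OF smod_TE ring_hom_on_id \<beta>1 \<beta>2])
      (assumption, assumption, (rule that; assumption))
  have "\<Phi> (TR_tensor \<epsilon> l M' M (T_pure M' M u' v u) 1) = TE_pure \<epsilon> l M' M u'
      (\<lambda>i. dual_grp (cochar \<nu> (xvar i)) (\<chi> j. rconst (v i $ j) :: ('n ratf, 'm) vec)) u"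
    if u: "u' \<in> carrier M'" "u \<in> carrier M" for u' v u
  proof -
    let ?r = "\<lambda>J. (\<Prod>i\<in>UNIV. rconst (v i $ J i)) :: 'n ratf"
    have r: "?r J \<in> Rloc \<epsilon> l" for J
      by (intro subring_on_prod[OF A.subring_Rloc] A.rconst_in_Rloc)
    have b: "O.bas u' J u \<in> carrier O.TR" for J by (rule O.TR_basis_closed[OF u])
    have t: "te (O.bas u' J u) 1 \<in> carrier ?TE" for J
      by (rule te_closed[OF b A.Rloc_closed(2)])
    have p: "(\<Prod>i\<in>UNIV. dual_grp (cochar \<nu> (xvar i)) (\<chi> j. rconst (v i $ j) :: ('n ratf, 'm) vec) $ J i) =
        ?r J * xw J" for J
      by (simp add: dual_cochar prod.distrib xw_def mult.commute)
    show ?thesis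
      unfolding TE_pure_def p \<Phi>(3)[OF u] TR_basis_def[symmetric] id_apply \<beta>_def
    proof (rule TE.M.finsum_cong'[OF refl])
      show "(\<lambda>J. te (O.bas u' J u) (?r J * xw J)) \<in> UNIV \<rightarrow> carrier ?TE"
        by (intro Pi_I te_closed b A.Rloc_closed(5) r xw_closed)
      show "?r J \<odot>\<^bsub>?TE\<^esub> (xw J \<odot>\<^bsub>?TE\<^esub> te (O.bas u' J u) 1) = te (O.bas u' J u) (?r J * xw J)" for J
        unfolding TE.scale_scale[OF r xw_closed(1) t]
        by (rule te_scale[OF b A.Rloc_closed(5)[OF r xw_closed(1)], symmetric])
    qed
  qed
  with \<Phi>(1,2) show thesis unfolding \<beta>_def by (rule that)
qed

lemma CE_proj_tensor:
  shows "semilinear (Rloc \<epsilon> l) id TE CE (CE_proj \<epsilon> l M' \<rho>1' M \<rho>1)"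
    and "t \<in> carrier O.TR \<Longrightarrow> f \<in> Rloc \<epsilon> l \<Longrightarrow>
      CE_proj \<epsilon> l M' \<rho>1' M \<rho>1 (te t f) = f \<odot>\<^bsub>CE\<^esub> ce (O.proj t) 1"
proof -
  let ?CE = "CE :: ('n::{finite,linorder} ratf, _) module"
  have eq: "CE_proj \<epsilon> l M' \<rho>1' M \<rho>1 = presented_lift id ?CE (\<lambda>(t, f). ce (O.proj t) f)"
    by (simp add: CE_proj_def geps_one)
  have \<psi>: "semilinear (Rloc 1 1) (id \<circ> emb l) O.TR ?CE (\<lambda>t. ce (O.proj t) 1)"
    unfolding id_o by (rule semilinear_ce_proj)
  have \<phi>: "(case (t, f) of (t, f) \<Rightarrow> ce (O.proj t) f) = id f \<odot>\<^bsub>?CE\<^esub> ce (O.proj t) 1"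
    if "t \<in> carrier O.TR" "f \<in> Rloc \<epsilon> l" for t f
    unfolding prod.case id_apply
    by (rule ce_scale[OF semilinearD(1)[OF O.semilinear_proj that(1)] that(2)])
  note L = scalar_extension.bc_lift[OF TE_extension smod_CE ring_hom_on_id \<psi> \<phi>, folded eq]
  show "semilinear (Rloc \<epsilon> l) id TE ?CE (CE_proj \<epsilon> l M' \<rho>1' M \<rho>1)"
    unfolding TE_mod_def by (rule L; assumption)
  show "CE_proj \<epsilon> l M' \<rho>1' M \<rho>1 (te t f) = f \<odot>\<^bsub>?CE\<^esub> ce (O.proj t) 1"
    if "t \<in> carrier O.TR" "f \<in> Rloc \<epsilon> l"
    using L(2)[OF _ _ that] by (simp add: TE_tensor_def)
qed

text \<open>On the embedded subring \<open>W_ring\<close> sees only the permutation, as the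
  \<open>l\<close>-th power of \<open>\<epsilon>^(-d) x_i\<close> is \<open>x_i^l\<close>. This
  makes the action compatible with the tensor product over \<open>R_{n,1}\<close>.\<close>

lemma W_CE_tensor:
  fixes w :: "'n::{finite,linorder} wreath"
  assumes w: "bij (fst w)"
  shows "semilinear (Rloc \<epsilon> l) (W_ring \<epsilon> w) CE CE (W_CE \<epsilon> l M' \<rho>1' M \<rho>1 w)"
    and "c \<in> carrier O.Co \<Longrightarrow> W_CE \<epsilon> l M' \<rho>1' M \<rho>1 w (ce c 1) =
      ce (W_coinv 1 1 (geps \<nu> 1) M' \<rho>1' M \<rho>1 (fst w, \<lambda>_. 0) c) 1"
proof -
  let ?CE = "CE :: ('n ratf, _) module"
  let ?w = "(fst w, \<lambda>_. 0) :: 'n wreath"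
  let ?V = "W_coinv 1 1 (geps \<nu> 1) M' \<rho>1' M \<rho>1 ?w"
  interpret CE: smod "Rloc \<epsilon> l" ?CE by (rule smod_CE)
  have w': "bij (fst ?w)" using w by simp
  note V = O.W_Co[OF w']
  note Wh = A.W_ring_hom_on[OF w] and W = W_ring_hom[OF A.eps_neq_0 w]
  note W1 = W_ring_hom[OF O.eps_neq_0 w'] and W1h = O.W_ring_hom_on[OF w']
  note E = emb_hom[OF A.l]
  have h1: "field_hom (W_ring \<epsilon> w \<circ> emb l)"
    by (rule field_hom.intro[OF ring_hom_on_comp[OF field_hom.hom[OF E(1)] field_hom.hom[OF W(1)]]])
  have h2: "field_hom (emb l \<circ> W_ring 1 ?w)"
    by (rule field_hom.intro[OF ring_hom_on_comp[OF field_hom.hom[OF W1(1)] field_hom.hom[OF E(1)]]])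
  have x: "W_ring \<epsilon> w (xvar i ^ l) = emb l (W_ring 1 ?w (xvar i))" for i
  proof -
    interpret W: field_hom "W_ring \<epsilon> w" by (rule W)
    interpret E: field_hom "emb l :: 'n ratf \<Rightarrow> 'n ratf" by (rule E)
    have "(inverse \<epsilon> ^ snd w i) ^ l = 1" by (simp add: power_inverse A.eps_power_power)
    then have "rconst (inverse \<epsilon> ^ snd w i) ^ l = (1 :: 'n ratf)" by (simp only: rconst_power[symmetric] rconst_hom)
    then show ?thesis by (simp add: W W1 E power_mult_distrib)
  qed
  have comm: "W_ring \<epsilon> w (emb l r) = emb l (W_ring 1 ?w r)" for r
    using field_hom_eqI[OF h1 _ h2, of r] by (simp add: W(2) W1(2) E(2,3) x)
  have "semilinear (Rloc 1 1) (emb l \<circ> W_ring 1 ?w) O.Co ?CE ((\<lambda>c. ce c 1) \<circ> ?V)"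
    by (rule semilinear_comp[OF V(1) semilinear_ce W1h])
  then have \<psi>: "semilinear (Rloc 1 1) (W_ring \<epsilon> w \<circ> emb l) O.Co ?CE (\<lambda>c. ce (?V c) 1)"
    by (simp add: comp_def comm)
  have eq: "W_CE \<epsilon> l M' \<rho>1' M \<rho>1 w = presented_lift (W_ring \<epsilon> w) ?CE (\<lambda>(c, f). ce (?V c) (W_ring \<epsilon> w f))"
    by (simp add: W_CE_def geps_one)
  have \<phi>: "(case (c, f) of (c, f) \<Rightarrow> ce (?V c) (W_ring \<epsilon> w f)) = W_ring \<epsilon> w f \<odot>\<^bsub>?CE\<^esub> ce (?V c) 1"
    if "c \<in> carrier O.Co" "f \<in> Rloc \<epsilon> l" for c f
    unfolding prod.case
    by (rule ce_scale[OF semilinearD(1)[OF V(1) that(1)] ring_hom_onD(1)[OF Wh A.subring_Rloc that(2)]])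
  note L = scalar_extension.bc_lift[OF CE_extension smod_CE Wh \<psi> \<phi>, folded eq CE_eq]
  show "semilinear (Rloc \<epsilon> l) (W_ring \<epsilon> w) ?CE ?CE (W_CE \<epsilon> l M' \<rho>1' M \<rho>1 w)"
    by (rule L; assumption)
  assume c: "c \<in> carrier O.Co"
  have "W_CE \<epsilon> l M' \<rho>1' M \<rho>1 w (ce c 1) = W_ring \<epsilon> w 1 \<odot>\<^bsub>?CE\<^esub> ce (?V c) 1"
    by (rule L(2)[OF _ _ c A.Rloc_closed(2)]; assumption)
  then show "W_CE \<epsilon> l M' \<rho>1' M \<rho>1 w (ce c 1) = ce (?V c) 1"
    using semilinearD(1)[OF \<psi> c] by (simp add: field_hom.hom_simps(2)[OF W(1)])
qed

text \<open>Each twisted loop \<open>X\<close> is the regrading of an untwisted loop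
  \<open>Y\<close>, so by \<open>compare\<close> the relation of \<open>X\<close> goes to
  \<open>x_J\<close> times the class of the relation of \<open>Y\<close>, which is zero.\<close>

lemma obtain_theta:
  fixes \<Phi> :: "('a, 'n::{finite,linorder}, 'm, 'b) tensR \<Rightarrow> _"
  assumes \<Phi>: "semilinear (Rloc \<epsilon> l) id A.TR TE \<Phi>"
    "\<And>u' J u. u' \<in> carrier M' \<Longrightarrow> u \<in> carrier M \<Longrightarrow> \<Phi> (A.bas u' J u) = xw J \<odot>\<^bsub>TE\<^esub> te (O.bas u' J u) 1"
  obtains \<Psi> where "semilinear (Rloc \<epsilon> l) id A.Co CE \<Psi>"
    and "\<And>t. t \<in> carrier A.TR \<Longrightarrow> \<Psi> (A.proj t) = CE_proj \<epsilon> l M' \<rho>1' M \<rho>1 (\<Phi> t)"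
    and "\<And>u' J u. u' \<in> carrier M' \<Longrightarrow> u \<in> carrier M \<Longrightarrow> \<Psi> (A.proj (A.bas u' J u)) = xw J \<odot>\<^bsub>CE\<^esub> Q u' J u"
proof -
  let ?CE = "CE :: ('n ratf, _) module"
  interpret CE: smod "Rloc \<epsilon> l" ?CE by (rule smod_CE)
  interpret E: field_hom "emb l :: 'n ratf \<Rightarrow> 'n ratf" by (rule emb_hom[OF A.l])
  define \<theta> where "\<theta> t = CE_proj \<epsilon> l M' \<rho>1' M \<rho>1 (\<Phi> t)" for t
  have \<theta>: "semilinear (Rloc \<epsilon> l) id A.TR ?CE \<theta>"
    unfolding \<theta>_def[abs_def]
    by (rule semilinear_comp[OF \<Phi>(1) CE_proj_tensor(1) ring_hom_on_id, unfolded id_o, unfolded comp_def])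
  have bas: "\<theta> (A.bas u' J u) = xw J \<odot>\<^bsub>?CE\<^esub> Q u' J u" if u: "u' \<in> carrier M'" "u \<in> carrier M" for u' J u
  proof -
    have b: "O.bas u' J u \<in> carrier O.TR" by (rule O.TR_basis_closed[OF u])
    have "\<theta> (A.bas u' J u) = CE_proj \<epsilon> l M' \<rho>1' M \<rho>1 (te (O.bas u' J u) (xw J))"
      unfolding \<theta>_def \<Phi>(2)[OF u] te_scale[OF b xw_closed(1)] ..
    also have "\<dots> = xw J \<odot>\<^bsub>?CE\<^esub> Q u' J u"
      unfolding CE_proj_tensor(2)[OF b xw_closed(1)] Q_def ..
    finally show ?thesis .
  qed
  have kern: "\<theta> x = \<zero>\<^bsub>?CE\<^esub>" if "x \<in> A.kern" for x
  proof (rule A.kern_zero[OF smod_CE ring_hom_on_id \<theta> _ that])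
    fix X :: "'m loop" and u' u and J :: "'n \<Rightarrow> 'm"
    assume X: "X \<in> graded_loops \<nu> l (- 1)" and u: "u' \<in> carrier M'" "u \<in> carrier M"
    define Y where "Y = down \<nu> l (\<lambda>_. 1) (- 1) X"
    have XY: "X = up \<nu> l (\<lambda>_. 1) (- 1) Y"
      unfolding Y_def by (rule up_down[OF \<nu> A.l _ X, symmetric]) simp
    \<comment> \<open>For \<open>l = 1\<close> the divisibility condition is empty.\<close>
    have Yg: "Y \<in> graded_loops \<nu> 1 (- 1)" by (simp add: graded_loops_def)
    have "\<theta> (A.rel X u' J u) =
        loop_sum ?CE (\<lambda>u' J u. xw J \<odot>\<^bsub>?CE\<^esub> Q u' J u) (A.left_op X) (\<lambda>i k j. - id (- loop_coeff X i k j)) (A.right_op X) u' J u"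
      by (rule A.loop_sum_image[OF smod_CE ring_hom_on_id \<theta>])
        (rule A.op_closed[OF X] A.loop_coeff_closed u | rule bas; assumption)+
    also have "\<dots> = xw J \<odot>\<^bsub>?CE\<^esub> loop_sum ?CE Q (O.left_op Y) (\<lambda>i k j. emb l (loop_coeff Y i k j)) (O.right_op Y) u' J u"
      using compare[where P = Q, OF smod_CE semilinear_Q u XY] by simp
    also have "loop_sum ?CE Q (O.left_op Y) (\<lambda>i k j. emb l (loop_coeff Y i k j)) (O.right_op Y) u' J u =
        ce (O.proj (O.rel Y u' J u)) 1"
    proof -
      have "ce (O.proj (O.rel Y u' J u)) 1 = loop_sum ?CE Q (O.left_op Y)
          (\<lambda>i k j. - emb l (- loop_coeff Y i k j)) (O.right_op Y) u' J u"
        by (rule O.loop_sum_image[OF smod_CE A.emb_hom_on semilinear_ce_proj])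
          (rule O.op_closed[OF Yg] O.loop_coeff_closed u | simp add: Q_def)+
      then show ?thesis by simp
    qed
    also have "\<dots> = \<zero>\<^bsub>?CE\<^esub>"
      unfolding O.proj_kern[OF O.rel_in_kern[OF Yg u]]
      by (rule semilinear_zero[OF O.smod_Co smod_CE A.emb_hom_on semilinear_ce])
    finally show "\<theta> (A.rel X u' J u) = \<zero>\<^bsub>?CE\<^esub>" by simp
  qed
  obtain \<Psi> where \<Psi>: "semilinear (Rloc \<epsilon> l) id A.Co ?CE \<Psi>" "\<And>x. x \<in> carrier A.TR \<Longrightarrow> \<Psi> (A.proj x) = \<theta> x"
    by (rule A.Co_lift[OF smod_CE \<theta> ring_hom_on_id kern]) (assumption, (rule that; assumption))
  show thesis
    by (rule that[OF \<Psi>(1)]) (simp_all add: \<Psi>(2) A.TR_basis_closed bas, simp add: \<theta>_def)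
qed

text \<open>Three universal properties in turn: a map on the untwisted tensor module that is
  semilinear along \<open>emb\<close>, its descent to the coinvariants, and its extension by base
  change. The target is already a module over \<open>R_{n,l}\<close>, so dividing by
  \<open>x_J\<close> makes sense from the start.\<close>

lemma obtain_inverse:
  obtains \<Psi>' where "semilinear (Rloc \<epsilon> l) id CE A.Co \<Psi>'"
    and "\<And>u' J u. u' \<in> carrier M' \<Longrightarrow> u \<in> carrier M \<Longrightarrow>
      \<Psi>' (Q u' J u) = inverse (xw J) \<odot>\<^bsub>A.Co\<^esub> (A.proj (A.bas u' J u) :: ('a, 'n::{finite,linorder}, 'm, 'b) tensR set)"
proof -
  let ?Co = "A.Co :: ('n ratf, _) module"
  interpret Co: smod "Rloc \<epsilon> l" ?Co by (rule A.smod_Co)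
  interpret E: field_hom "emb l :: 'n ratf \<Rightarrow> 'n ratf" by (rule emb_hom[OF A.l])
  define P where "P u' J u = inverse (xw J) \<odot>\<^bsub>?Co\<^esub> A.proj (A.bas u' J u)" for u' J u
  note s1 = semilinear_comp[OF A.semilinear_TR_basis_first A.semilinear_proj A.rconst_hom_on]
  note s2 = semilinear_comp[OF A.semilinear_TR_basis_last A.semilinear_proj A.rconst_hom_on]
  have P1: "semilinear UNIV rconst M' ?Co (\<lambda>u'. P u' J u)" if "u \<in> carrier M" for J u
    unfolding P_def
    by (rule semilinear_scale[OF A.M'.smod_axioms A.smod_Co A.rconst_hom_on s1[OF that, unfolded id_o, unfolded comp_def] xw_closed(2)])
  have P2: "semilinear UNIV rconst M ?Co (\<lambda>u. P u' J u)" if "u' \<in> carrier M'" for J u'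
    unfolding P_def
    by (rule semilinear_scale[OF A.M.smod_axioms A.smod_Co A.rconst_hom_on s2[OF that, unfolded id_o, unfolded comp_def] xw_closed(2)])
  obtain \<theta> where \<theta>: "semilinear (Rloc 1 1) (emb l) O.TR ?Co \<theta>"
    "\<And>u' J u. u' \<in> carrier M' \<Longrightarrow> u \<in> carrier M \<Longrightarrow> \<theta> (O.bas u' J u) = P u' J u"
    by (rule O.TR_extend[where \<beta> = P, OF A.smod_Co A.emb_hom_on], unfold emb_rconst)
      (erule P1, erule P2, (rule that; assumption))
  have kern: "\<theta> x = \<zero>\<^bsub>?Co\<^esub>" if "x \<in> O.kern" for x
  proof (rule O.kern_zero[OF A.smod_Co A.emb_hom_on \<theta>(1) _ that])
    fix Y :: "'m loop" and u' u and J :: "'n \<Rightarrow> 'm"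
    assume Y: "Y \<in> graded_loops \<nu> 1 (- 1)" and u: "u' \<in> carrier M'" "u \<in> carrier M"
    define X where "X = up \<nu> l (\<lambda>_. 1) (- 1) Y"
    have X: "X \<in> graded_loops \<nu> l (- 1)" unfolding X_def by (rule up_in_graded_loops[OF \<nu> A.l])
    let ?L = "loop_sum ?Co P (O.left_op Y) (\<lambda>i k j. emb l (loop_coeff Y i k j)) (O.right_op Y) u' J u"
    have "\<theta> (O.rel Y u' J u) =
        loop_sum ?Co P (O.left_op Y) (\<lambda>i k j. - emb l (- loop_coeff Y i k j)) (O.right_op Y) u' J u"
      by (rule O.loop_sum_image[OF A.smod_Co A.emb_hom_on \<theta>(1)])
        (rule O.op_closed[OF Y] O.loop_coeff_closed u | rule \<theta>(2); assumption)+
    then have L: "\<theta> (O.rel Y u' J u) = ?L" by simp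
    have Lc: "?L \<in> carrier ?Co"
      using semilinearD(1)[OF \<theta>(1), of "O.rel Y u' J u"] O.rel_in_kern[OF Y u]
        submod.B_closed(1)[OF O.kern_submod] L by auto
    have pb: "A.proj (A.bas u' J u) \<in> carrier ?Co" if "u' \<in> carrier M'" "u \<in> carrier M" for u' J u
      by (rule semilinearD(1)[OF A.semilinear_proj A.TR_basis_closed[OF that]])
    have "A.proj (A.rel X u' J u) =
        loop_sum ?Co (\<lambda>u' J u. xw J \<odot>\<^bsub>?Co\<^esub> P u' J u) (A.left_op X) (\<lambda>i k j. - id (- loop_coeff X i k j)) (A.right_op X) u' J u"
      by (rule A.loop_sum_image[OF A.smod_Co ring_hom_on_id A.semilinear_proj])
        (rule A.op_closed[OF X] A.loop_coeff_closed u | simp add: P_def pb Co.scale_scale)+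
    also have "\<dots> = xw J \<odot>\<^bsub>?Co\<^esub> ?L"
      using compare[where P = P, OF A.smod_Co P1 P2 u X_def] by simp
    finally have "xw J \<odot>\<^bsub>?Co\<^esub> ?L = \<zero>\<^bsub>?Co\<^esub>" using A.proj_kern[OF A.rel_in_kern[OF X u], of J] by simp
    \<comment> \<open>\<open>compare\<close> yields the vanishing after multiplication by
      \<open>x_J\<close>, which is a unit.\<close>
    then have "inverse (xw J) \<odot>\<^bsub>?Co\<^esub> (xw J \<odot>\<^bsub>?Co\<^esub> ?L) = \<zero>\<^bsub>?Co\<^esub>" by simp
    then show "\<theta> (O.rel Y u' J u) = \<zero>\<^bsub>?Co\<^esub>"
      unfolding L using Lc by (simp add: Co.scale_scale)
  qed
  obtain \<theta>1 where \<theta>1: "semilinear (Rloc 1 1) (emb l) O.Co ?Co \<theta>1" "\<And>x. x \<in> carrier O.TR \<Longrightarrow> \<theta>1 (O.proj x) = \<theta> x"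
    by (rule O.Co_lift[OF A.smod_Co \<theta>(1) A.emb_hom_on kern]) (assumption, (rule that; assumption))
  define \<Psi>' where "\<Psi>' = presented_lift id ?Co (\<lambda>(c, f). f \<odot>\<^bsub>?Co\<^esub> \<theta>1 c)"
  have "semilinear (Rloc 1 1) (id \<circ> emb l) O.Co ?Co \<theta>1" using \<theta>1(1) by simp
  note lift = scalar_extension.bc_lift[OF CE_extension A.smod_Co ring_hom_on_id this]
  have L: "semilinear (Rloc \<epsilon> l) id CE ?Co \<Psi>'"
    "\<And>c f. c \<in> carrier O.Co \<Longrightarrow> f \<in> Rloc \<epsilon> l \<Longrightarrow> \<Psi>' (ce c f) = id f \<odot>\<^bsub>?Co\<^esub> \<theta>1 c"
    unfolding \<Psi>'_def CE_eq by (rule lift; simp)+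
  have "\<Psi>' (Q u' J u) = P u' J u" if u: "u' \<in> carrier M'" "u \<in> carrier M" for u' J u
  proof -
    have c: "O.proj (O.bas u' J u) \<in> carrier O.Co"
      by (rule semilinearD(1)[OF O.semilinear_proj O.TR_basis_closed[OF u]])
    have "\<Psi>' (Q u' J u) = id 1 \<odot>\<^bsub>?Co\<^esub> \<theta>1 (O.proj (O.bas u' J u))"
      unfolding Q_def using L(2)[OF c A.Rloc_closed(2)] .
    then show ?thesis
      using \<theta>1(2)[OF O.TR_basis_closed[OF u]] \<theta>(2)[OF u] semilinearD(1)[OF \<theta>1(1) c] by simp
  qed
  with L(1) show thesis unfolding P_def by (rule that)
qed

text \<open>On generators the two maps multiply by \<open>x_J\<close> and by its inverse. Each
  \<open>w\<close> acts semilinearly along \<open>W_ring\<close>, so equivariance is an identity on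
  generators as well; elements of the algebra then follow by linearity and summation over
  \<open>W\<close>.\<close>

lemma comparison_iso:
  fixes \<Psi> :: "('a, 'n::{finite,linorder}, 'm, 'b) tensR set \<Rightarrow> _"
  assumes \<Psi>: "semilinear (Rloc \<epsilon> l) id A.Co CE \<Psi>"
    and bas: "\<And>u' J u. u' \<in> carrier M' \<Longrightarrow> u \<in> carrier M \<Longrightarrow> \<Psi> (A.proj (A.bas u' J u)) = xw J \<odot>\<^bsub>CE\<^esub> Q u' J u"
  shows "equivariant_iso (Balg \<epsilon> l) A.Co (B_coinv \<epsilon> l (geps \<nu> \<epsilon>) M' \<rho>' M \<rho>) CE (B_CE \<epsilon> l M' \<rho>1' M \<rho>1) \<Psi>"
proof -
  let ?Co = "A.Co :: ('n ratf, _) module" and ?CE = "CE :: ('n ratf, _) module"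
  interpret Co: smod "Rloc \<epsilon> l" ?Co by (rule A.smod_Co)
  interpret CE: smod "Rloc \<epsilon> l" ?CE by (rule smod_CE)
  obtain \<Psi>' where \<Psi>': "semilinear (Rloc \<epsilon> l) id ?CE ?Co \<Psi>'"
    "\<And>u' J u. u' \<in> carrier M' \<Longrightarrow> u \<in> carrier M \<Longrightarrow> \<Psi>' (Q u' J u) = inverse (xw J) \<odot>\<^bsub>?Co\<^esub> A.proj (A.bas u' J u)"
    by (rule obtain_inverse) (rule that; assumption)
  have pb: "A.proj (A.bas u' J u) \<in> carrier ?Co" if "u' \<in> carrier M'" "u \<in> carrier M" for u' J u
    by (rule semilinearD(1)[OF A.semilinear_proj A.TR_basis_closed[OF that]])
  have Qc: "Q u' J u \<in> carrier ?CE" if "u' \<in> carrier M'" "u \<in> carrier M" for u' J u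
    by (rule semilinearD(1)[OF semilinear_Q(1)[OF that(2)] that(1)])
  have CoB: "\<exists>u' J u. u' \<in> carrier M' \<and> u \<in> carrier M \<and> x = A.proj (A.bas u' J u)" if "x \<in> A.Co_basis" for x
    using that unfolding A.Co_basis_def A.TR_basis_set_def by blast
  have CEB: "\<exists>u' J u. u' \<in> carrier M' \<and> u \<in> carrier M \<and> x = Q u' J u" if "x \<in> CE_basis" for x
    using that unfolding CE_basis_def O.Co_basis_def O.TR_basis_set_def Q_def by blast
  have inv1: "\<Psi>' (\<Psi> x) = x" if "x \<in> carrier ?Co" for x
  proof (rule semilinear_eqI[OF A.smod_Co A.smod_Co ring_hom_on_id _ _ A.Co_span A.Co_basis_closed _ that])
    show "semilinear (Rloc \<epsilon> l) id ?Co ?Co (\<lambda>x. \<Psi>' (\<Psi> x))"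
      by (rule semilinear_comp[OF \<Psi> \<Psi>'(1) ring_hom_on_id, unfolded id_o, unfolded comp_def])
    show "semilinear (Rloc \<epsilon> l) id ?Co ?Co (\<lambda>x. x)" by (rule semilinearI) auto
    fix x :: "('a, 'n, 'm, 'b) tensR set" assume "x \<in> A.Co_basis"
    from CoB[OF this] obtain u' J u where u: "u' \<in> carrier M'" "u \<in> carrier M" "x = A.proj (A.bas u' J u)" by blast
    then show "\<Psi>' (\<Psi> x) = x"
      by (simp add: bas semilinearD(3)[OF \<Psi>'(1)] Qc \<Psi>'(2) Co.scale_scale pb)
  qed
  have inv2: "\<Psi> (\<Psi>' x) = x" if "x \<in> carrier ?CE" for x
  proof (rule semilinear_eqI[OF smod_CE smod_CE ring_hom_on_id _ _ CE_span CE_basis_closed _ that])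
    show "semilinear (Rloc \<epsilon> l) id ?CE ?CE (\<lambda>x. \<Psi> (\<Psi>' x))"
      by (rule semilinear_comp[OF \<Psi>'(1) \<Psi> ring_hom_on_id, unfolded id_o, unfolded comp_def])
    show "semilinear (Rloc \<epsilon> l) id ?CE ?CE (\<lambda>x. x)" by (rule semilinearI) auto
    fix x :: "(('a, 'n, 'm, 'b) tensR set \<times> 'n ratf \<Rightarrow>\<^sub>0 'n ratf) set" assume "x \<in> CE_basis"
    from CEB[OF this] obtain u' J u where u: "u' \<in> carrier M'" "u \<in> carrier M" "x = Q u' J u" by blast
    then show "\<Psi> (\<Psi>' x) = x"
      by (simp add: bas semilinearD(3)[OF \<Psi>] Qc \<Psi>'(2) CE.scale_scale pb)
  qed
  have bij: "bij_betw \<Psi> (carrier ?Co) (carrier ?CE)"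
    by (rule bij_betw_byWitness[where f' = \<Psi>'])
      (use inv1 inv2 semilinearD(1)[OF \<Psi>] semilinearD(1)[OF \<Psi>'(1)] in \<open>auto\<close>)
  let ?WCo = "W_coinv \<epsilon> l (geps \<nu> \<epsilon>) M' \<rho>' M \<rho>" and ?WCE = "W_CE \<epsilon> l M' \<rho>1' M \<rho>1"
  have W: "\<Psi> (?WCo w x) = ?WCE w (\<Psi> x)" if w: "bij (fst w)" and x: "x \<in> carrier ?Co" for w :: "'n wreath" and x
  proof (rule semilinear_eqI[OF A.smod_Co smod_CE A.W_ring_hom_on[OF w] _ _ A.Co_span A.Co_basis_closed _ x])
    note WCo = A.W_Co[OF w] and WCE = W_CE_tensor[OF w]
    show "semilinear (Rloc \<epsilon> l) (W_ring \<epsilon> w) ?Co ?CE (\<lambda>x. \<Psi> (?WCo w x))"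
      by (rule semilinear_comp[OF WCo(1) \<Psi> A.W_ring_hom_on[OF w], unfolded id_o, unfolded comp_def])
    show "semilinear (Rloc \<epsilon> l) (W_ring \<epsilon> w) ?Co ?CE (\<lambda>x. ?WCE w (\<Psi> x))"
      by (rule semilinear_comp[OF \<Psi> WCE(1) ring_hom_on_id, unfolded o_id, unfolded comp_def])
    fix x :: "('a, 'n, 'm, 'b) tensR set" assume "x \<in> A.Co_basis"
    from CoB[OF this] obtain u' J u where u: "u' \<in> carrier M'" "u \<in> carrier M" and x: "x = A.proj (A.bas u' J u)" by blast
    let ?J = "J \<circ> inv_into UNIV (fst w)"
    let ?w = "(fst w, \<lambda>_. 0) :: 'n wreath"
    have w': "bij (fst ?w)" using w by simp
    have "\<Psi> (?WCo w x) = \<Psi> (A.proj (rconst (A.W_weight \<nu> w J) \<odot>\<^bsub>A.TR\<^esub> A.bas u' ?J u))"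
      unfolding x WCo(2)[OF A.TR_basis_closed[OF u]] A.W_TR_basis(2)[OF w u] ..
    also have "\<dots> = rconst (A.W_weight \<nu> w J) \<odot>\<^bsub>?CE\<^esub> (xw ?J \<odot>\<^bsub>?CE\<^esub> Q u' ?J u)"
      by (simp only: semilinearD(3)[OF A.semilinear_proj A.rconst_in_Rloc A.TR_basis_closed[OF u]]
          semilinearD(3)[OF \<Psi> A.rconst_in_Rloc pb[OF u]] bas[OF u] id_apply)
    also have "\<dots> = W_ring \<epsilon> w (xw J) \<odot>\<^bsub>?CE\<^esub> Q u' ?J u"
      using Qc[OF u] by (simp add: CE.scale_scale W_ring_xw[OF w])
    also have "Q u' ?J u = ?WCE w (Q u' J u)"
    proof -
      have c: "O.proj (O.bas u' J u) \<in> carrier O.Co"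
        by (rule semilinearD(1)[OF O.semilinear_proj O.TR_basis_closed[OF u]])
      have "?WCE w (Q u' J u) = ce (O.proj (rconst (O.W_weight \<nu> ?w J) \<odot>\<^bsub>O.TR\<^esub> O.bas u' (J \<circ> inv_into UNIV (fst ?w)) u)) 1"
        unfolding Q_def WCE(2)[OF c] O.W_Co(2)[OF w' O.TR_basis_closed[OF u]] O.W_TR_basis(2)[OF w' u] ..
      also have "rconst (O.W_weight \<nu> ?w J) = (1 :: 'n ratf)" by (simp add: O.W_weight_def)
      finally show ?thesis
        by (simp only: fst_conv smod.scale_one[OF O.smod_TR O.TR_basis_closed[OF u]] Q_def)
    qed
    also have "W_ring \<epsilon> w (xw J) \<odot>\<^bsub>?CE\<^esub> ?WCE w (Q u' J u) = ?WCE w (\<Psi> x)"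
      unfolding x bas[OF u] by (rule semilinearD(3)[OF WCE(1) xw_closed(1) Qc[OF u], symmetric])
    finally show "\<Psi> (?WCo w x) = ?WCE w (\<Psi> x)" .
  qed
  have "\<Psi> (B_coinv \<epsilon> l (geps \<nu> \<epsilon>) M' \<rho>' M \<rho> b x) = B_CE \<epsilon> l M' \<rho>1' M \<rho>1 b (\<Psi> x)"
    if b: "b \<in> Balg \<epsilon> l" and x: "x \<in> carrier ?Co" for b x
  proof -
    have bw: "b w \<in> Rloc \<epsilon> l" if "w \<in> Wgrp l" for w using b that by (simp add: Balg_def)
    have wb: "bij (fst w)" if "w \<in> Wgrp l" for w :: "'n wreath" using that by (auto simp: Wgrp_def)
    have c: "?WCo w x \<in> carrier ?Co" if "w \<in> Wgrp l" for w
      by (rule semilinearD(1)[OF A.W_Co(1)[OF wb[OF that]] x])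
    have "\<Psi> (B_coinv \<epsilon> l (geps \<nu> \<epsilon>) M' \<rho>' M \<rho> b x) = (\<Oplus>\<^bsub>?CE\<^esub>w\<in>Wgrp l. \<Psi> (b w \<odot>\<^bsub>?Co\<^esub> ?WCo w x))"
      unfolding B_coinv_def
      by (rule semilinear_finsum[OF A.smod_Co smod_CE ring_hom_on_id \<Psi>]) (use bw c in auto)
    also have "\<dots> = (\<Oplus>\<^bsub>?CE\<^esub>w\<in>Wgrp l. b w \<odot>\<^bsub>?CE\<^esub> ?WCE w (\<Psi> x))"
    proof (rule CE.M.finsum_cong'[OF refl])
      fix w :: "'n wreath" assume w: "w \<in> Wgrp l"
      show "\<Psi> (b w \<odot>\<^bsub>?Co\<^esub> ?WCo w x) = b w \<odot>\<^bsub>?CE\<^esub> ?WCE w (\<Psi> x)"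
        using semilinearD(3)[OF \<Psi> bw[OF w] c[OF w]] W[OF wb[OF w] x] by simp
    next
      show "(\<lambda>w. b w \<odot>\<^bsub>?CE\<^esub> ?WCE w (\<Psi> x)) \<in> Wgrp l \<rightarrow> carrier ?CE"
        by (intro Pi_I CE.scale_closed bw semilinearD(1)[OF W_CE_tensor(1)[OF wb] semilinearD(1)[OF \<Psi> x]])
    qed
    finally show ?thesis unfolding B_CE_def .
  qed
  then show ?thesis
    unfolding equivariant_iso_def using bij semilinearD(2)[OF \<Psi>] by blast
qed

end

section \<open>Actions of affine Lie algebras and the main result\<close>

lemma lie_moduleD:
  assumes "lie_module L M \<rho>"
  shows "smod UNIV M" "\<And>\<eta>. \<eta> \<in> L \<Longrightarrow> semilinear UNIV id M M (\<rho> \<eta>)"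
    "\<And>\<eta> \<theta> u. \<eta> \<in> L \<Longrightarrow> \<theta> \<in> L \<Longrightarrow> u \<in> carrier M \<Longrightarrow> \<rho> (\<eta> + \<theta>) u = \<rho> \<eta> u \<oplus>\<^bsub>M\<^esub> \<rho> \<theta> u"
    "\<And>k \<eta> u. \<eta> \<in> L \<Longrightarrow> u \<in> carrier M \<Longrightarrow> \<rho> (aff_scale k \<eta>) u = k \<odot>\<^bsub>M\<^esub> \<rho> \<eta> u"
  using assms by (auto simp: lie_module_def lin_maps_iff intro: smod.intro)

lemma lie_module_sum:
  assumes M: "lie_module L M \<rho>" and L: "0 \<in> L" "\<And>\<eta> \<theta>. \<eta> \<in> L \<Longrightarrow> \<theta> \<in> L \<Longrightarrow> \<eta> + \<theta> \<in> L"
    and "finite F" and \<eta>: "\<And>i. i \<in> F \<Longrightarrow> \<eta> i \<in> L" and u: "u \<in> carrier M"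
  shows "\<rho> (\<Sum>i\<in>F. \<eta> i) u = (\<Oplus>\<^bsub>M\<^esub>i\<in>F. \<rho> (\<eta> i) u)"
proof -
  interpret M: smod UNIV M by (rule lie_moduleD(1)[OF M])
  note a = lie_moduleD(3)[OF M] and c = semilinearD(1)[OF lie_moduleD(2)[OF M] u]
  have z: "\<rho> 0 u = \<zero>\<^bsub>M\<^esub>"
    using a[OF L(1) L(1) u] c[OF L(1)] by - (rule M.idem_imp_zero, simp_all)
  \<comment> \<open>Membership of the partial sums is carried along, because additivity of
    \<open>\<rho>\<close> is available only inside \<open>L\<close>.\<close>
  have "(\<Sum>i\<in>F. \<eta> i) \<in> L \<and> \<rho> (\<Sum>i\<in>F. \<eta> i) u = (\<Oplus>\<^bsub>M\<^esub>i\<in>F. \<rho> (\<eta> i) u)"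
    using \<open>finite F\<close> \<eta>
  proof (induction F)
    case (insert i F)
    then have "\<rho> (\<eta> i) u \<in> carrier M" "(\<lambda>i. \<rho> (\<eta> i) u) \<in> F \<rightarrow> carrier M" using c by auto
    then show ?case using insert L(2) a[OF _ _ u] by (simp add: M.M.finsum_insert)
  qed (simp add: L z M.M.finsum_empty)
  then show ?thesis ..
qed

text \<open>The level fixes the action of \<open>(0, 1)\<close>; compatibility with scalars gives
  that of \<open>(0, s)\<close>, and additivity splits off this central part.\<close>

lemma lie_module_central:
  fixes X :: "'m::finite loop"
  assumes M: "lie_module L M \<rho>" and lev: "has_level l c M \<rho>" and L: "(X, 0) \<in> L" "\<And>s. (0, s) \<in> L"
    and u: "u \<in> carrier M"
  shows "\<rho> (X, s) u = \<rho> (X, 0) u \<oplus>\<^bsub>M\<^esub> (s * (c / of_nat l)) \<odot>\<^bsub>M\<^esub> u"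
proof -
  interpret M: smod UNIV M by (rule lie_moduleD(1)[OF M])
  have "Poly_Mapping.map (mscale s) 0 = (0 :: 'm loop)" for s
    by (rule poly_mapping_eqI) (simp add: lookup_mscale_map vec_eq_iff)
  then have s: "aff_scale s (0, 1) = (0 :: 'm loop, s)"
    by (simp add: aff_scale_def)
  have "\<rho> (X, s) u = \<rho> ((X, 0) + (0, s)) u" by simp
  also have "\<dots> = \<rho> (X, 0) u \<oplus>\<^bsub>M\<^esub> \<rho> (0, s) u"
    by (rule lie_moduleD(3)[OF M L u])
  also have "\<rho> (0, s) u = (s * (c / of_nat l)) \<odot>\<^bsub>M\<^esub> u"
    using lie_moduleD(4)[OF M L(2) u, of s 1] lev u
    by (simp add: has_level_def s M.scale_scale)
  finally show ?thesis .
qed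

lemma sum_laff: "(\<Sum>a\<in>Poly_Mapping.keys X. laff (Poly_Mapping.lookup X a) a) = (X, 0)"
proof -
  have "(\<Sum>a\<in>F. laff (Poly_Mapping.lookup X a) a) =
      (\<Sum>a\<in>F. Poly_Mapping.single a (Poly_Mapping.lookup X a), 0)" if "finite F" for F
    using that by (induction F) (simp_all add: laff_def zero_prod_def)
  moreover have "(\<Sum>a\<in>Poly_Mapping.keys X. Poly_Mapping.single a (Poly_Mapping.lookup X a)) = X"
    by (rule poly_mapping_eqI) (simp add: lookup_sum lookup_single when_def in_keys_iff)
  ultimately show ?thesis by simp
qed

lemma sum_sharp: "(\<Sum>a\<in>Poly_Mapping.keys X. sharp (Poly_Mapping.lookup X a) a) = (sharp_loop X, 0)"
proof -
  have "(\<Sum>a\<in>F. sharp (Poly_Mapping.lookup X a) a) =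
      (\<Sum>a\<in>F. Poly_Mapping.single (- a) (mscale (sgn_pow a) (Poly_Mapping.lookup X a)), 0)" if "finite F" for F
    using that by (induction F) (simp_all add: sharp_def laff_def sgn_pow_def zero_prod_def)
  then show ?thesis by (simp add: sharp_loop_def)
qed

lemma additive_sum:
  fixes f :: "'x::ab_group_add \<Rightarrow> 'y::ab_group_add"
  assumes "\<And>x y. f (x + y) = f x + f y"
  shows "f (sum h F) = (\<Sum>i\<in>F. f (h i))"
proof -
  have "f 0 = 0" using assms[of 0 0] by simp
  then show ?thesis by (induction F rule: infinite_finite_induct) (simp_all add: assms)
qed

lemma graded_loops_add: "X \<in> graded_loops \<nu> l s \<Longrightarrow> Y \<in> graded_loops \<nu> l s \<Longrightarrow> X + Y \<in> graded_loops \<nu> l s"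
  by (auto simp: graded_loops_def lookup_add) (metis add.right_neutral)

lemma graded_loops_zero: "0 \<in> graded_loops \<nu> l s"
  by (simp add: graded_loops_def)

lemma graded_loops_single:
  "X \<in> graded_loops \<nu> l s \<Longrightarrow> Poly_Mapping.single a (Poly_Mapping.lookup X a) \<in> graded_loops \<nu> l s"
  by (auto simp: graded_loops_def lookup_single when_def)

text \<open>\<open>sharp\<close> negates the degree and keeps the position of the matrix entry, so
  divisibility of \<open>a + b\<close> becomes divisibility of \<open>- a - b\<close>: a loop fixed
  by the twist of the loop algebra yields elements fixed by \<open>F\<close>.\<close>

lemma graded_loops_sharp:
  assumes "X \<in> graded_loops \<nu> l (- 1)"
  shows "Poly_Mapping.single (- a) (mscale k (Poly_Mapping.lookup X a)) \<in> graded_loops \<nu> l 1"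
  unfolding graded_loops_def
proof (intro CollectI allI impI)
  fix b i j assume "Poly_Mapping.lookup (Poly_Mapping.single (- a) (mscale k (Poly_Mapping.lookup X a))) b $ i $ j \<noteq> 0"
  then have b: "b = - a" "Poly_Mapping.lookup X a $ i $ j \<noteq> 0" by (auto simp: lookup_single when_def split: if_splits)
  then have "int l dvd a - (- 1) * bdeg \<nu> i j" using assms by (auto simp: graded_loops_def)
  then have "int l dvd - (a - (- 1) * bdeg \<nu> i j)" by (simp only: dvd_minus_iff)
  then show "int l dvd b - 1 * bdeg \<nu> i j" by (simp add: b)
qed

theorem proposition4p6:
  fixes \<epsilon> \<kappa> c :: complex
    and l :: nat
    and \<nu> :: "nat \<Rightarrow> nat"
    and M :: "(complex, 'b) module"
    and \<rho> :: "'m::{finite,linorder} affine \<Rightarrow> 'b \<Rightarrow> 'b"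
    and M' :: "(complex, 'a) module"
    and \<rho>' :: "'m affine \<Rightarrow> 'a \<Rightarrow> 'a"
  defines "g \<equiv> geps \<nu> \<epsilon> :: (complex, 'm) sqmat"
  defines "\<rho>N \<equiv> transport (aff_fixed g \<epsilon>) (kappa \<nu> l) \<rho>"
    and "\<rho>N'' \<equiv> transport (aff_fixed g (inverse \<epsilon>)) (kappa' \<nu> l) \<rho>'"
  assumes "l \<ge> 1"
    and "roots_group l = range (\<lambda>k::nat. \<epsilon> ^ k)"
    and "\<kappa> \<noteq> 0"
    and "c = \<kappa> - of_nat CARD('m)"
    and "(\<Sum>p=1..l. \<nu> p) = CARD('m)"
    and "lie_module (aff_fixed g \<epsilon>) M \<rho>"
    and "has_level l c M \<rho>"
    and "almost_smooth (aff_fixed g \<epsilon>) M \<rho>"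
    and "lie_module (aff_fixed g (inverse \<epsilon>)) M' \<rho>'"
    and "has_level l c M' \<rho>'"
    and "almost_smooth (aff_fixed g (inverse \<epsilon>)) M' \<rho>'"
  shows "\<exists>\<Phi> \<in> lin_maps (ring_on (Rloc \<epsilon> l :: 'n::{finite,linorder} ratf set))
                (TR_mod \<epsilon> l M' M) (TE_mod \<epsilon> l M' M).
     (\<forall>u'\<in>carrier M'. \<forall>v. \<forall>u\<in>carrier M.
        \<Phi> (TR_tensor \<epsilon> l M' M (T_pure M' M u' v u) 1) =
        TE_pure \<epsilon> l M' M u'
          (\<lambda>i. dual_grp (cochar \<nu> (xvar i)) (\<chi> j. rconst (v i $ j) :: ('n ratf, 'm) vec)) u) \<and>
     (\<exists>\<Psi>. (\<forall>t\<in>carrier (TR_mod \<epsilon> l M' M).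
              \<Psi> (coinv_proj \<epsilon> l g M' \<rho>' M \<rho> t) = CE_proj \<epsilon> l M' \<rho>N'' M \<rho>N (\<Phi> t)) \<and>
          equivariant_iso (Balg \<epsilon> l)
            (coinv \<epsilon> l g M' \<rho>' M \<rho>) (B_coinv \<epsilon> l g M' \<rho>' M \<rho>)
            (CE_mod \<epsilon> l M' \<rho>N'' M \<rho>N) (B_CE \<epsilon> l M' \<rho>N'' M \<rho>N) \<Psi>)"
proof -
  note \<nu> = \<open>(\<Sum>p=1..l. \<nu> p) = CARD('m)\<close>
  note M = \<open>lie_module (aff_fixed g \<epsilon>) M \<rho>\<close> and lev = \<open>has_level l c M \<rho>\<close>
  note M' = \<open>lie_module (aff_fixed g (inverse \<epsilon>)) M' \<rho>'\<close> and lev' = \<open>has_level l c M' \<rho>'\<close>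
  interpret E: root_of_unity \<epsilon> l by (rule root_of_unity.intro) fact+
  interpret M: smod UNIV M by (rule lie_moduleD(1)[OF M])
  interpret M': smod UNIV M' by (rule lie_moduleD(1)[OF M'])
  let ?L = "aff_fixed g \<epsilon>" and ?L' = "aff_fixed g (inverse \<epsilon>)"
  have L: "\<eta> \<in> ?L \<longleftrightarrow> fst \<eta> \<in> graded_loops \<nu> l 1" for \<eta>
    unfolding g_def by (simp add: aff_fixed_iff E.loop_fixed_eps)
  have L': "\<eta> \<in> ?L' \<longleftrightarrow> fst \<eta> \<in> graded_loops \<nu> l (- 1)" for \<eta>
    unfolding g_def by (simp add: aff_fixed_iff E.loop_fixed_inverse_eps)
  have Lc: "0 \<in> ?L" "\<And>\<eta> \<theta>. \<eta> \<in> ?L \<Longrightarrow> \<theta> \<in> ?L \<Longrightarrow> \<eta> + \<theta> \<in> ?L" "\<And>s. (0, s) \<in> ?L"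
    by (simp_all add: L graded_loops_add graded_loops_zero)
  have Lc': "0 \<in> ?L'" "\<And>\<eta> \<theta>. \<eta> \<in> ?L' \<Longrightarrow> \<theta> \<in> ?L' \<Longrightarrow> \<eta> + \<theta> \<in> ?L'" "\<And>s. (0, s) \<in> ?L'"
    by (simp_all add: L' graded_loops_add graded_loops_zero)
  have \<rho>N: "\<rho>N \<theta> = \<rho> (kappa_inv \<nu> l \<theta>)" for \<theta>
    unfolding \<rho>N_def transport_def g_def E.inv_into_kappa[OF \<nu>] ..
  have \<rho>N'': "\<rho>N'' \<theta> = \<rho>' (kappa'_inv \<nu> l \<theta>)" for \<theta>
    unfolding \<rho>N''_def transport_def g_def E.inv_into_kappa'[OF \<nu>] ..
  have kL: "kappa_inv \<nu> l \<theta> \<in> ?L" for \<theta> unfolding g_def by (rule E.kappa_inv_fixed[OF \<nu>])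
  have kL': "kappa'_inv \<nu> l \<theta> \<in> ?L'" for \<theta> unfolding g_def by (rule E.kappa'_inv_fixed[OF \<nu>])
  have laffL: "laff (Poly_Mapping.lookup X a) a \<in> ?L'" if "X \<in> graded_loops \<nu> l (- 1)" for X a
    using graded_loops_single[OF that] by (simp add: L' laff_def)
  have sharpL: "sharp (Poly_Mapping.lookup X a) a \<in> ?L" if "X \<in> graded_loops \<nu> l (- 1)" for X a
    using graded_loops_sharp[OF that] by (simp add: L sharp_def laff_def)
  interpret A: coinv_data M' M \<epsilon> l \<nu> \<rho>' \<rho>
    by unfold_locales (use lie_moduleD(2)[OF M'] laffL lie_moduleD(2)[OF M] sharpL in blast)+
  interpret O1: root_of_unity 1 1 by (rule root_of_unity_1)
  interpret O: coinv_data M' M 1 1 \<nu> \<rho>N'' \<rho>N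
    by unfold_locales (simp_all add: \<rho>N \<rho>N'' lie_moduleD(2)[OF M'] lie_moduleD(2)[OF M] kL kL')
  \<comment> \<open>The central component of \<open>kappa'_inv\<close> at \<open>(Y, 0)\<close>,
    multiplied by the scalar \<open>c / l\<close> by which \<open>(0, 1)\<close> acts.\<close>
  define s where "s Y = - trace (gcheck \<nu> ** Poly_Mapping.lookup (up \<nu> l (\<lambda>_. 1) (- 1) Y) 0) * (c / of_nat l)"
    for Y :: "'m loop"
  interpret comparison M' M \<epsilon> l \<nu> \<rho>' \<rho> \<rho>N'' \<rho>N s
  proof unfold_locales
    show "(\<Sum>p=1..l. \<nu> p) = CARD('m)" by (rule \<nu>)
    fix Y :: "'m loop"
    let ?X = "up \<nu> l (\<lambda>_. 1) (- 1) Y"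
    let ?t = "trace (gcheck \<nu> ** Poly_Mapping.lookup ?X 0)"
    have X: "?X \<in> graded_loops \<nu> l (- 1)" by (rule up_in_graded_loops[OF \<nu> E.l])
    show "O.left_op Y u' = A.left_op ?X u' \<oplus>\<^bsub>M'\<^esub> s Y \<odot>\<^bsub>M'\<^esub> u'" if u': "u' \<in> carrier M'" for u'
    proof -
      have "O.left_op Y u' = (\<Oplus>\<^bsub>M'\<^esub>k\<in>Poly_Mapping.keys Y. \<rho>' (kappa'_inv \<nu> l (laff (Poly_Mapping.lookup Y k) k)) u')"
        by (simp add: O.left_op_def \<rho>N'')
      also have "\<dots> = \<rho>' (\<Sum>k\<in>Poly_Mapping.keys Y. kappa'_inv \<nu> l (laff (Poly_Mapping.lookup Y k) k)) u'"
        by (rule lie_module_sum[OF M' Lc'(1,2) finite_keys kL' u', symmetric])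
      also have "(\<Sum>k\<in>Poly_Mapping.keys Y. kappa'_inv \<nu> l (laff (Poly_Mapping.lookup Y k) k)) = kappa'_inv \<nu> l (Y, 0)"
        unfolding sum_laff[symmetric] by (rule additive_sum[OF E.kappa'_inv_add[OF \<nu>], symmetric])
      also have "\<dots> = (?X, - ?t)" by (simp add: kappa'_inv_def Let_def)
      also have "\<rho>' (?X, - ?t) u' = \<rho>' (?X, 0) u' \<oplus>\<^bsub>M'\<^esub> s Y \<odot>\<^bsub>M'\<^esub> u'"
        unfolding s_def by (rule lie_module_central[OF M' lev' _ Lc'(3) u']) (simp add: L' X)
      also have "\<rho>' (?X, 0) u' = A.left_op ?X u'"
        unfolding A.left_op_def sum_laff[symmetric]
        by (rule lie_module_sum[OF M' Lc'(1,2) finite_keys laffL[OF X] u'])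
      finally show ?thesis .
    qed
    show "O.right_op Y u = A.right_op ?X u \<oplus>\<^bsub>M\<^esub> (- s Y) \<odot>\<^bsub>M\<^esub> u" if u: "u \<in> carrier M" for u
    proof -
      have "O.right_op Y u = (\<Oplus>\<^bsub>M\<^esub>k\<in>Poly_Mapping.keys Y. \<rho> (kappa_inv \<nu> l (sharp (Poly_Mapping.lookup Y k) k)) u)"
        by (simp add: O.right_op_def \<rho>N)
      also have "\<dots> = \<rho> (\<Sum>k\<in>Poly_Mapping.keys Y. kappa_inv \<nu> l (sharp (Poly_Mapping.lookup Y k) k)) u"
        by (rule lie_module_sum[OF M Lc(1,2) finite_keys kL u, symmetric])
      also have "(\<Sum>k\<in>Poly_Mapping.keys Y. kappa_inv \<nu> l (sharp (Poly_Mapping.lookup Y k) k)) = kappa_inv \<nu> l (sharp_loop Y, 0)"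
        unfolding sum_sharp[symmetric] by (rule additive_sum[OF E.kappa_inv_add[OF \<nu>], symmetric])
      \<comment> \<open>The sharp operation keeps the degree zero coefficient, so the trace is the
        one from the first factor, now with the opposite sign.\<close>
      also have "\<dots> = (sharp_loop ?X, ?t)"
      proof -
        have "Poly_Mapping.lookup (sharp_loop ?X) 0 = Poly_Mapping.lookup ?X 0"
          by (simp add: lookup_sharp_loop sgn_pow_def vec_eq_iff)
        then show ?thesis by (simp add: kappa_inv_def Let_def E.up_sharp_loop[OF \<nu>])
      qed
      also have "\<rho> (sharp_loop ?X, ?t) u = \<rho> (sharp_loop ?X, 0) u \<oplus>\<^bsub>M\<^esub> (?t * (c / of_nat l)) \<odot>\<^bsub>M\<^esub> u"
      proof (rule lie_module_central[OF M lev _ Lc(3) u])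
        have "kappa_inv \<nu> l (sharp_loop Y, 0) \<in> ?L" by (rule kL)
        then show "(sharp_loop ?X, 0) \<in> ?L" by (simp add: L kappa_inv_def Let_def E.up_sharp_loop[OF \<nu>])
      qed
      also have "?t * (c / of_nat l) = - s Y" by (simp add: s_def)
      also have "\<rho> (sharp_loop ?X, 0) u = A.right_op ?X u"
        unfolding A.right_op_def sum_sharp[symmetric]
        by (rule lie_module_sum[OF M Lc(1,2) finite_keys sharpL[OF X] u])
      finally show ?thesis .
    qed
  qed
  obtain \<Phi> where \<Phi>: "semilinear (Rloc \<epsilon> l) id A.TR TE \<Phi>"
    "\<And>u' J u. u' \<in> carrier M' \<Longrightarrow> u \<in> carrier M \<Longrightarrow> \<Phi> (A.bas u' J u) = xw J \<odot>\<^bsub>TE\<^esub> te (O.bas u' J u) 1"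
    "\<And>u' v u. u' \<in> carrier M' \<Longrightarrow> u \<in> carrier M \<Longrightarrow>
      \<Phi> (TR_tensor \<epsilon> l M' M (T_pure M' M u' v u) 1) =
      TE_pure \<epsilon> l M' M u'
        (\<lambda>i. dual_grp (cochar \<nu> (xvar i)) (\<chi> j. rconst (v i $ j) :: ('n ratf, 'm) vec)) u"
    by (rule obtain_Phi) (rule that; assumption)
  obtain \<Psi> where \<Psi>: "semilinear (Rloc \<epsilon> l) id A.Co CE \<Psi>"
    "\<And>t. t \<in> carrier A.TR \<Longrightarrow> \<Psi> (A.proj t) = CE_proj \<epsilon> l M' \<rho>N'' M \<rho>N (\<Phi> t)"
    "\<And>u' J u. u' \<in> carrier M' \<Longrightarrow> u \<in> carrier M \<Longrightarrow> \<Psi> (A.proj (A.bas u' J u)) = xw J \<odot>\<^bsub>CE\<^esub> Q u' J u"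
    by (rule obtain_theta[OF \<Phi>(1,2)]) (assumption, assumption, (rule that; assumption))
  note iso = comparison_iso[OF \<Psi>(1,3)]
  show ?thesis
    unfolding g_def
  proof (rule bexI[of _ \<Phi>], intro conjI ballI allI exI[of _ \<Psi>])
    show "\<Phi> \<in> lin_maps (ring_on (Rloc \<epsilon> l)) A.TR TE" unfolding lin_maps_iff by (rule \<Phi>(1))
  qed (rule \<Phi>(3), assumption, assumption, rule \<Psi>(2), assumption, rule iso, assumption+)
qed

end
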